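(* Consider the generalized linear model with density $f(y,h)$, the i.i.d. data $D^n$ from the true density $p^*(y|x)=f(y,x^T\beta^* )$, and the truncated i.i.d.-binary / Gaussian variable selection prior with parameters $r_n,\bar r_n,\{V_\gamma\}$, all as described in the context. Assume $|x_j|\le 1$ for all $j$ and $\lim_{n\to\infty}\sum_{j=1}^{K_n}|\beta_j^*|<\infty$, where $K_n$ is a nondecreasing sequence in $n$. Define $$\Delta(r_n)=\inf_{\gamma:|\gamma|=r_n}\sum_{j:j\notin\gamma}|\beta_j^*|,\quad B(r_n)=\sup_{\gamma:|\gamma|=r_n}\mathrm{ch}_1(V_\gamma^{-1}),\quad \bar B(r_n)=\sup_{\gamma:|\gamma|=r_n}\mathrm{ch}_1(V_\gamma),\quad \tilde B_n=\sup_{\gamma:|\gamma|\le\bar r_n}\mathrm{ch}_1(V_\gamma),$$ and $D(R)=1+R\cdot\sup_{|h|\le R}|a'(h)|\cdot\sup_{|h|\le R}|\psi(h)|$ for $R>0$. Let $\varepsilon_n\in(0,1]$ be a sequence with $n\varepsilon_n^2\succ 1$, and assume $$\bar r_n\ln(1/\varepsilon_n^2)\prec n\varepsilon_n^2,\qquad \bar r_n\ln(K_n)\prec n\varepsilon_n^2,\qquad \bar r_n\ln D\big(\bar r_n\sqrt{n\varepsilon_n^2\tilde B_n}\big)\prec n\varepsilon_n^2,$$ $$1\le r_n\le\bar r_n<K_n,\qquad 1\prec r_n\prec K_n,\qquad \Delta(r_n)\prec\varepsilon_n^2,\qquad B(r_n)\prec n\varepsilon_n^2,\qquad r_n\ln\bar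 B(r_n)\prec n\varepsilon_n^2.$$ Let $d(p,p^* )^2=\int\int|p(y,x|\gamma,\beta_\gamma)^{1/2}-p^*(y,x)^{1/2}|^2\,\nu_y(dy)\,\nu_x(dx)$. Then: (i) for some $r_0>0$, $\lim_{n\to\infty}P^*\{\pi[d(p,p^* )\le\varepsilon_n|D^n]\ge 1-e^{-r_0n\varepsilon_n^2}\}=1$; (ii) for some $c_1>0$ and all sufficiently large $n$, $P^*\{\pi[d(p,p^* )>\varepsilon_n|D^n]\ge e^{-0.5c_1n\varepsilon_n^2}\}\le e^{-0.5c_1n\varepsilon_n^2}$; (iii) for some $c_1>0$ and all sufficiently large $n$, $E^*_{D^n}\,\pi[d(p,p^* )>\varepsilon_n|D^n]\le e^{-c_1n\varepsilon_n^2}$.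
   Context: Notation. For sequences, $a_n\prec b_n$ (equivalently $b_n\succ a_n$) means $\lim_{n\to\infty}a_n/b_n=0$. $\mathrm{ch}_1$ denotes the largest eigenvalue of a symmetric matrix. For a vector $v$, $|v|$ is the sum of absolute values of its components. Model. For each $n$, $x=(x_1,\dots,x_{K_n})^T$ is a random vector with probability law $\nu_x(dx)$, and $y$ is a real response with dominating measure $\nu_y(dy)$. The GLM density is $f(y,h)=\exp\{a(h)y+b(h)+c(y)\}$, a probability density with respect to $\nu_y$ for each real $h$, where $a,b$ are continuously differentiable and $a$ has nonzero derivative; its mean is $\psi(h)=-b'(h)/a'(h)$. The true conditional density of $y$ given $x$ is $p^*(y|x)=f(y,x^T\beta^* )$ for a true vector $\beta^*=(\beta_1^*,\dots,\beta_{K_n}^* )^T$; it is also the joint density $p^*(y,x)$ of $(x,y)$ with respect to $\nu_x(dx)\nu_y(dy)$. The data $D^n=(x^{(i)},y^{(i)})_{i=1}^n$ are i.i.d. from $p^*\,\nu_x(dx)\nu_y(dy)$; $P^*$ and $E^*_{D^n}$ denote probability and expectation for $D^n$. Fitted models. A model is $\gamma=(\gamma_1,\dots,\gamma_{K_n})\in\{0,1\}^{K_n}$, identified with the index set $\{j:\gamma_j=1\}$; $|\gamma|$ is its size; $v_\gamma$ is the subvector of $v$ with indices in $\gamma$. With coefficients $\beta_\gamma\in\mathbb R^{|\gamma|}$ the fitted density is $p(y,x|\gamma,\beta_\gamma)=f(y,x_\gamma^T\beta_\gamma)$ (linear parameter $0$ for the empty model). Suprema of eigenvalues of $V_\gamma$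 are over nonempty $\gamma\subset\{1,\dots,K_n\}$. Prior. $r_n\le\bar r_n$ are integers. Let $\tilde\gamma_1,\dots,\tilde\gamma_{K_n}$ be i.i.d. binary with $\pi(\tilde\gamma_j=1)=\lambda_n=r_n/K_n$; $\gamma$ is distributed as $\tilde\gamma$ conditioned on $\sum_j\tilde\gamma_j\le\bar r_n$, i.e. $\pi(\gamma)\propto\prod_{j=1}^{K_n}\lambda_n^{\gamma_j}(1-\lambda_n)^{1-\gamma_j}\,I[\sum_l\gamma_l\le\bar r_n]$. Conditional on $\gamma$, $\beta_\gamma\sim N(0,V_\gamma)$ with $V_\gamma$ a given $|\gamma|\times|\gamma|$ (positive definite) covariance matrix. The posterior is $$\pi(\gamma,d\beta_\gamma|D^n)=\frac{\prod_{i=1}^np(y^{(i)},x^{(i)}|\gamma,\beta_\gamma)\,\pi(\gamma,d\beta_\gamma)}{\sum_{\gamma'}\int\prod_{i=1}^np(y^{(i)},x^{(i)}|\gamma',\beta'_{\gamma'})\,\pi(\gamma',d\beta'_{\gamma'})},$$ and it induces a posterior distribution on densities $p=p(\cdot|\gamma,\beta_\gamma)$. *)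

theory Defs
  imports
    "HOL-Probability.Probability"
    "Jordan_Normal_Form.Char_Poly"
    "Jordan_Normal_Form.Gauss_Jordan_Elimination"
begin

text \<open>The relation \<open>\<prec>\<close> between sequences; that symbol already denotes \<open>lesspoll\<close>.\<close>

definition seq_prec :: "(nat \<Rightarrow> real) \<Rightarrow> (nat \<Rightarrow> real) \<Rightarrow> bool"  (infix "\<lless>" 50) where
  "u \<lless> v \<longleftrightarrow> (\<lambda>n. u n / v n) \<longlonglongrightarrow> 0"


subsection \<open>Matrices\<close>

definition pos_def_mat :: "nat \<Rightarrow> real mat \<Rightarrow> bool" where
  "pos_def_mat k A \<longleftrightarrow> A \<in> carrier_mat k k \<and> transpose_mat A = A \<and>
     (\<forall>v \<in> carrier_vec k. v \<noteq> 0\<^sub>v k \<longrightarrow> scalar_prod v (mult_mat_vec A v) > 0)"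

definition ch1 :: "real mat \<Rightarrow> real" where
  "ch1 A = Max {k. eigenvalue A k}"

definition inv_mat :: "real mat \<Rightarrow> real mat" where
  "inv_mat A = the (mat_inverse A)"


subsection \<open>The generalized linear model\<close>

definition glm_density :: "(real \<Rightarrow> real) \<Rightarrow> (real \<Rightarrow> real) \<Rightarrow> (real \<Rightarrow> real) \<Rightarrow> real \<Rightarrow> real \<Rightarrow> real" where
  "glm_density a b c y h = exp (a h * y + b h + c y)"

definition glm_mean :: "(real \<Rightarrow> real) \<Rightarrow> (real \<Rightarrow> real) \<Rightarrow> real \<Rightarrow> real" where
  "glm_mean a b h = - deriv b h / deriv a h"

text \<open>Covariates are indexed by \<open>{..<K}\<close> and models are subsets of \<open>{..<K}\<close>; a vector with index set
  \<open>J\<close> is a function that is only read on \<open>J\<close>, so the subvector \<open>x\<^sub>\<gamma>\<close> needs no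
  separate notation. The empty model has linear parameter 0.\<close>

definition lin_par :: "nat set \<Rightarrow> (nat \<Rightarrow> real) \<Rightarrow> (nat \<Rightarrow> real) \<Rightarrow> real" where
  "lin_par J x \<beta> = (\<Sum>j\<in>J. x j * \<beta> j)"

text \<open>The density of \<open>(x, y)\<close> with respect to \<open>\<nu>\<^sub>x(dx) \<nu>\<^sub>y(dy)\<close>. The fitted
  density is the case \<open>J = \<gamma>\<close>, the true density the case \<open>J = {..<K}\<close>, \<open>\<beta> = \<beta>\<^sup>*\<close>.\<close>

definition model_density ::
    "(real \<Rightarrow> real \<Rightarrow> real) \<Rightarrow> nat set \<Rightarrow> (nat \<Rightarrow> real) \<Rightarrow> (nat \<Rightarrow> real) \<times> real \<Rightarrow> real" where
  "model_density f J \<beta> = (\<lambda>(x, y). f y (lin_par J x \<beta>))"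

text \<open>Law of \<open>n\<close> i.i.d. observations \<open>(x, y)\<close> from the density \<open>p\<close>.\<close>

definition data_law ::
    "(nat \<Rightarrow> real) measure \<Rightarrow> real measure \<Rightarrow> ((nat \<Rightarrow> real) \<times> real \<Rightarrow> real) \<Rightarrow> nat
      \<Rightarrow> (nat \<Rightarrow> (nat \<Rightarrow> real) \<times> real) measure" where
  "data_law \<nu>x \<nu>y p n = PiM {..<n} (\<lambda>_. density (\<nu>x \<Otimes>\<^sub>M \<nu>y) (\<lambda>z. ennreal (p z)))"

definition hellinger_dist ::
    "(nat \<Rightarrow> real) measure \<Rightarrow> real measure \<Rightarrow> ((nat \<Rightarrow> real) \<times> real \<Rightarrow> real)
      \<Rightarrow> ((nat \<Rightarrow> real) \<times> real \<Rightarrow> real) \<Rightarrow> real" where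
  "hellinger_dist \<nu>x \<nu>y p q =
     sqrt (\<integral>x. (\<integral>y. \<bar>sqrt (p (x, y)) - sqrt (q (x, y))\<bar>\<^sup>2 \<partial>\<nu>y) \<partial>\<nu>x)"


subsection \<open>Prior and posterior\<close>

definition model_weight :: "nat \<Rightarrow> nat \<Rightarrow> nat \<Rightarrow> nat set \<Rightarrow> real" where
  "model_weight K r rbar \<gamma> =
     (\<Prod>j<K. if j \<in> \<gamma> then real r / real K else 1 - real r / real K)
       * (if card \<gamma> \<le> rbar then 1 else 0)"

definition model_prior :: "nat \<Rightarrow> nat \<Rightarrow> nat \<Rightarrow> nat set \<Rightarrow> real" where
  "model_prior K r rbar \<gamma> =
     model_weight K r rbar \<gamma> / (\<Sum>\<gamma>'\<in>Pow {..<K}. model_weight K r rbar \<gamma>')"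

text \<open>Row and column \<open>i\<close> of \<open>V\<^sub>\<gamma>\<close> belong to the \<open>i\<close>-th smallest element of \<open>\<gamma>\<close>.\<close>

definition coef_vec :: "nat set \<Rightarrow> (nat \<Rightarrow> real) \<Rightarrow> real vec" where
  "coef_vec \<gamma> \<beta> = Matrix.vec (card \<gamma>) (\<lambda>i. \<beta> (sorted_list_of_set \<gamma> ! i))"

definition mvn_density :: "nat \<Rightarrow> real mat \<Rightarrow> real vec \<Rightarrow> real" where
  "mvn_density k V v =
     exp (- scalar_prod v (mult_mat_vec (inv_mat V) v) / 2) / sqrt ((2 * pi) ^ k * Determinant.det V)"

text \<open>The law \<open>N(0, V)\<close> on vectors with index set \<open>\<gamma>\<close>; for the empty index set this is
  the point mass at the empty vector.\<close>

definition coef_prior :: "real mat \<Rightarrow> nat set \<Rightarrow> (nat \<Rightarrow> real) measure" where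
  "coef_prior V \<gamma> =
     density (PiM \<gamma> (\<lambda>_. lborel)) (\<lambda>\<beta>. ennreal (mvn_density (card \<gamma>) V (coef_vec \<gamma> \<beta>)))"

definition likelihood ::
    "(real \<Rightarrow> real \<Rightarrow> real) \<Rightarrow> nat \<Rightarrow> (nat \<Rightarrow> (nat \<Rightarrow> real) \<times> real) \<Rightarrow> nat set \<Rightarrow> (nat \<Rightarrow> real) \<Rightarrow> real" where
  "likelihood f n D \<gamma> \<beta> = (\<Prod>i<n. model_density f \<gamma> \<beta> (D i))"

text \<open>The mass of a set \<open>A\<close> of pairs \<open>(\<gamma>, \<beta>\<^sub>\<gamma>)\<close> under likelihood times prior.\<close>

definition joint_mass ::
    "(real \<Rightarrow> real \<Rightarrow> real) \<Rightarrow> nat \<Rightarrow> nat \<Rightarrow> nat \<Rightarrow> (nat set \<Rightarrow> real mat) \<Rightarrow> nat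
      \<Rightarrow> (nat \<Rightarrow> (nat \<Rightarrow> real) \<times> real) \<Rightarrow> (nat set \<times> (nat \<Rightarrow> real)) set \<Rightarrow> ennreal" where
  "joint_mass f K r rbar V n D A =
     (\<Sum>\<gamma>\<in>Pow {..<K}. ennreal (model_prior K r rbar \<gamma>) *
        (\<integral>\<^sup>+\<beta>. ennreal (likelihood f n D \<gamma> \<beta>) * indicator A (\<gamma>, \<beta>) \<partial>coef_prior (V \<gamma>) \<gamma>))"

text \<open>The denominator is positive everywhere and finite for almost every data set.\<close>

definition posterior ::
    "(real \<Rightarrow> real \<Rightarrow> real) \<Rightarrow> nat \<Rightarrow> nat \<Rightarrow> nat \<Rightarrow> (nat set \<Rightarrow> real mat) \<Rightarrow> nat
      \<Rightarrow> (nat \<Rightarrow> (nat \<Rightarrow> real) \<times> real) \<Rightarrow> (nat set \<times> (nat \<Rightarrow> real)) set \<Rightarrow> real" where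
  "posterior f K r rbar V n D A =
     enn2real (joint_mass f K r rbar V n D A / joint_mass f K r rbar V n D UNIV)"


subsection \<open>Quantities entering the rate conditions\<close>

definition models_of_size :: "nat \<Rightarrow> nat \<Rightarrow> nat set set" where
  "models_of_size K r = {\<gamma>. \<gamma> \<subseteq> {..<K} \<and> card \<gamma> = r}"

definition tail_sum :: "nat \<Rightarrow> (nat \<Rightarrow> real) \<Rightarrow> nat \<Rightarrow> real" where
  "tail_sum K \<beta> r = (INF \<gamma>\<in>models_of_size K r. \<Sum>j\<in>{..<K} - \<gamma>. \<bar>\<beta> j\<bar>)"

definition sup_ch1_inv :: "nat \<Rightarrow> (nat set \<Rightarrow> real mat) \<Rightarrow> nat \<Rightarrow> real" where
  "sup_ch1_inv K V r = (SUP \<gamma>\<in>models_of_size K r. ch1 (inv_mat (V \<gamma>)))"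

definition sup_ch1 :: "nat \<Rightarrow> (nat set \<Rightarrow> real mat) \<Rightarrow> nat \<Rightarrow> real" where
  "sup_ch1 K V r = (SUP \<gamma>\<in>models_of_size K r. ch1 (V \<gamma>))"

definition sup_ch1_upto :: "nat \<Rightarrow> (nat set \<Rightarrow> real mat) \<Rightarrow> nat \<Rightarrow> real" where
  "sup_ch1_upto K V rbar =
     (SUP \<gamma>\<in>{\<gamma>. \<gamma> \<subseteq> {..<K} \<and> \<gamma> \<noteq> {} \<and> card \<gamma> \<le> rbar}. ch1 (V \<gamma>))"

definition growth_D :: "(real \<Rightarrow> real) \<Rightarrow> (real \<Rightarrow> real) \<Rightarrow> real \<Rightarrow> real" where
  "growth_D a b R =
     1 + R * (SUP h\<in>{h. \<bar>h\<bar> \<le> R}. \<bar>deriv a h\<bar>) * (SUP h\<in>{h. \<bar>h\<bar> \<le> R}. \<bar>glm_mean a b h\<bar>)"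

end

theory Submission
  imports Defs
begin

text \<open>
The argument is the evidence-and-sieve scheme for posterior contraction, with all bounds in
expectation under the true law. Write \<open>n \<epsilon>\<^sup>2\<close> for the rate, divide every likelihood by the true one,
and let \<open>Z\<close> be the integral of the likelihood ratio against the whole prior. The posterior mass of a
set is then the integral of the ratio over that set, divided by \<open>Z\<close>.

The denominator \<open>Z\<close> is rarely smaller than \<open>exp (- c n \<epsilon>\<^sup>2)\<close>, whatever the constant \<open>c > 0\<close>. By Cauchy-Schwarz, the expectation of \<open>1 / Z\<close> is
at most \<open>\<kappa>\<^sup>n / w\<close> if a set of prior mass \<open>w\<close> consists of densities whose inverse likelihood ratio has
mean at most \<open>\<kappa>\<close> (\<open>expected_inverse_evidence\<close>). The set is a small box around the \<open>r\<^sub>n\<close> largest true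
coefficients. Its densities have \<open>\<kappa> \<le> exp (C \<bar>h - h\<^sup>*\<bar>)\<close>, because in an exponential family the mean
of \<open>p\<^sup>* / p\<close> is again an exponential of values of \<open>b\<close>, at the reflection of \<open>h\<close> about \<open>h\<^sup>*\<close>
(\<open>chi_square_bound\<close>). The linear bound in \<open>h - h\<^sup>*\<close> is why \<open>\<Delta>(r\<^sub>n) \<prec> \<epsilon>\<^sub>n\<^sup>2\<close> is the right condition on
the neglected coefficients. The prior mass of the box is read off the Gaussian density
(\<open>coef_prior_box\<close>, \<open>model_prior_lower\<close>), and the conditions on \<open>B\<close>, \<open>B\<close>-bar and \<open>r\<^sub>n ln K\<^sub>n\<close> make its
logarithm negligible against \<open>n \<epsilon>\<^sup>2\<close>.

The numerator splits into coefficient vectors with an entry beyond \<open>C\<^sub>n = sqrt (n \<epsilon>\<^sup>2 b\<^sub>n)\<close>, with \<open>b\<^sub>n\<close>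
the largest eigenvalue of all covariance matrices \<open>V\<^sub>\<gamma>\<close>, and a sieve of bounded ones. The first part has expectation equal to its prior mass, which a Gaussian
tail bound controls (\<open>coef_prior_tail\<close>). The sieve is cut into cubes, so small that the densities in
one cube are within Hellinger distance \<open>\<epsilon> / 2\<close>. Here the bound \<open>d\<^sup>2 \<le> \<bar>h\<^sub>1 - h\<^sub>2\<bar> sup \<bar>a'\<bar> sup \<bar>\<psi>\<bar>\<close> enters
(\<open>hellinger_le\<close>), and the number of cubes is at most \<open>(11 D / \<epsilon>\<^sup>2)\<^sup>r\<close> per model, with \<open>r\<close> the largest
model size.

For a cube that meets \<open>{d > \<epsilon>}\<close>, consider with Walker the square root of the integrated likelihood
ratio over the cube. Adding one observation multiplies it, in mean, by
the affinity between the true density and a mixture of densities of the cube. Hellinger balls are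
convex, so the mixture is still at distance at least \<open>\<epsilon> / 2\<close> from the truth, and the affinity is
at most \<open>1 - \<epsilon>\<^sup>2 / 8\<close> (\<open>affinity_mixture\<close>, \<open>sqrt_integrated_likelihood_decay\<close>). Since posterior
probabilities are at most one, the posterior mass of the sieve part is at most the square root of
itself, so these roots may simply be added over the cubes.

The three bounds are added in \<open>expected_posterior\<close>. With the explicit constants of
\<open>expected_posterior_rate\<close>, this gives claim (iii) with \<open>c\<^sub>1 = 1/80\<close>. Claims (ii) and (i) follow by
Markov's inequality.
\<close>

section \<open>Square roots of extended nonnegative reals\<close>

text \<open>The value \<open>\<infinity>\<close> at \<open>\<infinity>\<close> makes \<open>esqrt x * esqrt x = x\<close> hold without exception. Integrated likelihoods, which
may be infinite on a null set, can then be handled without finiteness side conditions.\<close>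

definition esqrt :: "ennreal \<Rightarrow> ennreal" where
  "esqrt x = (if x = \<infinity> then \<infinity> else ennreal (sqrt (enn2real x)))"

lemma esqrt_ennreal: "r \<ge> 0 \<Longrightarrow> esqrt (ennreal r) = ennreal (sqrt r)"
  by (simp add: esqrt_def)

lemma esqrt_top [simp]: "esqrt Orderings.top = Orderings.top"
  by (simp add: esqrt_def)

lemma measurable_esqrt [measurable]: "esqrt \<in> borel_measurable borel"
  unfolding esqrt_def by measurable

lemma esqrt_mono: "x \<le> y \<Longrightarrow> esqrt x \<le> esqrt y"
  by (cases x; cases y) (auto simp: esqrt_def top_unique)

lemma esqrt_mult_self: "esqrt x * esqrt x = x"
  by (cases x) (auto simp: esqrt_def ennreal_mult_top ennreal_mult[symmetric])

lemma esqrt_mult_ennreal: "r \<ge> 0 \<Longrightarrow> r \<noteq> 0 \<Longrightarrow> esqrt (ennreal r * x) = ennreal (sqrt r) * esqrt x"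
  by (cases x) (auto simp: esqrt_def ennreal_mult_top ennreal_mult[symmetric] real_sqrt_mult)

lemma esqrt_sum_le: "finite I \<Longrightarrow> esqrt (\<Sum>i\<in>I. f i) \<le> (\<Sum>i\<in>I. esqrt (f i))"
proof (induction I rule: finite_induct)
  case empty
  then show ?case by (simp add: esqrt_def)
next
  case (insert i I)
  have add: "esqrt (x + y) \<le> esqrt x + esqrt y" for x y
    by (cases x; cases y)
      (auto simp: esqrt_def sqrt_add_le_add_sqrt simp flip: ennreal_plus)
  have "esqrt (\<Sum>i\<in>insert i I. f i) \<le> esqrt (f i) + esqrt (\<Sum>i\<in>I. f i)"
    using insert add by simp
  also have "\<dots> \<le> esqrt (f i) + (\<Sum>i\<in>I. esqrt (f i))"
    using insert by (simp add: add_left_mono)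
  finally show ?case using insert by simp
qed

text \<open>This replaces a posterior probability by its square root, whose expectation decays.\<close>

lemma le_one_imp_le_esqrt: "x \<le> 1 \<Longrightarrow> x \<le> esqrt x"
proof (cases x)
  case (real r)
  assume "x \<le> 1"
  then have "r \<le> 1" using real by (simp flip: ennreal_1)
  then have "r \<le> sqrt r" using real
    by (intro real_le_rsqrt) (simp add: power2_eq_square mult_left_le)
  then show ?thesis using real by (simp add: esqrt_def)
qed (simp add: esqrt_def)

section \<open>Integrated likelihood ratios\<close>

text \<open>One point \<open>z\<close> of the sample space: \<open>u\<close> weighs the parameters and has total mass \<open>m\<^sup>2\<close>, \<open>s\<close> and \<open>s1\<close>
are the roots of the densities relative to the true one. With \<open>q\<close> the mixture \<open>\<integral> u s\<^sup>2\<close>, Cauchy-Schwarz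
gives \<open>\<integral> u s \<le> m \<surd>q\<close>, hence \<open>(\<surd>q - m s1)\<^sup>2 \<le> \<integral> u (s - s1)\<^sup>2\<close>, the convexity of squared Hellinger
distance. The claim is then \<open>(x + y)\<^sup>2 \<le> 2 x\<^sup>2 + 2 y\<^sup>2\<close> with \<open>x = m - \<surd>q\<close> and \<open>y = \<surd>q - m s1\<close>.\<close>

lemma affinity_pointwise:
  fixes s :: "'t \<Rightarrow> real" and s1 m :: real
  assumes [measurable]: "u \<in> borel_measurable T" "s \<in> borel_measurable T"
    and s: "\<And>t. s t \<ge> 0" and s1: "s1 \<ge> 0" and m: "m \<ge> 0"
    and u: "(\<integral>\<^sup>+t. u t \<partial>T) = ennreal (m\<^sup>2)"
  shows "2 * ennreal m * esqrt (\<integral>\<^sup>+t. u t * ennreal ((s t)\<^sup>2) \<partial>T) + ennreal (m\<^sup>2 / 2) * ennreal ((s1 - 1)\<^sup>2)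
    \<le> ennreal (m\<^sup>2) + (\<integral>\<^sup>+t. u t * ennreal ((s t)\<^sup>2) \<partial>T) + (\<integral>\<^sup>+t. u t * ennreal ((s t - s1)\<^sup>2) \<partial>T)"
    (is "_ * esqrt ?q + _ \<le> _ + _ + ?X")
proof (cases ?q)
  case top
  then show ?thesis by simp
next
  case (real q)
  define t where "t = sqrt q"
  have t: "t \<ge> 0" "q = t\<^sup>2" using real by (auto simp: t_def)
  let ?S = "\<integral>\<^sup>+t. u t * ennreal (s t) \<partial>T"
  have "?S\<^sup>2 \<le> (\<integral>\<^sup>+t. u t \<partial>T) * ?q"
  proof -
    have e: "u x = esqrt (u x) * esqrt (u x)" for x by (simp add: esqrt_mult_self)
    have "?S\<^sup>2 = (\<integral>\<^sup>+t. esqrt (u t) * (esqrt (u t) * ennreal (s t)) \<partial>T)\<^sup>2"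
      by (subst e) (simp add: mult.assoc)
    also have "\<dots> \<le> (\<integral>\<^sup>+t. (esqrt (u t))\<^sup>2 \<partial>T) * (\<integral>\<^sup>+t. (esqrt (u t) * ennreal (s t))\<^sup>2 \<partial>T)"
      by (rule Cauchy_Schwarz_nn_integral) auto
    also have "\<dots> = (\<integral>\<^sup>+t. u t \<partial>T) * ?q"
    proof -
      have "(esqrt (u x) * ennreal (s x))\<^sup>2 = u x * ennreal ((s x)\<^sup>2)" for x
        using s[of x] esqrt_mult_self[of "u x"]
        by (metis power_mult_distrib power2_eq_square ennreal_power)
      then show ?thesis by (simp add: power2_eq_square esqrt_mult_self)
    qed
    finally show ?thesis .
  qed
  then have S2: "?S\<^sup>2 \<le> ennreal ((m * t)\<^sup>2)"
    unfolding u using real t by (simp add: power_mult_distrib ennreal_mult)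
  have "?S \<noteq> \<infinity>"
  proof
    assume "?S = \<infinity>" then show False using S2 by (simp add: power2_eq_square top_unique)
  qed
  then obtain S where S: "S \<ge> 0" "?S = ennreal S"
    by (cases ?S) auto
  have Sle: "S \<le> m * t"
  proof (rule power2_le_imp_le)
    show "S\<^sup>2 \<le> (m * t)\<^sup>2" using S2 S by (simp add: ennreal_power)
    show "0 \<le> m * t" using m t by simp
  qed
  have eq: "?X + ennreal (2 * s1) * ?S = ?q + ennreal (s1\<^sup>2) * (\<integral>\<^sup>+t. u t \<partial>T)"
  proof -
    have "?X + ennreal (2 * s1) * ?S
      = (\<integral>\<^sup>+t. u t * ennreal ((s t - s1)\<^sup>2) + ennreal (2 * s1) * (u t * ennreal (s t)) \<partial>T)"
      by (simp add: nn_integral_add nn_integral_cmult)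
    also have "\<dots> = (\<integral>\<^sup>+t. u t * ennreal ((s t)\<^sup>2) + ennreal (s1\<^sup>2) * u t \<partial>T)"
    proof (rule nn_integral_cong)
      fix x
      have "u x * ennreal ((s x - s1)\<^sup>2) + ennreal (2 * s1) * (u x * ennreal (s x))
        = u x * (ennreal ((s x - s1)\<^sup>2) + ennreal (2 * s1 * s x))"
        using s s1 by (simp add: distrib_left ennreal_mult ac_simps)
      also have "\<dots> = u x * (ennreal ((s x)\<^sup>2) + ennreal (s1\<^sup>2))"
      proof -
        have "ennreal ((s x - s1)\<^sup>2) + ennreal (2 * s1 * s x) = ennreal ((s x - s1)\<^sup>2 + 2 * s1 * s x)"
          using s[of x] s1 by (intro ennreal_plus[symmetric]) auto
        also have "(s x - s1)\<^sup>2 + 2 * s1 * s x = (s x)\<^sup>2 + s1\<^sup>2"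
          by (simp add: power2_eq_square algebra_simps)
        finally show ?thesis by simp
      qed
      finally show "u x * ennreal ((s x - s1)\<^sup>2) + ennreal (2 * s1) * (u x * ennreal (s x))
        = u x * ennreal ((s x)\<^sup>2) + ennreal (s1\<^sup>2) * u x"
        by (simp add: distrib_left mult.commute)
    qed
    also have "\<dots> = ?q + ennreal (s1\<^sup>2) * (\<integral>\<^sup>+t. u t \<partial>T)"
      by (simp add: nn_integral_add nn_integral_cmult)
    finally show ?thesis .
  qed
  have eq': "?X + ennreal (2 * s1 * S) = ennreal (t\<^sup>2 + s1\<^sup>2 * m\<^sup>2)"
    using eq S s1 real t unfolding u by (simp add: ennreal_mult)
  have "?X \<noteq> \<infinity>"
  proof
    assume "?X = \<infinity>"
    then have "ennreal (t\<^sup>2 + s1\<^sup>2 * m\<^sup>2) = \<infinity>" using eq' by simp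
    then show False by simp
  qed
  then obtain X where X: "X \<ge> 0" "?X = ennreal X" by (cases ?X) auto
  have "X + 2 * s1 * S = t\<^sup>2 + s1\<^sup>2 * m\<^sup>2"
    using eq' X S s1 by (simp flip: ennreal_plus)
  moreover have "s1 * S \<le> s1 * (m * t)" using Sle s1 by (rule mult_left_mono)
  ultimately have "X \<ge> (t - s1 * m)\<^sup>2" by (simp add: power2_eq_square algebra_simps)
  moreover have "(m * (s1 - 1))\<^sup>2 \<le> 2 * (m - t)\<^sup>2 + 2 * (t - s1 * m)\<^sup>2"
    using zero_le_power2[of "(m - t) - (t - s1 * m)"] by (simp add: power2_eq_square algebra_simps)
  ultimately have "m\<^sup>2 * (s1 - 1)\<^sup>2 / 2 \<le> (m - t)\<^sup>2 + X"
    by (simp add: power_mult_distrib)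
  also have "\<dots> = m\<^sup>2 + t\<^sup>2 + X - 2 * m * t" by (simp add: power2_diff)
  finally have fin: "2 * m * t + m\<^sup>2 / 2 * (s1 - 1)\<^sup>2 \<le> m\<^sup>2 + t\<^sup>2 + X" by simp
  have "2 * ennreal m * esqrt ?q = ennreal (2 * m * t)"
    using real m t by (simp add: esqrt_ennreal ennreal_mult)
  moreover have "ennreal (m\<^sup>2 / 2) * ennreal ((s1 - 1)\<^sup>2) = ennreal (m\<^sup>2 / 2 * (s1 - 1)\<^sup>2)"
    by (rule ennreal_mult[symmetric]) auto
  ultimately show ?thesis
    using fin m t X real by (simp flip: ennreal_plus)
qed

text \<open>Integrating the pointwise inequality: a mixture of densities near \<open>g1\<close> is as far from the truth
as \<open>g1\<close> is, up to the factor lost in \<open>(x + y)\<^sup>2 \<le> 2 x\<^sup>2 + 2 y\<^sup>2\<close>. All densities are taken relative to \<open>P\<close>,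
so that the true density is the constant 1. The weights \<open>u\<close> need not be normalized, because in the
induction below they are the likelihood ratios of the earlier observations.\<close>

lemma affinity_mixture:
  fixes g :: "'t \<Rightarrow> 'z \<Rightarrow> real"
  assumes P: "prob_space P" and T: "sigma_finite_measure T"
    and gm [measurable]: "case_prod g \<in> borel_measurable (T \<Otimes>\<^sub>M P)"
    and g1m [measurable]: "g1 \<in> borel_measurable P"
    and um [measurable]: "u \<in> borel_measurable T"
    and g0: "\<And>t z. g t z \<ge> 0" and g10: "\<And>z. g1 z \<ge> 0"
    and g: "AE t in T. (\<integral>\<^sup>+z. ennreal (g t z) \<partial>P) = 1"
    and near: "AE t in T. (\<integral>\<^sup>+z. ennreal ((sqrt (g t z) - sqrt (g1 z))\<^sup>2) \<partial>P) \<le> ennreal (\<epsilon>\<^sup>2 / 4)"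
    and far: "(\<integral>\<^sup>+z. ennreal ((sqrt (g1 z) - 1)\<^sup>2) \<partial>P) \<ge> ennreal (\<epsilon>\<^sup>2)"
    and \<epsilon>: "\<epsilon>\<^sup>2 < 8"
  shows "(\<integral>\<^sup>+z. esqrt (\<integral>\<^sup>+t. u t * ennreal (g t z) \<partial>T) \<partial>P)
     \<le> ennreal (1 - \<epsilon>\<^sup>2 / 8) * esqrt (\<integral>\<^sup>+t. u t \<partial>T)"
proof -
  interpret P: prob_space P by fact
  interpret T: sigma_finite_measure T by fact
  interpret TP: pair_sigma_finite T P by unfold_locales
  have [measurable]: "case_prod (\<lambda>z t. g t z) \<in> borel_measurable (P \<Otimes>\<^sub>M T)"
    using measurable_compose[OF measurable_pair_swap' gm] by (simp add: case_prod_unfold)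
  let ?M = "\<integral>\<^sup>+t. u t \<partial>T"
  let ?q = "\<lambda>z. \<integral>\<^sup>+t. u t * ennreal (g t z) \<partial>T"
  have [measurable]: "?q \<in> borel_measurable P" by measurable
  show ?thesis
  proof (cases ?M)
    case top
    have "1 - \<epsilon>\<^sup>2 / 8 > 0" using \<epsilon> by simp
    then show ?thesis using top by (simp add: ennreal_mult_top)
  next
    case (real M)
    define m where "m = sqrt M"
    have m: "m \<ge> 0" "M = m\<^sup>2" using real by (auto simp: m_def)
    let ?X = "\<lambda>z. \<integral>\<^sup>+t. u t * ennreal ((sqrt (g t z) - sqrt (g1 z))\<^sup>2) \<partial>T"
    have [measurable]: "?X \<in> borel_measurable P" by measurable
    have i1: "(\<integral>\<^sup>+z. 2 * ennreal m * esqrt (?q z) + ennreal (m\<^sup>2 / 2) * ennreal ((sqrt (g1 z) - 1)\<^sup>2) \<partial>P)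
        \<le> (\<integral>\<^sup>+z. ennreal (m\<^sup>2) + ?q z + ?X z \<partial>P)"
    proof (rule nn_integral_mono)
      fix z assume z: "z \<in> space P"
      have [measurable]: "(\<lambda>t. g t z) \<in> borel_measurable T" using z by measurable
      show "2 * ennreal m * esqrt (?q z) + ennreal (m\<^sup>2 / 2) * ennreal ((sqrt (g1 z) - 1)\<^sup>2)
        \<le> ennreal (m\<^sup>2) + ?q z + ?X z"
        using affinity_pointwise[of u T "\<lambda>t. sqrt (g t z)" "sqrt (g1 z)" m] real m g0 g10 by simp
    qed
    have i2: "(\<integral>\<^sup>+z. 2 * ennreal m * esqrt (?q z) + ennreal (m\<^sup>2 / 2) * ennreal ((sqrt (g1 z) - 1)\<^sup>2) \<partial>P)
       = 2 * ennreal m * (\<integral>\<^sup>+z. esqrt (?q z) \<partial>P) + ennreal (m\<^sup>2 / 2) * (\<integral>\<^sup>+z. ennreal ((sqrt (g1 z) - 1)\<^sup>2) \<partial>P)"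
      by (simp add: nn_integral_add nn_integral_cmult)
    have i3: "(\<integral>\<^sup>+z. ennreal (m\<^sup>2) + ?q z + ?X z \<partial>P)
       = ennreal (m\<^sup>2) + (\<integral>\<^sup>+z. ?q z \<partial>P) + (\<integral>\<^sup>+z. ?X z \<partial>P)"
      by (simp add: nn_integral_add P.emeasure_space_1)
    have i4: "(\<integral>\<^sup>+z. ?q z \<partial>P) = ennreal (m\<^sup>2)"
    proof -
      have "(\<integral>\<^sup>+z. ?q z \<partial>P) = (\<integral>\<^sup>+t. (\<integral>\<^sup>+z. u t * ennreal (g t z) \<partial>P) \<partial>T)"
        by (rule TP.Fubini') measurable
      also have "\<dots> = (\<integral>\<^sup>+t. u t * (\<integral>\<^sup>+z. ennreal (g t z) \<partial>P) \<partial>T)"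
        by (intro nn_integral_cong nn_integral_cmult) measurable
      also have "\<dots> = (\<integral>\<^sup>+t. u t \<partial>T)"
        by (intro nn_integral_cong_AE) (use g in \<open>auto\<close>)
      finally show ?thesis using real m by simp
    qed
    have i5: "(\<integral>\<^sup>+z. ?X z \<partial>P) \<le> ennreal (m\<^sup>2) * ennreal (\<epsilon>\<^sup>2 / 4)"
    proof -
      have "(\<integral>\<^sup>+z. ?X z \<partial>P) = (\<integral>\<^sup>+t. (\<integral>\<^sup>+z. u t * ennreal ((sqrt (g t z) - sqrt (g1 z))\<^sup>2) \<partial>P) \<partial>T)"
        by (rule TP.Fubini') measurable
      also have "\<dots> = (\<integral>\<^sup>+t. u t * (\<integral>\<^sup>+z. ennreal ((sqrt (g t z) - sqrt (g1 z))\<^sup>2) \<partial>P) \<partial>T)"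
        by (intro nn_integral_cong nn_integral_cmult) measurable
      also have "\<dots> \<le> (\<integral>\<^sup>+t. u t * ennreal (\<epsilon>\<^sup>2 / 4) \<partial>T)"
        by (intro nn_integral_mono_AE) (use near in eventually_elim, simp add: mult_left_mono)
      also have "\<dots> = ennreal (m\<^sup>2) * ennreal (\<epsilon>\<^sup>2 / 4)"
        using real m by (simp add: nn_integral_multc)
      finally show ?thesis .
    qed
    have i6: "ennreal (m\<^sup>2 / 2) * ennreal (\<epsilon>\<^sup>2) \<le> ennreal (m\<^sup>2 / 2) * (\<integral>\<^sup>+z. ennreal ((sqrt (g1 z) - 1)\<^sup>2) \<partial>P)"
      using far by (rule mult_left_mono) simp
    have "2 * ennreal m * (\<integral>\<^sup>+z. esqrt (?q z) \<partial>P) + ennreal (m\<^sup>2 / 2) * ennreal (\<epsilon>\<^sup>2)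
      \<le> 2 * ennreal m * (\<integral>\<^sup>+z. esqrt (?q z) \<partial>P) + ennreal (m\<^sup>2 / 2) * (\<integral>\<^sup>+z. ennreal ((sqrt (g1 z) - 1)\<^sup>2) \<partial>P)"
      using i6 by (rule add_left_mono)
    also have "\<dots> \<le> ennreal (m\<^sup>2) + (\<integral>\<^sup>+z. ?q z \<partial>P) + (\<integral>\<^sup>+z. ?X z \<partial>P)"
      using i1 unfolding i2 i3 .
    also have "\<dots> \<le> ennreal (m\<^sup>2) + ennreal (m\<^sup>2) + ennreal (m\<^sup>2) * ennreal (\<epsilon>\<^sup>2 / 4)"
      unfolding i4 using i5 by (rule add_left_mono)
    finally have main: "2 * ennreal m * (\<integral>\<^sup>+z. esqrt (?q z) \<partial>P) + ennreal (m\<^sup>2 / 2) * ennreal (\<epsilon>\<^sup>2)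
      \<le> ennreal (m\<^sup>2) + ennreal (m\<^sup>2) + ennreal (m\<^sup>2) * ennreal (\<epsilon>\<^sup>2 / 4)" .
    show ?thesis
    proof (cases "m = 0")
      case True
      then have "AE t in T. u t = 0" using real m by (simp add: nn_integral_0_iff_AE)
      have "?q z = 0" if "z \<in> space P" for z
      proof -
        have [measurable]: "(\<lambda>t. g t z) \<in> borel_measurable T" using that by measurable
        show ?thesis using \<open>AE t in T. u t = 0\<close> by (subst nn_integral_0_iff_AE) auto
      qed
      then have "(\<integral>\<^sup>+z. esqrt (?q z) \<partial>P) = (\<integral>\<^sup>+z. 0 \<partial>P)"
        by (intro nn_integral_cong) (simp add: esqrt_def)
      then show ?thesis by simp
    next
      case False
      then have m0: "m > 0" using m by simp
      have "(\<integral>\<^sup>+z. esqrt (?q z) \<partial>P) \<noteq> \<infinity>"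
      proof
        assume "(\<integral>\<^sup>+z. esqrt (?q z) \<partial>P) = \<infinity>"
        with main m0 show False by (simp add: ennreal_mult_top top_unique ennreal_mult_eq_top_iff)
      qed
      then obtain A where A: "A \<ge> 0" "(\<integral>\<^sup>+z. esqrt (?q z) \<partial>P) = ennreal A" by (cases "\<integral>\<^sup>+z. esqrt (?q z) \<partial>P") auto
      have "ennreal (2 * m * A + m\<^sup>2 / 2 * \<epsilon>\<^sup>2) \<le> ennreal (m\<^sup>2 + m\<^sup>2 + m\<^sup>2 * (\<epsilon>\<^sup>2 / 4))"
      proof -
        have "ennreal (2 * m * A + m\<^sup>2 / 2 * \<epsilon>\<^sup>2) = 2 * ennreal m * ennreal A + ennreal (m\<^sup>2 / 2) * ennreal (\<epsilon>\<^sup>2)"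
          using A m0 by (subst ennreal_plus) (simp_all add: ennreal_mult[of "m\<^sup>2 / 2" "\<epsilon>\<^sup>2", simplified] ennreal_mult)
        also have "\<dots> \<le> ennreal (m\<^sup>2) + ennreal (m\<^sup>2) + ennreal (m\<^sup>2) * ennreal (\<epsilon>\<^sup>2 / 4)"
          using main A by simp
        also have "\<dots> = ennreal (m\<^sup>2 + m\<^sup>2 + m\<^sup>2 * (\<epsilon>\<^sup>2 / 4))"
        proof -
          have "ennreal (m\<^sup>2) * ennreal (\<epsilon>\<^sup>2 / 4) = ennreal (m\<^sup>2 * (\<epsilon>\<^sup>2 / 4))"
            by (rule ennreal_mult[symmetric]) auto
          then show ?thesis by (simp only:) (subst ennreal_plus[symmetric]; (subst ennreal_plus[symmetric])?; simp)
        qed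
        finally show ?thesis .
      qed
      then have "2 * m * A + m\<^sup>2 / 2 * \<epsilon>\<^sup>2 \<le> m\<^sup>2 + m\<^sup>2 + m\<^sup>2 * (\<epsilon>\<^sup>2 / 4)"
        by (subst (asm) ennreal_le_iff) auto
      then have "m * A \<le> m * ((1 - \<epsilon>\<^sup>2 / 8) * m)"
        by (simp add: power2_eq_square algebra_simps)
      then have "A \<le> (1 - \<epsilon>\<^sup>2 / 8) * m" using m0 by simp
      moreover have "esqrt ?M = ennreal m" using real m by (simp add: esqrt_ennreal)
      ultimately show ?thesis using A \<epsilon> m by (simp flip: ennreal_mult)
    qed
  qed
qed

lemma measurable_prod_likelihood:
  fixes g :: "'t \<Rightarrow> 'z \<Rightarrow> real"
  assumes [measurable]: "case_prod g \<in> borel_measurable (T \<Otimes>\<^sub>M P)"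
  shows "(\<lambda>(D, t). \<Prod>i<n. g t (D i)) \<in> borel_measurable ((PiM {..<n::nat} (\<lambda>_. P)) \<Otimes>\<^sub>M T)"
proof -
  have "(\<lambda>p. g (snd p) (fst p i)) \<in> borel_measurable ((PiM {..<n::nat} (\<lambda>_. P)) \<Otimes>\<^sub>M T)" if [simp]: "i < n" for i
  proof -
    have "(\<lambda>p. (snd p, fst p i)) \<in> (PiM {..<n::nat} (\<lambda>_. P)) \<Otimes>\<^sub>M T \<rightarrow>\<^sub>M T \<Otimes>\<^sub>M P" by measurable
    from measurable_compose[OF this assms] show ?thesis by simp
  qed
  then show ?thesis unfolding case_prod_unfold by (intro borel_measurable_prod) auto
qed

text \<open>Given the first \<open>n\<close> observations, the ratio of successive integrated likelihoods at a new
observation is a mixture of the densities \<open>g t\<close>, weighted by the restricted posterior. The preceding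
lemma bounds its affinity with the truth whatever these weights are.\<close>

lemma sqrt_integrated_likelihood_decay:
  fixes g :: "'t \<Rightarrow> 'z \<Rightarrow> real"
  assumes P: "prob_space P" and T: "sigma_finite_measure T"
    and gm [measurable]: "case_prod g \<in> borel_measurable (T \<Otimes>\<^sub>M P)"
    and g1m [measurable]: "g1 \<in> borel_measurable P"
    and g0: "\<And>t z. g t z \<ge> 0" and g10: "\<And>z. g1 z \<ge> 0"
    and g: "AE t in T. (\<integral>\<^sup>+z. ennreal (g t z) \<partial>P) = 1"
    and near: "AE t in T. (\<integral>\<^sup>+z. ennreal ((sqrt (g t z) - sqrt (g1 z))\<^sup>2) \<partial>P) \<le> ennreal (\<epsilon>\<^sup>2 / 4)"
    and far: "(\<integral>\<^sup>+z. ennreal ((sqrt (g1 z) - 1)\<^sup>2) \<partial>P) \<ge> ennreal (\<epsilon>\<^sup>2)"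
    and \<epsilon>: "\<epsilon>\<^sup>2 < 8"
  shows "(\<integral>\<^sup>+D. esqrt (\<integral>\<^sup>+t. ennreal (\<Prod>i<n. g t (D i)) \<partial>T) \<partial>(PiM {..<n::nat} (\<lambda>_. P)))
     \<le> ennreal ((1 - \<epsilon>\<^sup>2 / 8) ^ n) * esqrt (emeasure T (space T))"
proof (induction n)
  case 0
  interpret product_sigma_finite "\<lambda>_::nat. P"
    using P by (simp add: product_sigma_finite_def prob_space_imp_sigma_finite)
  have "emeasure (PiM {} (\<lambda>_::nat. P)) (space (PiM {} (\<lambda>_::nat. P))) = 1"
    by (intro prob_space.emeasure_space_1 prob_space_PiM P)
  then show ?case by simp
next
  case (Suc n)
  interpret P: prob_space P by fact
  interpret T: sigma_finite_measure T by fact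
  interpret product_sigma_finite "\<lambda>_::nat. P"
    by (simp add: product_sigma_finite_def P.sigma_finite_measure_axioms)
  let ?Q = "\<lambda>n. PiM {..<n::nat} (\<lambda>_. P)"
  have ins: "{..<Suc n} = insert n {..<n}" by auto
  have [measurable]: "(\<lambda>(D, t). \<Prod>i<n. g t (D i)) \<in> borel_measurable (?Q n \<Otimes>\<^sub>M T)" for n
    by (rule measurable_prod_likelihood) fact
  have "(\<integral>\<^sup>+D. esqrt (\<integral>\<^sup>+t. ennreal (\<Prod>i<Suc n. g t (D i)) \<partial>T) \<partial>?Q (Suc n))
     = (\<integral>\<^sup>+D. (\<integral>\<^sup>+z. esqrt (\<integral>\<^sup>+t. ennreal (\<Prod>i<Suc n. g t ((D(n := z)) i)) \<partial>T) \<partial>P) \<partial>?Q n)"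
    unfolding ins
    by (rule product_nn_integral_insert) (simp_all flip: ins, measurable)
  also have "\<dots> = (\<integral>\<^sup>+D. (\<integral>\<^sup>+z. esqrt (\<integral>\<^sup>+t. ennreal (\<Prod>i<n. g t (D i)) * ennreal (g t z) \<partial>T) \<partial>P) \<partial>?Q n)"
    by (simp add: ennreal_mult g0 prod_nonneg)
  also have "\<dots> \<le> (\<integral>\<^sup>+D. ennreal (1 - \<epsilon>\<^sup>2 / 8) * esqrt (\<integral>\<^sup>+t. ennreal (\<Prod>i<n. g t (D i)) \<partial>T) \<partial>?Q n)"
  proof (rule nn_integral_mono)
    fix D assume D: "D \<in> space (?Q n)"
    have [measurable]: "(\<lambda>t. \<Prod>i<n. g t (D i)) \<in> borel_measurable T" using D by measurable
    show "(\<integral>\<^sup>+z. esqrt (\<integral>\<^sup>+t. ennreal (\<Prod>i<n. g t (D i)) * ennreal (g t z) \<partial>T) \<partial>P)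
      \<le> ennreal (1 - \<epsilon>\<^sup>2 / 8) * esqrt (\<integral>\<^sup>+t. ennreal (\<Prod>i<n. g t (D i)) \<partial>T)"
      by (rule affinity_mixture[OF P T gm g1m _ g0 g10 g near far \<epsilon>]) measurable
  qed
  also have "\<dots> = ennreal (1 - \<epsilon>\<^sup>2 / 8) * (\<integral>\<^sup>+D. esqrt (\<integral>\<^sup>+t. ennreal (\<Prod>i<n. g t (D i)) \<partial>T) \<partial>?Q n)"
    by (rule nn_integral_cmult) measurable
  also have "\<dots> \<le> ennreal (1 - \<epsilon>\<^sup>2 / 8) * (ennreal ((1 - \<epsilon>\<^sup>2 / 8) ^ n) * esqrt (emeasure T (space T)))"
    by (intro mult_left_mono Suc.IH) simp
  also have "\<dots> = ennreal ((1 - \<epsilon>\<^sup>2 / 8) ^ Suc n) * esqrt (emeasure T (space T))"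
    using \<epsilon> by (simp add: mult.assoc[symmetric] ennreal_mult)
  finally show ?case .
qed

lemma expected_integrated_likelihood:
  fixes g :: "'t \<Rightarrow> 'z \<Rightarrow> real"
  assumes P: "prob_space P" and T: "sigma_finite_measure T"
    and gm [measurable]: "case_prod g \<in> borel_measurable (T \<Otimes>\<^sub>M P)"
    and g0: "\<And>t z. g t z \<ge> 0"
    and g: "AE t in T. (\<integral>\<^sup>+z. ennreal (g t z) \<partial>P) \<le> ennreal \<kappa>"
    and \<kappa>: "\<kappa> \<ge> 0"
  shows "(\<integral>\<^sup>+D. (\<integral>\<^sup>+t. ennreal (\<Prod>i<n. g t (D i)) \<partial>T) \<partial>(PiM {..<n::nat} (\<lambda>_. P)))
     \<le> ennreal (\<kappa> ^ n) * emeasure T (space T)"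
proof -
  interpret P: prob_space P by fact
  interpret T: sigma_finite_measure T by fact
  interpret product_sigma_finite "\<lambda>_::nat. P"
    by (simp add: product_sigma_finite_def P.sigma_finite_measure_axioms)
  let ?Q = "PiM {..<n::nat} (\<lambda>_. P)"
  interpret Q: sigma_finite_measure ?Q by (rule sigma_finite) simp
  interpret QT: pair_sigma_finite ?Q T by unfold_locales
  have [measurable]: "(\<lambda>(D, t). \<Prod>i<n. g t (D i)) \<in> borel_measurable (?Q \<Otimes>\<^sub>M T)"
    by (rule measurable_prod_likelihood) fact
  have "(\<integral>\<^sup>+D. (\<integral>\<^sup>+t. ennreal (\<Prod>i<n. g t (D i)) \<partial>T) \<partial>?Q)
     = (\<integral>\<^sup>+t. (\<integral>\<^sup>+D. ennreal (\<Prod>i<n. g t (D i)) \<partial>?Q) \<partial>T)"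
    by (rule QT.Fubini'[symmetric]) measurable
  also have "\<dots> \<le> (\<integral>\<^sup>+t. ennreal (\<kappa> ^ n) \<partial>T)"
  proof (rule nn_integral_mono_AE, use g AE_space in eventually_elim)
    fix t assume t: "(\<integral>\<^sup>+z. ennreal (g t z) \<partial>P) \<le> ennreal \<kappa>" "t \<in> space T"
    have [measurable]: "g t \<in> borel_measurable P" using measurable_Pair2[OF gm t(2)] by simp
    have "(\<integral>\<^sup>+D. ennreal (\<Prod>i<n. g t (D i)) \<partial>?Q) = (\<integral>\<^sup>+D. (\<Prod>i<n. ennreal (g t (D i))) \<partial>?Q)"
      by (simp add: prod_ennreal g0)
    also have "\<dots> = (\<Prod>i<n. (\<integral>\<^sup>+z. ennreal (g t z) \<partial>P))"
      by (rule product_nn_integral_prod) auto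
    also have "\<dots> \<le> (ennreal \<kappa>) ^ n" using t by (simp add: power_mono)
    finally show "(\<integral>\<^sup>+D. ennreal (\<Prod>i<n. g t (D i)) \<partial>?Q) \<le> ennreal (\<kappa> ^ n)"
      using \<kappa> by (simp add: ennreal_power)
  qed
  also have "\<dots> = ennreal (\<kappa> ^ n) * emeasure T (space T)" by simp
  finally show ?thesis .
qed

text \<open>By Cauchy-Schwarz \<open>T\<^sup>2 \<le> (\<integral> \<Prod> g) (\<integral> \<Prod> 1/g)\<close> with \<open>T\<close> the total mass, so the inverse evidence is
dominated by an integrated product of inverse ratios, whose expectation factorizes.\<close>

lemma expected_inverse_evidence:
  fixes g :: "'t \<Rightarrow> 'z \<Rightarrow> real"
  assumes P: "prob_space P" and T: "finite_measure T"
    and gm [measurable]: "case_prod g \<in> borel_measurable (T \<Otimes>\<^sub>M P)"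
    and g0: "\<And>t z. g t z > 0"
    and g: "AE t in T. (\<integral>\<^sup>+z. ennreal (1 / g t z) \<partial>P) \<le> ennreal \<kappa>"
    and \<kappa>: "\<kappa> \<ge> 0" and w: "0 < w" "ennreal w \<le> emeasure T (space T)"
  shows "(\<integral>\<^sup>+D. 1 / (\<integral>\<^sup>+t. ennreal (\<Prod>i<n. g t (D i)) \<partial>T) \<partial>(PiM {..<n::nat} (\<lambda>_. P)))
     \<le> ennreal (\<kappa> ^ n / w)"
proof -
  interpret P: prob_space P by fact
  interpret T: finite_measure T by fact
  let ?Q = "PiM {..<n::nat} (\<lambda>_. P)"
  define W where "W = measure T (space T)"
  have W: "emeasure T (space T) = ennreal W" "W \<ge> w" "W > 0"
    using w by (auto simp: W_def T.emeasure_eq_measure)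
  have lm [measurable]: "(\<lambda>(D, t). \<Prod>i<n. g t (D i)) \<in> borel_measurable (?Q \<Otimes>\<^sub>M T)"
    by (rule measurable_prod_likelihood) fact
  have im [measurable]: "(\<lambda>(t, z). 1 / g t z) \<in> borel_measurable (T \<Otimes>\<^sub>M P)"
    unfolding case_prod_unfold using gm by (auto simp: case_prod_unfold)
  have im' [measurable]: "(\<lambda>(D, t). \<Prod>i<n. 1 / g t (D i)) \<in> borel_measurable (?Q \<Otimes>\<^sub>M T)"
    by (rule measurable_prod_likelihood) fact
  let ?L = "\<lambda>D. \<integral>\<^sup>+t. ennreal (\<Prod>i<n. g t (D i)) \<partial>T"
  let ?I = "\<lambda>D. \<integral>\<^sup>+t. ennreal (\<Prod>i<n. 1 / g t (D i)) \<partial>T"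
  have "(\<integral>\<^sup>+D. 1 / ?L D \<partial>?Q) \<le> (\<integral>\<^sup>+D. ennreal (1 / W\<^sup>2) * ?I D \<partial>?Q)"
  proof (rule nn_integral_mono)
    fix D assume D: "D \<in> space ?Q"
    have [measurable]: "(\<lambda>t. \<Prod>i<n. g t (D i)) \<in> borel_measurable T"
       "(\<lambda>t. \<Prod>i<n. 1 / g t (D i)) \<in> borel_measurable T"
      using measurable_Pair2[OF lm D] measurable_Pair2[OF im' D] by simp_all
    have pos: "(\<Prod>i<n. g t (D i)) > 0" for t using g0 by (simp add: prod_pos)
    have "(emeasure T (space T))\<^sup>2 \<le> ?L D * ?I D"
    proof -
      have "emeasure T (space T) = (\<integral>\<^sup>+t. ennreal (sqrt (\<Prod>i<n. g t (D i))) * ennreal (sqrt (\<Prod>i<n. 1 / g t (D i))) \<partial>T)"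
      proof -
        have "ennreal (sqrt (\<Prod>i<n. g t (D i))) * ennreal (sqrt (\<Prod>i<n. 1 / g t (D i))) = 1" for t
        proof -
          have "(\<Prod>i<n. 1 / g t (D i)) = 1 / (\<Prod>i<n. g t (D i))"
            by (simp add: prod_dividef)
          moreover have "sqrt p * sqrt (1 / p) = 1" if "p > 0" for p :: real
            using that by (simp add: real_sqrt_divide)
          ultimately have "sqrt (\<Prod>i<n. g t (D i)) * sqrt (\<Prod>i<n. 1 / g t (D i)) = 1"
            using pos[of t] by presburger
          then show ?thesis 
          proof -
            have "ennreal (sqrt (\<Prod>i<n. g t (D i))) * ennreal (sqrt (\<Prod>i<n. 1 / g t (D i)))
              = ennreal (sqrt (\<Prod>i<n. g t (D i)) * sqrt (\<Prod>i<n. 1 / g t (D i)))"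
              using g0 by (intro ennreal_mult[symmetric] real_sqrt_ge_zero prod_nonneg) (auto simp: less_imp_le)
            also note \<open>sqrt (\<Prod>i<n. g t (D i)) * sqrt (\<Prod>i<n. 1 / g t (D i)) = 1\<close>
            finally show ?thesis by simp
          qed
        qed
        then show ?thesis by simp
      qed
      also have "\<dots>\<^sup>2 \<le> (\<integral>\<^sup>+t. (ennreal (sqrt (\<Prod>i<n. g t (D i))))\<^sup>2 \<partial>T) * (\<integral>\<^sup>+t. (ennreal (sqrt (\<Prod>i<n. 1 / g t (D i))))\<^sup>2 \<partial>T)"
        by (rule Cauchy_Schwarz_nn_integral) measurable
      also have "\<dots> = ?L D * ?I D"
        using g0 by (simp add: ennreal_power prod_nonneg less_imp_le)
      finally show ?thesis .
    qed
    then have le: "ennreal (W\<^sup>2) \<le> ?L D * ?I D" using W by (simp add: ennreal_power)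
    show "1 / ?L D \<le> ennreal (1 / W\<^sup>2) * ?I D"
    proof (cases "?L D")
      case top then show ?thesis by (simp add: ennreal_divide_self divide_ennreal_def)
    next
      case (real l)
      have "l \<noteq> 0"
      proof
        assume "l = 0" then have "?L D = 0" using real by simp
        then have "ennreal (W\<^sup>2) \<le> 0" using le by simp
        then show False using W by simp
      qed
      then have l: "l > 0" using real by simp
      show ?thesis
      proof (cases "?I D")
        case top then show ?thesis using W by (simp add: ennreal_mult_top)
      next
        case (real i)
        have "W\<^sup>2 \<le> l * i" using le \<open>?L D = ennreal l\<close> real l by (simp flip: ennreal_mult)
        then have "1 / l \<le> 1 / W\<^sup>2 * i" using l W by (simp add: field_simps)
        moreover have "1 / ennreal l = ennreal (1 / l)"
          using l by (metis ennreal_1 divide_ennreal zero_le_one)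
        ultimately show ?thesis using \<open>?L D = ennreal l\<close> real W
          by (simp flip: ennreal_mult)
      qed
    qed
  qed
  also have "\<dots> = ennreal (1 / W\<^sup>2) * (\<integral>\<^sup>+D. ?I D \<partial>?Q)"
    by (rule nn_integral_cmult) measurable
  also have "\<dots> \<le> ennreal (1 / W\<^sup>2) * (ennreal (\<kappa> ^ n) * emeasure T (space T))"
    by (intro mult_left_mono expected_integrated_likelihood P im g \<kappa>)
      (use g0 in \<open>auto intro: less_imp_le T.sigma_finite_measure_axioms\<close>)
  also have "\<dots> = ennreal (1 / W\<^sup>2 * (\<kappa> ^ n * W))"
    using W \<kappa> by (simp add: ennreal_mult[symmetric])
  also have "1 / W\<^sup>2 * (\<kappa> ^ n * W) = \<kappa> ^ n / W"
    using W by (simp add: power2_eq_square)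
  also have "\<dots> \<le> ennreal (\<kappa> ^ n / w)"
    using W w \<kappa> by (intro ennreal_leI divide_left_mono) auto
  finally show ?thesis .
qed

section \<open>Quadratic forms\<close>

text \<open>Quadratic forms are written with functions in place of matrices, so that a form in \<open>k\<close> variables
can be restricted to fewer variables without changing its type.\<close>

definition qform :: "nat \<Rightarrow> (nat \<Rightarrow> nat \<Rightarrow> real) \<Rightarrow> (nat \<Rightarrow> real) \<Rightarrow> real" where
  "qform k A v = (\<Sum>i<k. \<Sum>j<k. A i j * v i * v j)"

definition pos_def_form :: "nat \<Rightarrow> (nat \<Rightarrow> nat \<Rightarrow> real) \<Rightarrow> bool" where
  "pos_def_form k A \<longleftrightarrow> (\<forall>i<k. \<forall>j<k. A i j = A j i) \<and>
     (\<forall>v. (\<exists>i<k. v i \<noteq> 0) \<longrightarrow> qform k A v > 0)"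

lemma qform_cong: "(\<And>i. i < k \<Longrightarrow> v i = w i) \<Longrightarrow> qform k A v = qform k A w"
  unfolding qform_def by (intro sum.cong) auto

lemma qform_add:
  assumes "\<forall>i<k. \<forall>j<k. A i j = A j i"
  shows "qform k A (\<lambda>i. v i + s * w i)
    = qform k A v + 2 * s * (\<Sum>i<k. v i * (\<Sum>j<k. A i j * w j)) + s\<^sup>2 * qform k A w"
proof -
  have e1: "qform k A (\<lambda>i. v i + s * w i) = qform k A v + s * (\<Sum>i<k. \<Sum>j<k. A i j * v i * w j)
     + s * (\<Sum>i<k. \<Sum>j<k. A i j * w i * v j) + s\<^sup>2 * qform k A w"
    unfolding qform_def sum_distrib_left sum.distrib[symmetric]
    by (intro sum.cong refl) (simp add: algebra_simps power2_eq_square)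
  have "(\<Sum>i<k. \<Sum>j<k. A i j * w i * v j) = (\<Sum>j<k. \<Sum>i<k. A i j * w i * v j)"
    by (rule sum.swap)
  also have "\<dots> = (\<Sum>i<k. \<Sum>j<k. A i j * v i * w j)"
  proof (intro sum.cong refl)
    fix i j assume "i \<in> {..<k}" "j \<in> {..<k}"
    then have "A i j = A j i" using assms by auto
    then show "A j i * w j * v i = A i j * v i * w j" by (simp add: algebra_simps)
  qed
  finally have e2: "(\<Sum>i<k. \<Sum>j<k. A i j * w i * v j) = (\<Sum>i<k. \<Sum>j<k. A i j * v i * w j)" .
  have e3: "(\<Sum>i<k. v i * (\<Sum>j<k. A i j * w j)) = (\<Sum>i<k. \<Sum>j<k. A i j * v i * w j)"
    unfolding sum_distrib_left by (intro sum.cong refl) (simp add: algebra_simps)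
  show ?thesis unfolding e1 e2 e3 by (simp add: algebra_simps)
qed

lemma qform_unit: "m < k \<Longrightarrow> qform k A (\<lambda>i. if i = m then 1 else 0) = A m m"
proof -
  assume m: "m < k"
  have "qform k A (\<lambda>i. if i = m then 1 else 0) = (\<Sum>i<k. if i = m then (\<Sum>j<k. if j = m then A m m else 0) else 0)"
    unfolding qform_def by (intro sum.cong refl) (auto simp: if_distrib[of "\<lambda>x. _ * x"] cong: if_cong)
  then show ?thesis using m by simp
qed

lemma pos_def_formD: "pos_def_form k A \<Longrightarrow> i < k \<Longrightarrow> v i \<noteq> 0 \<Longrightarrow> 0 < qform k A v"
  unfolding pos_def_form_def by blast

lemma pos_def_form_sym: "pos_def_form k A \<Longrightarrow> \<forall>i<k. \<forall>j<k. A i j = A j i"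
  unfolding pos_def_form_def by blast

lemma pos_def_form_diag: "pos_def_form k A \<Longrightarrow> m < k \<Longrightarrow> A m m > 0"
  proof -
  assume A: "pos_def_form k A" and m: "m < k"
  have "0 < qform k A (\<lambda>i. if i = m then 1 else 0)" by (rule pos_def_formD[OF A m]) simp
  then show ?thesis using qform_unit[OF m] by simp
qed

text \<open>The Schur complement of the last diagonal entry: the form that remains after completing the
square in the last variable. It drives the inductions for determinants, coercivity and Gaussian
integrals.\<close>

definition schur :: "nat \<Rightarrow> (nat \<Rightarrow> nat \<Rightarrow> real) \<Rightarrow> nat \<Rightarrow> nat \<Rightarrow> real" where
  "schur k A i j = A i j - A i k * A k j / A k k"

lemma qform_Suc:
  assumes sym: "\<forall>i<Suc k. \<forall>j<Suc k. A i j = A j i" and d: "A k k \<noteq> 0"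
  shows "qform (Suc k) A v = qform k (schur k A) v + A k k * (v k + (\<Sum>i<k. A i k * v i) / A k k)\<^sup>2"
proof -
  let ?L = "\<Sum>i<k. A i k * v i"
  have symk: "A k j = A j k" if "j < k" for j using sym that by auto
  have "qform (Suc k) A v = qform k A v + (\<Sum>i<k. A i k * v i * v k) + (\<Sum>j<k. A k j * v k * v j) + A k k * v k * v k"
    unfolding qform_def by (simp add: sum.distrib)
  also have "(\<Sum>j<k. A k j * v k * v j) = v k * ?L"
    unfolding sum_distrib_left by (intro sum.cong refl) (simp add: symk algebra_simps)
  also have "(\<Sum>i<k. A i k * v i * v k) = v k * ?L"
    unfolding sum_distrib_left by (intro sum.cong refl) (simp add: algebra_simps)
  finally have 1: "qform (Suc k) A v = qform k A v + 2 * v k * ?L + A k k * v k * v k" by simp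
  have "?L * ?L = (\<Sum>i<k. \<Sum>j<k. A i k * A k j * v i * v j)"
    unfolding sum_product by (intro sum.cong refl) (simp add: symk algebra_simps)
  then have 2: "qform k (schur k A) v = qform k A v - ?L * ?L / A k k"
    unfolding qform_def schur_def
    by (simp add: sum_divide_distrib sum_subtractf[symmetric] algebra_simps)
  show ?thesis unfolding 1 2 using d
    by (simp add: power2_eq_square field_simps)
qed

lemma pos_def_form_schur:
  assumes A: "pos_def_form (Suc k) A"
  shows "pos_def_form k (schur k A)"
  unfolding pos_def_form_def
proof (intro conjI allI impI)
  have sym: "\<forall>i<Suc k. \<forall>j<Suc k. A i j = A j i" using A by (rule pos_def_form_sym)
  have d: "A k k > 0" using pos_def_form_diag[OF A, of k] by simp
  show "schur k A i j = schur k A j i" if "i < k" "j < k" for i j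
  proof -
    have "A i j = A j i" "A i k = A k i" "A k j = A j k" using sym that by auto
    then show ?thesis by (simp only: schur_def mult.commute)
  qed
  fix v :: "nat \<Rightarrow> real" assume v: "\<exists>i<k. v i \<noteq> 0"
  let ?w = "\<lambda>i. if i < k then v i else - (\<Sum>i<k. A i k * v i) / A k k"
  have "0 < qform (Suc k) A ?w"
  proof -
    obtain i where "i < k" "v i \<noteq> 0" using v by blast
    then show ?thesis by (intro pos_def_formD[OF A, of i]) simp_all
  qed
  also have "\<dots> = qform k (schur k A) ?w"
    using d by (subst qform_Suc[OF sym]) simp_all
  also have "\<dots> = qform k (schur k A) v" by (rule qform_cong) simp
  finally show "0 < qform k (schur k A) v" .
qed

lemma det_schur:
  fixes A :: "nat \<Rightarrow> nat \<Rightarrow> real"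
  assumes d: "A k k \<noteq> 0"
  shows "Determinant.det (mat (Suc k) (Suc k) (\<lambda>(i, j). A i j))
    = A k k * Determinant.det (mat k k (\<lambda>(i, j). schur k A i j))"
proof -
  define S where "S = mat k k (\<lambda>(i, j). schur k A i j)"
  define C where "C = mat k 1 (\<lambda>(i, j). A i k)"
  define D where "D = mat 1 1 (\<lambda>(i::nat, j::nat). A k k)"
  define R where "R = mat 1 k (\<lambda>(i::nat, j). A k j / A k k)"
  have [simp]: "S \<in> carrier_mat k k" "C \<in> carrier_mat k 1" "D \<in> carrier_mat 1 1" "R \<in> carrier_mat 1 k"
    by (auto simp: S_def C_def D_def R_def)
  note [simp] = this[unfolded One_nat_def]
  let ?L = "four_block_mat S C (0\<^sub>m 1 k) D"
  let ?U = "four_block_mat (1\<^sub>m k) (0\<^sub>m k 1) R (1\<^sub>m 1)"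
  have "mat (Suc k) (Suc k) (\<lambda>(i, j). A i j) = ?L * ?U"
  proof -
    have e1: "S * 1\<^sub>m k + C * R = S + C * R"
      by (simp add: right_mult_one_mat[of S k k])
    have e2: "S * 0\<^sub>m k 1 + C * 1\<^sub>m 1 = C"
      by (simp add: right_mult_zero_mat[of S k k] right_mult_one_mat[of C k])
    have e3: "0\<^sub>m 1 k * 1\<^sub>m k + D * R = D * R"
      by (simp add: left_add_zero_mat[OF mult_carrier_mat[of D _ 1]])
    have e4: "0\<^sub>m 1 k * 0\<^sub>m k 1 + D * 1\<^sub>m 1 = D"
      by (simp add: left_add_zero_mat[of _ 1 1] right_mult_one_mat[of D 1])
    have "?L * ?U = four_block_mat (S * 1\<^sub>m k + C * R) (S * 0\<^sub>m k 1 + C * 1\<^sub>m 1)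
       (0\<^sub>m 1 k * 1\<^sub>m k + D * R) (0\<^sub>m 1 k * 0\<^sub>m k 1 + D * 1\<^sub>m 1)"
      by (rule mult_four_block_mat[of S k k C 1 "0\<^sub>m 1 k" 1 D "1\<^sub>m k" k "0\<^sub>m k 1" 1 R "1\<^sub>m 1"]) simp_all
    also have "\<dots> = four_block_mat (S + C * R) C (D * R) D"
      by (simp only: e1 e2 e3 e4)
    also have "\<dots> = mat (Suc k) (Suc k) (\<lambda>(i, j). A i j)"
    proof (rule eq_matI)
      fix i j assume ij: "i < dim_row (mat (Suc k) (Suc k) (\<lambda>(i, j). A i j))" "j < dim_col (mat (Suc k) (Suc k) (\<lambda>(i, j). A i j))"
      then have ij: "i < Suc k" "j < Suc k" by auto
      consider "i < k" "j < k" | "i < k" "j = k" | "i = k" "j < k" | "i = k" "j = k"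
        using ij by linarith
      then show "four_block_mat (S + C * R) C (D * R) D $$ (i, j) = mat (Suc k) (Suc k) (\<lambda>(i, j). A i j) $$ (i, j)"
        by cases (use d in \<open>auto simp: S_def C_def D_def R_def schur_def scalar_prod_def\<close>)
    qed (auto simp: S_def D_def C_def R_def)
    finally show ?thesis ..
  qed
  then have "Determinant.det (mat (Suc k) (Suc k) (\<lambda>(i, j). A i j)) = Determinant.det ?L * Determinant.det ?U"
    by (simp only:) (rule det_mult[where n = "k + 1"], rule four_block_carrier_mat, auto intro!: four_block_carrier_mat)
  also have "Determinant.det ?L = Determinant.det S * Determinant.det D"
    by (rule det_four_block_mat_lower_left_zero) auto
  also have "Determinant.det ?U = 1"
    by (subst det_four_block_mat_upper_right_zero[of _ k _ 1]) auto
  also have "Determinant.det D = A k k"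
    by (subst det_single) (auto simp: D_def)
  finally show ?thesis by (simp add: S_def)
qed

text \<open>Eliminating a variable multiplies the determinant by the pivot and lowers the remaining diagonal
entries, which gives positivity and Hadamard's inequality at once.\<close>

lemma pos_def_form_det:
  assumes "pos_def_form k A"
  shows "0 < Determinant.det (mat k k (\<lambda>(i, j). A i j))"
    and "Determinant.det (mat k k (\<lambda>(i, j). A i j)) \<le> (\<Prod>i<k. A i i)"
proof -
  have "0 < Determinant.det (mat k k (\<lambda>(i, j). A i j)) \<and> Determinant.det (mat k k (\<lambda>(i, j). A i j)) \<le> (\<Prod>i<k. A i i)"
    using assms
  proof (induction k arbitrary: A)
    case 0
    then show ?case by simp
  next
    case (Suc k)
    have sym: "\<forall>i<Suc k. \<forall>j<Suc k. A i j = A j i" using Suc.prems by (rule pos_def_form_sym)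
    have d: "A k k > 0" using pos_def_form_diag[OF Suc.prems, of k] by simp
    note S = pos_def_form_schur[OF Suc.prems]
    note IH = Suc.IH[OF S]
    have "(\<Prod>i<k. schur k A i i) \<le> (\<Prod>i<k. A i i)"
    proof (rule prod_mono, intro conjI)
      fix i assume i: "i \<in> {..<k}"
      show "0 \<le> schur k A i i" using pos_def_form_diag[OF S] i by (simp add: less_imp_le)
      have "A k i = A i k" using i sym by auto
      then show "schur k A i i \<le> A i i" using d by (simp add: schur_def)
    qed
    then show ?case using IH d by (auto simp: det_schur mult.commute intro: mult_left_mono)
  qed
  then show "0 < Determinant.det (mat k k (\<lambda>(i, j). A i j))"
    and "Determinant.det (mat k k (\<lambda>(i, j). A i j)) \<le> (\<Prod>i<k. A i i)" by auto
qed

lemma pos_def_form_coercive: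
  assumes "pos_def_form k A"
  shows "\<exists>c>0. \<forall>v. c * (\<Sum>i<k. (v i)\<^sup>2) \<le> qform k A v"
  using assms
proof (induction k arbitrary: A)
  case 0
  then show ?case by (auto simp: qform_def intro: exI[of _ 1])
next
  case (Suc k)
  have sym: "\<forall>i<Suc k. \<forall>j<Suc k. A i j = A j i" using Suc.prems by (rule pos_def_form_sym)
  have d: "A k k > 0" using pos_def_form_diag[OF Suc.prems, of k] by simp
  obtain c where c: "c > 0" "\<And>v. c * (\<Sum>i<k. (v i)\<^sup>2) \<le> qform k (schur k A) v"
    using Suc.IH[OF pos_def_form_schur[OF Suc.prems]] by blast
  define l where "l = (\<Sum>i<k. (A i k / A k k)\<^sup>2)"
  have l: "l \<ge> 0" by (simp add: l_def sum_nonneg)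
  define C where "C = (1 + 2 * l) / c + 2 / A k k"
  have C: "C > 0" using c d l by (auto simp: C_def intro!: add_nonneg_pos)
  have "(\<Sum>i<Suc k. (v i)\<^sup>2) \<le> C * qform (Suc k) A v" for v
  proof -
    let ?L = "\<Sum>i<k. A i k * v i" and ?n = "\<Sum>i<k. (v i)\<^sup>2"
    let ?q = "qform k (schur k A) v" and ?t = "v k + ?L / A k k"
    have n: "?n \<ge> 0" by (simp add: sum_nonneg)
    have q0: "?q \<ge> 0" using c(2)[of v] c(1) n by (meson order_trans mult_nonneg_nonneg less_imp_le)
    have "(?L / A k k)\<^sup>2 = (\<Sum>i<k. (A i k / A k k) * v i)\<^sup>2"
      by (simp add: sum_divide_distrib)
    also have "\<dots> \<le> l * ?n" unfolding l_def by (rule Cauchy_Schwarz_ineq_sum)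
    finally have cs: "(?L / A k k)\<^sup>2 \<le> l * ?n" .
    have "0 \<le> (?t + ?L / A k k)\<^sup>2" by simp
    then have "(v k)\<^sup>2 \<le> 2 * ?t\<^sup>2 + 2 * (?L / A k k)\<^sup>2"
      by (simp add: power2_eq_square algebra_simps)
    then have "(\<Sum>i<Suc k. (v i)\<^sup>2) \<le> (1 + 2 * l) * ?n + 2 * ?t\<^sup>2"
      using cs by (simp add: algebra_simps)
    also have "\<dots> \<le> (1 + 2 * l) * (?q / c) + 2 * ?t\<^sup>2"
      using c l by (intro add_right_mono mult_left_mono) (auto simp: field_simps)
    also have "\<dots> \<le> C * (?q + A k k * ?t\<^sup>2)"
      unfolding C_def using q0 c d l by (simp add: field_simps)
    also have "?q + A k k * ?t\<^sup>2 = qform (Suc k) A v"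
      using qform_Suc[OF sym, of v] d by simp
    finally show ?thesis .
  qed
  then have "\<forall>v. (1 / C) * (\<Sum>i<Suc k. (v i)\<^sup>2) \<le> qform (Suc k) A v"
    using C by (simp add: field_simps)
  then show ?case using C by (intro exI[of _ "1 / C"]) simp
qed

text \<open>Moving from \<open>v\<close> in direction \<open>e\<^sub>i\<close> changes the form by a linear term plus a constant; a nonzero
slope would make it negative somewhere.\<close>

lemma psd_kernel:
  assumes sym: "\<forall>i<k. \<forall>j<k. A i j = A j i"
    and psd: "\<And>v. 0 \<le> qform k A v" and v: "qform k A v = 0" and i: "i < k"
  shows "(\<Sum>j<k. A i j * v j) = 0"
proof (rule ccontr)
  let ?e = "\<lambda>j. if j = i then 1 else 0 :: real"
  let ?b = "\<Sum>j<k. A i j * v j"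
  assume b: "?b \<noteq> 0"
  have "qform k A (\<lambda>j. ?e j + s * v j) = A i i + 2 * s * ?b" for s
  proof -
    have "(\<Sum>m<k. ?e m * (\<Sum>j<k. A m j * v j)) = (\<Sum>m<k. if m = i then ?b else 0)"
      by (intro sum.cong refl) simp
    then show ?thesis unfolding qform_add[OF sym] v qform_unit[OF i] using i by simp
  qed
  then have "0 \<le> A i i + 2 * s * ?b" for s using psd by metis
  then have "0 \<le> A i i + 2 * (- (A i i + 1) / (2 * ?b)) * ?b" .
  also have "\<dots> = - 1" using b by (simp add: field_simps)
  finally show False by simp
qed

text \<open>Let \<open>l\<close> be the supremum of the form over the unit sphere. Then \<open>l I - A\<close> is positive semidefinite, but
not positive definite, because coercivity would lower the supremum. A null vector of it is an
eigenvector.\<close>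

lemma rayleigh_eigenvector:
  assumes sym: "\<forall>i<k. \<forall>j<k. A i j = A j i" and k: "k > 0"
  shows "\<exists>l. (\<forall>v. qform k A v \<le> l * (\<Sum>i<k. (v i)\<^sup>2)) \<and>
    (\<exists>v. (\<exists>i<k. v i \<noteq> 0) \<and> (\<forall>i<k. (\<Sum>j<k. A i j * v j) = l * v i))"
proof -
  let ?n = "\<lambda>v::nat \<Rightarrow> real. \<Sum>i<k. (v i)\<^sup>2"
  define Sph where "Sph = {v. ?n v = 1}"
  define b where "b = (\<Sum>i<k. \<Sum>j<k. \<bar>A i j\<bar>)"
  have bd: "qform k A v \<le> b" if "v \<in> Sph" for v
  proof -
    have v1: "\<bar>v i\<bar> \<le> 1" if "i < k" for i
    proof -
      have "(v i)\<^sup>2 \<le> ?n v" using that by (intro member_le_sum) auto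
      then show ?thesis using \<open>v \<in> Sph\<close> by (simp add: Sph_def abs_square_le_1)
    qed
    have "A i j * v i * v j \<le> \<bar>A i j\<bar>" if "i < k" "j < k" for i j
    proof -
      have "A i j * v i * v j \<le> \<bar>A i j\<bar> * (\<bar>v i\<bar> * \<bar>v j\<bar>)" by (metis abs_ge_self abs_mult mult.assoc)
      also have "\<dots> \<le> \<bar>A i j\<bar> * (1 * 1)" using v1 that by (intro mult_left_mono mult_mono) auto
      finally show ?thesis by simp
    qed
    then show ?thesis unfolding qform_def b_def by (intro sum_mono) auto
  qed
  have ne: "(\<lambda>i. if i = 0 then 1 else 0) \<in> Sph"
  proof -
    have "?n (\<lambda>i. if i = 0 then 1 else 0) = (\<Sum>i<k. if i = 0 then 1 else 0)"
      by (intro sum.cong) auto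
    then show ?thesis using k by (simp add: Sph_def)
  qed
  have bdd: "bdd_above (qform k A ` Sph)" using bd by (intro bdd_aboveI) auto
  define l where "l = (SUP v\<in>Sph. qform k A v)"
  have scale: "qform k A (\<lambda>i. s * v i) = s\<^sup>2 * qform k A v" for s v
    unfolding qform_def sum_distrib_left by (intro sum.cong refl) (simp add: power2_eq_square algebra_simps)
  have le: "qform k A v \<le> l * ?n v" for v
  proof (cases "?n v = 0")
    case True
    then have "\<forall>i<k. v i = 0" by (simp add: sum_nonneg_eq_0_iff)
    then have "qform k A v = 0" by (simp add: qform_def)
    then show ?thesis using True by simp
  next
    case False
    then have n: "?n v > 0" by (simp add: sum_nonneg order_le_neq_trans)
    let ?w = "\<lambda>i. (1 / sqrt (?n v)) * v i"
    have "?n ?w = 1"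
      using n by (simp add: power_mult_distrib power_divide sum_divide_distrib[symmetric])
    then have "?w \<in> Sph" by (simp add: Sph_def)
    then have "qform k A ?w \<le> l" unfolding l_def by (rule cSUP_upper[OF _ bdd])
    then show ?thesis using n unfolding scale by (simp add: power_divide field_simps)
  qed
  define M where "M = (\<lambda>i j. (if i = j then l else 0) - A i j)"
  have symM: "\<forall>i<k. \<forall>j<k. M i j = M j i" using sym by (auto simp: M_def)
  \<comment> \<open>\<open>M = l I - A\<close> is a form whose null vectors are the eigenvectors of \<open>A\<close> for \<open>l\<close>.\<close>
  have mulM: "(\<Sum>j<k. M i j * v j) = l * v i - (\<Sum>j<k. A i j * v j)" if "i < k" for i v
  proof -
    have "(\<Sum>j<k. M i j * v j) = (\<Sum>j<k. (if j = i then l * v i else 0) - A i j * v j)"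
      by (intro sum.cong) (auto simp: M_def algebra_simps)
    then show ?thesis using that by (simp add: sum_subtractf)
  qed
  have qM: "qform k M v = l * ?n v - qform k A v" for v
  proof -
    have alt: "qform k B v = (\<Sum>i<k. v i * (\<Sum>j<k. B i j * v j))" for B
      unfolding qform_def sum_distrib_left by (intro sum.cong refl) (simp add: algebra_simps)
    have "qform k M v = (\<Sum>i<k. l * (v i)\<^sup>2 - v i * (\<Sum>j<k. A i j * v j))"
      unfolding alt
    proof (intro sum.cong refl)
      fix i assume "i \<in> {..<k}"
      then have e: "(\<Sum>j<k. M i j * v j) = l * v i - (\<Sum>j<k. A i j * v j)" by (intro mulM) simp
      show "v i * (\<Sum>j<k. M i j * v j) = l * (v i)\<^sup>2 - v i * (\<Sum>j<k. A i j * v j)"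
        unfolding e by (simp only: power2_eq_square right_diff_distrib mult.left_commute)
    qed
    then show ?thesis unfolding alt by (simp add: sum_subtractf sum_distrib_left)
  qed
  have psd: "0 \<le> qform k M v" for v using le[of v] qM[of v] by simp
  have "\<not> pos_def_form k M"
  proof
    assume "pos_def_form k M"
    then obtain c where c: "c > 0" "\<And>v. c * ?n v \<le> qform k M v"
      using pos_def_form_coercive by blast
    have "l \<le> l - c" unfolding l_def
    proof (rule cSUP_least)
      show "Sph \<noteq> {}" using ne by blast
      fix v assume "v \<in> Sph"
      then show "qform k A v \<le> (SUP v\<in>Sph. qform k A v) - c"
        using c(2)[of v] qM[of v] by (simp add: Sph_def l_def)
    qed
    then show False using c by simp
  qed
  then obtain v where v: "\<exists>i<k. v i \<noteq> 0" "\<not> 0 < qform k M v"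
    using symM unfolding pos_def_form_def by blast
  then have "qform k M v = 0" using psd[of v] by simp
  then have "(\<Sum>j<k. M i j * v j) = 0" if "i < k" for i
    using psd_kernel[OF symM psd] that by blast
  then have "\<forall>i<k. (\<Sum>j<k. A i j * v j) = l * v i" using mulM by simp
  then show ?thesis using le v(1) by blast
qed

lemma scalar_prod_mult_qform:
  assumes "A \<in> carrier_mat k k"
  shows "scalar_prod (vec k v) (mult_mat_vec A (vec k v)) = qform k (\<lambda>i j. A $$ (i, j)) v"
proof -
  have "scalar_prod (vec k v) (mult_mat_vec A (vec k v))
     = (\<Sum>i<k. v i * (\<Sum>j<k. A $$ (i, j) * v j))"
    using assms by (auto simp: scalar_prod_def lessThan_atLeast0 intro!: sum.cong)
  then show ?thesis
    unfolding qform_def by (simp add: sum_distrib_left ac_simps)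
qed

lemma mult_mat_vec_nth:
  assumes "A \<in> carrier_mat k k" "i < k"
  shows "vec_index (mult_mat_vec A (vec k v)) i = (\<Sum>j<k. A $$ (i, j) * v j)"
  using assms by (auto simp: scalar_prod_def lessThan_atLeast0 intro!: sum.cong)

lemma mat_of_entries: "A \<in> carrier_mat k k \<Longrightarrow> mat k k (($$) A) = A"
  by (intro eq_matI) auto

lemma symmetric_entries:
  assumes "A \<in> carrier_mat k k" "transpose_mat A = A"
  shows "\<forall>i<k. \<forall>j<k. A $$ (i, j) = A $$ (j, i)"
proof (intro allI impI)
  fix i j assume "i < k" "j < k"
  then have "transpose_mat A $$ (i, j) = A $$ (j, i)" using assms(1) by simp
  then show "A $$ (i, j) = A $$ (j, i)" unfolding assms(2) .
qed

lemma pos_def_mat_form: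
  assumes "pos_def_mat k A"
  shows "pos_def_form k (\<lambda>i j. A $$ (i, j))"
  unfolding pos_def_form_def
proof (intro conjI impI)
  have A: "A \<in> carrier_mat k k" "transpose_mat A = A"
    and pos: "\<And>v. v \<in> carrier_vec k \<Longrightarrow> v \<noteq> 0\<^sub>v k \<Longrightarrow> scalar_prod v (mult_mat_vec A v) > 0"
    using assms unfolding pos_def_mat_def by auto
  show "\<forall>i<k. \<forall>j<k. A $$ (i, j) = A $$ (j, i)" by (rule symmetric_entries[OF A])
  show "\<forall>v. (\<exists>i<k. v i \<noteq> 0) \<longrightarrow> 0 < qform k (\<lambda>i j. A $$ (i, j)) v"
  proof (intro allI impI)
    fix v :: "nat \<Rightarrow> real" assume "\<exists>i<k. v i \<noteq> 0"
    then have "vec k v \<noteq> 0\<^sub>v k" by (metis index_vec index_zero_vec(1))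
    then have "scalar_prod (vec k v) (mult_mat_vec A (vec k v)) > 0" by (intro pos) auto
    then show "0 < qform k (\<lambda>i j. A $$ (i, j)) v" by (simp add: scalar_prod_mult_qform[OF A(1)])
  qed
qed

lemma inv_mat_props:
  assumes "pos_def_mat k V"
  shows "inv_mat V \<in> carrier_mat k k" "V * inv_mat V = 1\<^sub>m k" "inv_mat V * V = 1\<^sub>m k"
    "transpose_mat (inv_mat V) = inv_mat V"
    "Determinant.det V > 0" "Determinant.det (inv_mat V) = 1 / Determinant.det V"
    "pos_def_form k (\<lambda>i j. inv_mat V $$ (i, j))"
proof -
  have V: "V \<in> carrier_mat k k" "transpose_mat V = V" using assms by (auto simp: pos_def_mat_def)
  note pd = pos_def_mat_form[OF assms]
  show det: "Determinant.det V > 0" using pos_def_form_det(1)[OF pd] by (simp add: mat_of_entries V)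
  have "V \<in> Units (ring_mat TYPE(real) k undefined)"
    using det_non_zero_imp_unit[OF V(1)] det by simp
  then obtain P where P: "mat_inverse V = Some P" using mat_inverse(1)[OF V(1)] by (metis not_None_eq)
  then have iP: "inv_mat V = P" by (simp add: inv_mat_def)
  note PP = mat_inverse(2)[OF V(1) P]
  show c: "inv_mat V \<in> carrier_mat k k" and r: "V * inv_mat V = 1\<^sub>m k" and l: "inv_mat V * V = 1\<^sub>m k"
    using PP iP by auto
  show t: "transpose_mat (inv_mat V) = inv_mat V"
  proof -
    have "transpose_mat (V * inv_mat V) = transpose_mat (inv_mat V) * V"
      using transpose_mult[OF V(1) c] V(2) by simp
    then have "transpose_mat (inv_mat V) * V = 1\<^sub>m k" using r by simp
    then have "transpose_mat (inv_mat V) * V * inv_mat V = inv_mat V" using c by simp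
    moreover have "transpose_mat (inv_mat V) * V * inv_mat V = transpose_mat (inv_mat V)"
      using c V r by (subst assoc_mult_mat[of _ k k _ k _ k]) auto
    ultimately show ?thesis by simp
  qed
  have "Determinant.det V * Determinant.det (inv_mat V) = 1"
    using det_mult[OF V(1) c] r by simp
  then show "Determinant.det (inv_mat V) = 1 / Determinant.det V"
    using det by (simp add: field_simps)
  show "pos_def_form k (\<lambda>i j. inv_mat V $$ (i, j))"
    unfolding pos_def_form_def
  proof (intro conjI allI impI)
    show "inv_mat V $$ (i, j) = inv_mat V $$ (j, i)" if "i < k" "j < k" for i j
      using symmetric_entries[OF c t] that by blast
    fix v :: "nat \<Rightarrow> real" assume "\<exists>i<k. v i \<noteq> 0"
    then have v: "vec k v \<noteq> 0\<^sub>v k" by (metis index_vec index_zero_vec(1))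
    define w where "w = mult_mat_vec (inv_mat V) (vec k v)"
    have w: "w \<in> carrier_vec k" using c by (simp add: w_def)
    have Vw: "mult_mat_vec V w = vec k v"
      unfolding w_def using V c r by (subst assoc_mult_mat_vec[symmetric, of _ k k _ k]) auto
    have "w \<noteq> 0\<^sub>v k"
    proof
      assume "w = 0\<^sub>v k"
      then have "mult_mat_vec V w = 0\<^sub>v k" using V by auto
      then show False using Vw v by simp
    qed
    then have "0 < scalar_prod w (mult_mat_vec V w)"
      using assms w unfolding pos_def_mat_def by blast
    also have "\<dots> = scalar_prod (vec k v) w"
      unfolding Vw using w by (intro comm_scalar_prod) auto
    also have "\<dots> = qform k (\<lambda>i j. inv_mat V $$ (i, j)) v"
      unfolding w_def by (rule scalar_prod_mult_qform[OF c])
    finally show "0 < qform k (\<lambda>i j. inv_mat V $$ (i, j)) v" .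
  qed
qed

text \<open>The extremal value of the Rayleigh quotient is an eigenvalue, hence at most the largest one.\<close>

lemma qform_le_ch1:
  assumes A: "A \<in> carrier_mat k k" "transpose_mat A = A"
  shows "qform k (\<lambda>i j. A $$ (i, j)) v \<le> ch1 A * (\<Sum>i<k. (v i)\<^sup>2)"
proof (cases "k = 0")
  case True
  then show ?thesis by (simp add: qform_def)
next
  case False
  then have k: "k > 0" by simp
  from rayleigh_eigenvector[OF symmetric_entries[OF A] k]
  obtain l where l': "(\<forall>v. qform k (\<lambda>i j. A $$ (i, j)) v \<le> l * (\<Sum>i<k. (v i)\<^sup>2)) \<and>
    (\<exists>u. (\<exists>i<k. u i \<noteq> 0) \<and> (\<forall>i<k. (\<Sum>j<k. A $$ (i, j) * u j) = l * u i))"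
    by (rule exE)
  from conjunct2[OF l'] obtain u
    where u': "(\<exists>i<k. u i \<noteq> 0) \<and> (\<forall>i<k. (\<Sum>j<k. A $$ (i, j) * u j) = l * u i)" by (rule exE)
  note l = spec[OF conjunct1[OF l']] and u = conjunct1[OF u'] conjunct2[OF u']
  have "eigenvector A (vec k u) l"
    unfolding eigenvector_def
  proof (intro conjI)
    show "vec k u \<noteq> 0\<^sub>v (dim_row A)" using u(1) A by (metis index_vec index_zero_vec(1) carrier_matD(1))
    show "mult_mat_vec A (vec k u) = l \<cdot>\<^sub>v vec k u"
    proof (rule eq_vecI)
      fix i assume "i < dim_vec (l \<cdot>\<^sub>v vec k u)"
      then have i: "i < k" by simp
      then show "vec_index (mult_mat_vec A (vec k u)) i = vec_index (l \<cdot>\<^sub>v vec k u) i"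
        using mult_mat_vec_nth[OF A(1) i] u(2) by simp
    qed (use A in auto)
  qed (use A in auto)
  then have "eigenvalue A l" unfolding eigenvalue_def by blast
  moreover have "finite {k. eigenvalue A k}"
  proof -
    have "char_poly A \<noteq> 0" using degree_monic_char_poly[OF A(1)] by auto
    then show ?thesis unfolding eigenvalue_root_char_poly[OF A(1)] by (rule poly_roots_finite)
  qed
  ultimately have "l \<le> ch1 A" unfolding ch1_def by (intro Max_ge) auto
  then have "l * (\<Sum>i<k. (v i)\<^sup>2) \<le> ch1 A * (\<Sum>i<k. (v i)\<^sup>2)"
    by (intro mult_right_mono sum_nonneg) auto
  then show ?thesis using l[of v] by simp
qed

lemma diag_le_ch1:
  assumes A: "A \<in> carrier_mat k k" "transpose_mat A = A" and m: "m < k"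
  shows "A $$ (m, m) \<le> ch1 A"
proof -
  have "(\<Sum>i<k. (if i = m then 1 else 0 :: real)\<^sup>2) = (\<Sum>i<k. if i = m then 1 else 0)"
    by (intro sum.cong) auto
  then show ?thesis using qform_le_ch1[OF A, of "\<lambda>i. if i = m then 1 else 0"] qform_unit[OF m] m by simp
qed

lemma det_le_ch1_power:
  assumes "pos_def_mat k V"
  shows "Determinant.det V \<le> ch1 V ^ k"
proof -
  have V: "V \<in> carrier_mat k k" "transpose_mat V = V" using assms by (auto simp: pos_def_mat_def)
  note pd = pos_def_mat_form[OF assms]
  have "Determinant.det V \<le> (\<Prod>i<k. V $$ (i, i))" using pos_def_form_det(2)[OF pd] by (simp add: mat_of_entries V)
  also have "\<dots> \<le> (\<Prod>i<k. ch1 V)"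
    by (intro prod_mono) (use diag_le_ch1[OF V] pos_def_form_diag[OF pd] in \<open>auto intro: less_imp_le\<close>)
  finally show ?thesis by simp
qed

lemma ch1_pos: "pos_def_mat k V \<Longrightarrow> k > 0 \<Longrightarrow> ch1 V > 0"
  using diag_le_ch1[of V k 0] pos_def_form_diag[OF pos_def_mat_form, of k V 0]
  by (auto simp: pos_def_mat_def)

section \<open>The Gaussian coefficient prior\<close>

abbreviation coord :: "nat set \<Rightarrow> (nat \<Rightarrow> real) \<Rightarrow> nat \<Rightarrow> real" where
  "coord \<gamma> \<beta> \<equiv> (\<lambda>i. \<beta> (sorted_list_of_set \<gamma> ! i))"

lemma nth_sorted_list_mem: "finite \<gamma> \<Longrightarrow> i < card \<gamma> \<Longrightarrow> sorted_list_of_set \<gamma> ! i \<in> \<gamma>"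
  by (metis nth_mem set_sorted_list_of_set length_sorted_list_of_set)

lemma sum_coord:
  assumes "finite \<gamma>"
  shows "(\<Sum>i<card \<gamma>. h (sorted_list_of_set \<gamma> ! i)) = sum h \<gamma>"
proof -
  have "sum h \<gamma> = sum_list (map h (sorted_list_of_set \<gamma>))"
    using assms by (simp add: sum_list_distinct_conv_sum_set)
  also have "\<dots> = (\<Sum>i<card \<gamma>. h (sorted_list_of_set \<gamma> ! i))"
    by (simp add: sum_list_sum_nth lessThan_atLeast0)
  finally show ?thesis ..
qed

lemma measurable_qform_coord [measurable]:
  assumes "finite \<gamma>"
  shows "(\<lambda>\<beta>. qform (card \<gamma>) A (coord \<gamma> \<beta>)) \<in> borel_measurable (PiM \<gamma> (\<lambda>_. lborel))"
proof -
  have [measurable]: "(\<lambda>\<beta>. \<beta> (sorted_list_of_set \<gamma> ! i)) \<in> borel_measurable (PiM \<gamma> (\<lambda>_. lborel))" if "i < card \<gamma>" for i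
  proof -
    have "(\<lambda>\<beta>. \<beta> (sorted_list_of_set \<gamma> ! i)) \<in> PiM \<gamma> (\<lambda>_. lborel) \<rightarrow>\<^sub>M lborel"
      by (rule measurable_component_singleton) (rule nth_sorted_list_mem[OF assms that])
    then show ?thesis by simp
  qed
  show ?thesis unfolding qform_def by (intro borel_measurable_sum) simp
qed

lemma nn_integral_gauss1:
  assumes d: "d > 0"
  shows "(\<integral>\<^sup>+t. ennreal (exp (- (d * (t + c)\<^sup>2) / 2)) \<partial>lborel) = ennreal (sqrt (2 * pi / d))"
proof -
  have "exp (- (d * (t + c)\<^sup>2) / 2) = sqrt (2 * pi / d) * normal_density (- c) (1 / sqrt d) t" for t
    using d by (simp add: normal_density_def power_divide real_sqrt_mult real_sqrt_divide field_simps)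
  then have "(\<integral>\<^sup>+t. ennreal (exp (- (d * (t + c)\<^sup>2) / 2)) \<partial>lborel)
    = (\<integral>\<^sup>+t. ennreal (sqrt (2 * pi / d)) * ennreal (normal_density (- c) (1 / sqrt d) t) \<partial>lborel)"
    using d by (simp add: ennreal_mult normal_density_nonneg)
  also have "\<dots> = ennreal (sqrt (2 * pi / d)) * (\<integral>\<^sup>+t. ennreal (normal_density (- c) (1 / sqrt d) t) \<partial>lborel)"
    by (rule nn_integral_cmult) simp
  also have "(\<integral>\<^sup>+t. ennreal (normal_density (- c) (1 / sqrt d) t) \<partial>lborel) = 1"
    using prob_space.emeasure_space_1[OF prob_space_normal_density[of "1 / sqrt d" "- c"]] d
    by (simp add: emeasure_density)
  finally show ?thesis by simp
qed

interpretation lborel_prod: product_sigma_finite "\<lambda>_::nat. lborel :: real measure"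
  by unfold_locales

text \<open>The models are built up by adding their largest index, which appends one coordinate to the
coefficient vector. That coordinate is integrated out by completing the square, and the Schur
complement remains.\<close>

lemma nn_integral_gauss:
  assumes "finite \<gamma>" "pos_def_form (card \<gamma>) A"
  shows "(\<integral>\<^sup>+\<beta>. ennreal (exp (- qform (card \<gamma>) A (coord \<gamma> \<beta>) / 2)) \<partial>(PiM \<gamma> (\<lambda>_. lborel)))
    = ennreal (sqrt ((2 * pi) ^ card \<gamma> / Determinant.det (mat (card \<gamma>) (card \<gamma>) (\<lambda>(i, j). A i j))))"
  using assms
proof (induction \<gamma> arbitrary: A rule: finite_linorder_max_induct)
  case empty
  show ?case by (simp add: qform_def lborel_prod.nn_integral_empty PiM_empty)
next
  case (insert m \<gamma>)
  have m: "m \<notin> \<gamma>" using insert.hyps by auto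
  have c: "card (insert m \<gamma>) = Suc (card \<gamma>)" using insert.hyps m by simp
  let ?k = "card \<gamma>"
  have A: "pos_def_form (Suc ?k) A" using insert.prems c by simp
  have d: "A ?k ?k > 0" using pos_def_form_diag[OF A, of ?k] by simp
  have sl: "sorted_list_of_set (insert m \<gamma>) = sorted_list_of_set \<gamma> @ [m]"
    using insert.hyps m by (intro sorted_list_of_set_unique[THEN iffD1]) (auto simp: sorted_wrt_append)
  let ?S = "schur ?k A"
  let ?D = "Determinant.det (mat ?k ?k (\<lambda>(i, j). ?S i j))"
  have D: "?D > 0" using pos_def_form_det(1)[OF pos_def_form_schur[OF A]] .
  have q: "qform (Suc ?k) A (coord (insert m \<gamma>) (\<beta>(m := t)))
      = qform ?k ?S (coord \<gamma> \<beta>) + A ?k ?k * (t + (\<Sum>i<?k. A i ?k * coord \<gamma> \<beta> i) / A ?k ?k)\<^sup>2" for \<beta> t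
  proof -
    have e: "coord (insert m \<gamma>) (\<beta>(m := t)) i = coord \<gamma> \<beta> i" if "i < ?k" for i
      using that nth_sorted_list_mem[OF insert.hyps(1) that] m by (auto simp: sl nth_append)
    have "qform ?k ?S (coord (insert m \<gamma>) (\<beta>(m := t))) = qform ?k ?S (coord \<gamma> \<beta>)"
      by (rule qform_cong) (rule e)
    moreover have "(\<Sum>i<?k. A i ?k * coord (insert m \<gamma>) (\<beta>(m := t)) i) = (\<Sum>i<?k. A i ?k * coord \<gamma> \<beta> i)"
      using e by simp
    moreover have "coord (insert m \<gamma>) (\<beta>(m := t)) ?k = t" by (simp add: sl nth_append)
    ultimately show ?thesis
      using qform_Suc[OF pos_def_form_sym[OF A], of "coord (insert m \<gamma>) (\<beta>(m := t))"] d by simp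
  qed
  have "(\<integral>\<^sup>+\<beta>. ennreal (exp (- qform (Suc ?k) A (coord (insert m \<gamma>) \<beta>) / 2)) \<partial>(PiM (insert m \<gamma>) (\<lambda>_. lborel)))
    = (\<integral>\<^sup>+\<beta>. (\<integral>\<^sup>+t. ennreal (exp (- qform (Suc ?k) A (coord (insert m \<gamma>) (\<beta>(m := t))) / 2)) \<partial>lborel) \<partial>(PiM \<gamma> (\<lambda>_. lborel)))"
    using measurable_qform_coord[of "insert m \<gamma>" A] insert.hyps m
    by (intro lborel_prod.product_nn_integral_insert) (auto simp: c)
  also have "\<dots> = (\<integral>\<^sup>+\<beta>. ennreal (sqrt (2 * pi / A ?k ?k)) * ennreal (exp (- qform ?k ?S (coord \<gamma> \<beta>) / 2)) \<partial>(PiM \<gamma> (\<lambda>_. lborel)))"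
  proof (rule nn_integral_cong)
    fix \<beta> :: "nat \<Rightarrow> real"
    let ?c = "(\<Sum>i<?k. A i ?k * coord \<gamma> \<beta> i) / A ?k ?k"
    have "(\<integral>\<^sup>+t. ennreal (exp (- qform (Suc ?k) A (coord (insert m \<gamma>) (\<beta>(m := t))) / 2)) \<partial>lborel)
      = (\<integral>\<^sup>+t. ennreal (exp (- qform ?k ?S (coord \<gamma> \<beta>) / 2)) * ennreal (exp (- (A ?k ?k * (t + ?c)\<^sup>2) / 2)) \<partial>lborel)"
      unfolding q by (simp add: ennreal_mult[symmetric] exp_add[symmetric] add_divide_distrib diff_divide_distrib)
    also have "\<dots> = ennreal (exp (- qform ?k ?S (coord \<gamma> \<beta>) / 2)) * (\<integral>\<^sup>+t. ennreal (exp (- (A ?k ?k * (t + ?c)\<^sup>2) / 2)) \<partial>lborel)"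
      by (rule nn_integral_cmult) simp
    finally show "(\<integral>\<^sup>+t. ennreal (exp (- qform (Suc ?k) A (coord (insert m \<gamma>) (\<beta>(m := t))) / 2)) \<partial>lborel)
      = ennreal (sqrt (2 * pi / A ?k ?k)) * ennreal (exp (- qform ?k ?S (coord \<gamma> \<beta>) / 2))"
      unfolding nn_integral_gauss1[OF d] by (simp add: mult.commute)
  qed
  also have "\<dots> = ennreal (sqrt (2 * pi / A ?k ?k)) * (\<integral>\<^sup>+\<beta>. ennreal (exp (- qform ?k ?S (coord \<gamma> \<beta>) / 2)) \<partial>(PiM \<gamma> (\<lambda>_. lborel)))"
    using measurable_qform_coord[of \<gamma> ?S] insert.hyps(1)
    by (intro nn_integral_cmult) auto
  also have "\<dots> = ennreal (sqrt (2 * pi / A ?k ?k)) * ennreal (sqrt ((2 * pi) ^ ?k / ?D))"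
    by (subst insert.IH[OF pos_def_form_schur[OF A]]) simp
  also have "\<dots> = ennreal (sqrt (2 * pi / A ?k ?k * ((2 * pi) ^ ?k / ?D)))"
    using d D by (simp add: ennreal_mult[symmetric] real_sqrt_mult[symmetric])
  also have "2 * pi / A ?k ?k * ((2 * pi) ^ ?k / ?D) = (2 * pi) ^ Suc ?k / Determinant.det (mat (Suc ?k) (Suc ?k) (\<lambda>(i, j). A i j))"
    using d D by (simp add: det_schur)
  finally show ?case unfolding c .
qed

lemma PiM_lborel_translate:
  fixes s :: "nat \<Rightarrow> real"
  assumes "finite \<gamma>" and [measurable]: "F \<in> borel_measurable (PiM \<gamma> (\<lambda>_. lborel))"
  shows "(\<integral>\<^sup>+\<beta>. F (\<lambda>i\<in>\<gamma>. s i + \<beta> i) \<partial>(PiM \<gamma> (\<lambda>_. lborel))) = (\<integral>\<^sup>+\<beta>. F \<beta> \<partial>(PiM \<gamma> (\<lambda>_. lborel)))"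
proof -
  let ?M = "PiM \<gamma> (\<lambda>_. lborel) :: (nat \<Rightarrow> real) measure"
  let ?t = "\<lambda>\<beta>. \<lambda>i\<in>\<gamma>. s i + \<beta> i"
  have t [measurable]: "?t \<in> ?M \<rightarrow>\<^sub>M ?M" by measurable
  have "distr ?M ?M ?t = ?M"
  proof (rule lborel_prod.PiM_eqI)
    fix A :: "nat \<Rightarrow> real set" assume A: "\<And>i. i \<in> \<gamma> \<Longrightarrow> A i \<in> sets lborel"
    have "emeasure (distr ?M ?M ?t) (PiE \<gamma> A) = emeasure ?M (?t -` PiE \<gamma> A \<inter> space ?M)"
      using A assms by (intro emeasure_distr) auto
    also have "?t -` PiE \<gamma> A \<inter> space ?M = PiE \<gamma> (\<lambda>i. (+) (s i) -` A i)"
      by (auto simp: space_PiM PiE_def Pi_def extensional_def)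
    also have "emeasure ?M \<dots> = (\<Prod>i\<in>\<gamma>. emeasure lborel ((+) (s i) -` A i))"
    proof (rule lborel_prod.emeasure_PiM[OF assms(1)])
      fix i assume "i \<in> \<gamma>"
      have "(+) (s i) -` A i \<inter> space (borel::real measure) \<in> sets borel"
        by (rule measurable_sets[of _ borel borel]) (use A[OF \<open>i \<in> \<gamma>\<close>] in auto)
      then show "(+) (s i) -` A i \<in> sets lborel" by simp
    qed
    also have "\<dots> = (\<Prod>i\<in>\<gamma>. emeasure lborel (A i))"
    proof (rule prod.cong[OF refl])
      fix i assume "i \<in> \<gamma>"
      have "emeasure lborel (A i) = emeasure (distr lborel borel ((+) (s i))) (A i)"
        by (simp add: lborel_distr_plus)
      also have "\<dots> = emeasure lborel ((+) (s i) -` A i)"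
        using A[OF \<open>i \<in> \<gamma>\<close>] by (subst emeasure_distr) auto
      finally show "emeasure lborel ((+) (s i) -` A i) = emeasure lborel (A i)" ..
    qed
    finally show "emeasure (distr ?M ?M ?t) (PiE \<gamma> A) = (\<Prod>i\<in>\<gamma>. emeasure lborel (A i))" .
  qed (use assms in auto)
  then have "(\<integral>\<^sup>+\<beta>. F \<beta> \<partial>?M) = (\<integral>\<^sup>+\<beta>. F \<beta> \<partial>(distr ?M ?M ?t))" by simp
  also have "\<dots> = (\<integral>\<^sup>+\<beta>. F (?t \<beta>) \<partial>?M)" by (rule nn_integral_distr) measurable
  finally show ?thesis ..
qed

lemma mvn_density_coef_vec:
  assumes "pos_def_mat (card \<gamma>) V"
  shows "mvn_density (card \<gamma>) V (coef_vec \<gamma> \<beta>)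
    = exp (- qform (card \<gamma>) (\<lambda>i j. inv_mat V $$ (i, j)) (coord \<gamma> \<beta>) / 2) / sqrt ((2 * pi) ^ card \<gamma> * Determinant.det V)"
  unfolding mvn_density_def coef_vec_def
  by (subst scalar_prod_mult_qform[OF inv_mat_props(1)[OF assms]]) simp

lemma measurable_mvn_density [measurable]:
  assumes "finite \<gamma>" "pos_def_mat (card \<gamma>) V"
  shows "(\<lambda>\<beta>. mvn_density (card \<gamma>) V (coef_vec \<gamma> \<beta>)) \<in> borel_measurable (PiM \<gamma> (\<lambda>_. lborel))"
  unfolding mvn_density_coef_vec[OF assms(2)] using measurable_qform_coord[OF assms(1)] by measurable

lemma sets_coef_prior [simp, measurable_cong]: "sets (coef_prior V \<gamma>) = sets (PiM \<gamma> (\<lambda>_. borel))"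
  by (simp add: coef_prior_def cong: sets_PiM_cong)

lemma space_coef_prior [simp]: "space (coef_prior V \<gamma>) = (\<Pi>\<^sub>E i\<in>\<gamma>. UNIV)"
  by (simp add: coef_prior_def space_PiM)

text \<open>Tilting by a linear functional is the same as translating by \<open>s\<close> times the corresponding column of
\<open>V\<close>, by translation invariance of Lebesgue measure.\<close>

lemma coef_prior_mgf:
  assumes fin: "finite \<gamma>" and pd: "pos_def_mat (card \<gamma>) V" and m: "m < card \<gamma>"
  shows "(\<integral>\<^sup>+\<beta>. ennreal (exp (s * coord \<gamma> \<beta> m)) \<partial>(coef_prior V \<gamma>)) = ennreal (exp (s\<^sup>2 * V $$ (m, m) / 2))"
proof -
  let ?k = "card \<gamma>" and ?M = "PiM \<gamma> (\<lambda>_. lborel) :: (nat \<Rightarrow> real) measure"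
  define A where "A = (\<lambda>i j. inv_mat V $$ (i, j))"
  define w where "w = (\<lambda>i. V $$ (i, m))"
  define n where "n = sqrt ((2 * pi) ^ ?k * Determinant.det V)"
  have V: "V \<in> carrier_mat ?k ?k" using pd by (simp add: pos_def_mat_def)
  note P = inv_mat_props[OF pd]
  have n: "n > 0" using P(5) by (simp add: n_def)
  have A: "pos_def_form ?k A" using P(7) by (simp add: A_def)
  have Aw: "(\<Sum>j<?k. A i j * w j) = (if i = m then 1 else 0)" if "i < ?k" for i
  proof -
    have "(inv_mat V * V) $$ (i, m) = (\<Sum>j<?k. A i j * w j)"
      using P(1) V that m by (auto simp: scalar_prod_def lessThan_atLeast0 A_def w_def)
    then show ?thesis using P(3) that m by simp
  qed
  \<comment> \<open>\<open>w\<close> is column \<open>m\<close> of \<open>V\<close>, so \<open>A w\<close> is the unit vector: completing the square moves \<open>v\<close> by \<open>s w\<close>.\<close>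
  have shift: "qform ?k A (\<lambda>i. v i + s * w i) = qform ?k A v + 2 * s * v m + s\<^sup>2 * V $$ (m, m)" for v
  proof -
    have "(\<Sum>i<?k. v i * (\<Sum>j<?k. A i j * w j)) = (\<Sum>i<?k. if i = m then v m else 0)" for v
      by (intro sum.cong) (auto simp: Aw)
    then have e: "(\<Sum>i<?k. v i * (\<Sum>j<?k. A i j * w j)) = v m" for v using m by simp
    have "qform ?k A w = (\<Sum>i<?k. w i * (\<Sum>j<?k. A i j * w j))"
      unfolding qform_def by (simp add: sum_distrib_left ac_simps)
    then have "qform ?k A w = V $$ (m, m)" unfolding e by (simp add: w_def)
    then show ?thesis unfolding qform_add[OF pos_def_form_sym[OF A]] e by simp
  qed
  note mc [measurable] = measurable_qform_coord[OF fin, of A]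
  have [measurable]: "(\<lambda>\<beta>. coord \<gamma> \<beta> m) \<in> borel_measurable ?M"
  proof -
    have "(\<lambda>\<beta>. coord \<gamma> \<beta> m) \<in> ?M \<rightarrow>\<^sub>M lborel"
      by (rule measurable_component_singleton) (rule nth_sorted_list_mem[OF fin m])
    then show ?thesis by simp
  qed
  let ?F = "\<lambda>\<beta>. ennreal (exp (s * coord \<gamma> \<beta> m - qform ?k A (coord \<gamma> \<beta>) / 2))"
  define \<tau> where "\<tau> = (\<lambda>j. s * w (inv_into {..<?k} (\<lambda>i. sorted_list_of_set \<gamma> ! i) j))"
  have \<tau>: "\<tau> (sorted_list_of_set \<gamma> ! i) = s * w i" if "i < ?k" for i
  proof -
    have "inj_on (\<lambda>i. sorted_list_of_set \<gamma> ! i) {..<?k}"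
      by (intro inj_onI) (use nth_eq_iff_index_eq[of "sorted_list_of_set \<gamma>"] fin in auto)
    then show ?thesis using that by (simp add: \<tau>_def inv_into_f_f)
  qed
  have co: "coord \<gamma> (\<lambda>i\<in>\<gamma>. \<tau> i + \<beta> i) i = coord \<gamma> \<beta> i + s * w i" if "i < ?k" for \<beta> i
    using nth_sorted_list_mem[OF fin that] \<tau>[OF that] by simp
  have "(\<integral>\<^sup>+\<beta>. ennreal (exp (s * coord \<gamma> \<beta> m)) \<partial>(coef_prior V \<gamma>))
    = (\<integral>\<^sup>+\<beta>. ennreal (mvn_density ?k V (coef_vec \<gamma> \<beta>)) * ennreal (exp (s * coord \<gamma> \<beta> m)) \<partial>?M)"
    unfolding coef_prior_def
    using measurable_mvn_density[OF fin pd] by (intro nn_integral_density) auto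
  also have "\<dots> = (\<integral>\<^sup>+\<beta>. ennreal (1 / n) * ?F \<beta> \<partial>?M)"
  proof (rule nn_integral_cong)
    fix \<beta> :: "nat \<Rightarrow> real"
    have "exp (- q / 2) / n * exp x = 1 / n * exp (x - q / 2)" for x q
    proof -
      have "exp (x - q / 2) = exp (- q / 2) * exp x" unfolding exp_add[symmetric] by simp
      then show ?thesis by simp
    qed
    then show "ennreal (mvn_density ?k V (coef_vec \<gamma> \<beta>)) * ennreal (exp (s * coord \<gamma> \<beta> m)) = ennreal (1 / n) * ?F \<beta>"
      using n unfolding mvn_density_coef_vec[OF pd] A_def[symmetric] n_def[symmetric]
      by (subst (1 2) ennreal_mult[symmetric]) auto
  qed
  also have "\<dots> = ennreal (1 / n) * (\<integral>\<^sup>+\<beta>. ?F \<beta> \<partial>?M)"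
    by (rule nn_integral_cmult) measurable
  also have "(\<integral>\<^sup>+\<beta>. ?F \<beta> \<partial>?M) = (\<integral>\<^sup>+\<beta>. ?F (\<lambda>i\<in>\<gamma>. \<tau> i + \<beta> i) \<partial>?M)"
    by (rule PiM_lborel_translate[OF fin, symmetric]) measurable
  also have "\<dots> = (\<integral>\<^sup>+\<beta>. ennreal (exp (s\<^sup>2 * V $$ (m, m) / 2)) * ennreal (exp (- qform ?k A (coord \<gamma> \<beta>) / 2)) \<partial>?M)"
  proof (rule nn_integral_cong)
    fix \<beta> :: "nat \<Rightarrow> real"
    have "qform ?k A (coord \<gamma> (\<lambda>i\<in>\<gamma>. \<tau> i + \<beta> i)) = qform ?k A (\<lambda>i. coord \<gamma> \<beta> i + s * w i)"
      by (rule qform_cong) (rule co)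
    then have "s * coord \<gamma> (\<lambda>i\<in>\<gamma>. \<tau> i + \<beta> i) m - qform ?k A (coord \<gamma> (\<lambda>i\<in>\<gamma>. \<tau> i + \<beta> i)) / 2
      = s\<^sup>2 * V $$ (m, m) / 2 + (- qform ?k A (coord \<gamma> \<beta>) / 2)"
      unfolding co[OF m] shift by (simp add: w_def power2_eq_square field_simps)
    then show "?F (\<lambda>i\<in>\<gamma>. \<tau> i + \<beta> i) = ennreal (exp (s\<^sup>2 * V $$ (m, m) / 2)) * ennreal (exp (- qform ?k A (coord \<gamma> \<beta>) / 2))"
      by (simp only: exp_add ennreal_mult exp_ge_zero)
  qed
  also have "\<dots> = ennreal (exp (s\<^sup>2 * V $$ (m, m) / 2)) * (\<integral>\<^sup>+\<beta>. ennreal (exp (- qform ?k A (coord \<gamma> \<beta>) / 2)) \<partial>?M)"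
    by (rule nn_integral_cmult) measurable
  also have "(\<integral>\<^sup>+\<beta>. ennreal (exp (- qform ?k A (coord \<gamma> \<beta>) / 2)) \<partial>?M) = ennreal n"
    unfolding nn_integral_gauss[OF fin A] using P(1,6) by (simp add: A_def mat_of_entries n_def)
  finally show ?thesis using n by (simp add: ennreal_mult[symmetric])
qed

lemma prob_space_coef_prior:
  assumes fin: "finite \<gamma>" and pd: "pos_def_mat (card \<gamma>) V"
  shows "prob_space (coef_prior V \<gamma>)"
proof
  let ?k = "card \<gamma>" and ?M = "PiM \<gamma> (\<lambda>_. lborel) :: (nat \<Rightarrow> real) measure"
  define n where "n = sqrt ((2 * pi) ^ ?k * Determinant.det V)"
  note P = inv_mat_props[OF pd]
  let ?A = "\<lambda>i j. inv_mat V $$ (i, j)"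
  have n: "n > 0" using P(5) by (simp add: n_def)
  note mc [measurable] = measurable_qform_coord[OF fin, of ?A]
  have "emeasure (coef_prior V \<gamma>) (space (coef_prior V \<gamma>)) = (\<integral>\<^sup>+\<beta>. ennreal (mvn_density ?k V (coef_vec \<gamma> \<beta>)) \<partial>?M)"
    unfolding coef_prior_def
    using measurable_mvn_density[OF fin pd] by (subst emeasure_density) (auto cong: nn_integral_cong)
  also have "\<dots> = (\<integral>\<^sup>+\<beta>. ennreal (1 / n) * ennreal (exp (- qform ?k ?A (coord \<gamma> \<beta>) / 2)) \<partial>?M)"
    using n unfolding mvn_density_coef_vec[OF pd] n_def[symmetric]
    by (intro nn_integral_cong) (simp add: ennreal_mult[symmetric])
  also have "\<dots> = ennreal (1 / n) * (\<integral>\<^sup>+\<beta>. ennreal (exp (- qform ?k ?A (coord \<gamma> \<beta>) / 2)) \<partial>?M)"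
    by (rule nn_integral_cmult) measurable
  also have "(\<integral>\<^sup>+\<beta>. ennreal (exp (- qform ?k ?A (coord \<gamma> \<beta>) / 2)) \<partial>?M) = ennreal n"
    unfolding nn_integral_gauss[OF fin P(7)] using P(1,6) by (simp add: mat_of_entries n_def)
  finally show "emeasure (coef_prior V \<gamma>) (space (coef_prior V \<gamma>)) = 1"
    using n by (simp add: ennreal_mult[symmetric])
qed

text \<open>Chernoff's bound with \<open>s = C / b\<close>, applied to both signs of the coordinate.\<close>

lemma coef_prior_tail:
  assumes fin: "finite \<gamma>" and pd: "pos_def_mat (card \<gamma>) V" and j: "j \<in> \<gamma>"
    and b: "ch1 V \<le> b" and C: "C > 0"
  shows "emeasure (coef_prior V \<gamma>) {\<beta> \<in> space (coef_prior V \<gamma>). \<bar>\<beta> j\<bar> > C} \<le> ennreal (2 * exp (- C\<^sup>2 / (2 * b)))"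
proof -
  let ?k = "card \<gamma>" and ?N = "coef_prior V \<gamma>"
  obtain m where m: "m < ?k" "sorted_list_of_set \<gamma> ! m = j"
    using j fin by (metis in_set_conv_nth set_sorted_list_of_set length_sorted_list_of_set)
  have V: "V \<in> carrier_mat ?k ?k" "transpose_mat V = V" using pd by (auto simp: pos_def_mat_def)
  have vb: "V $$ (m, m) \<le> b" using diag_le_ch1[OF V m(1)] b by simp
  have b0: "b > 0" using ch1_pos[OF pd] m(1) b by linarith
  define s where "s = C / b"
  have s: "s > 0" using C b0 by (simp add: s_def)
  have [measurable]: "(\<lambda>\<beta>. \<beta> j) \<in> borel_measurable ?N"
    using measurable_component_singleton[OF j, of "\<lambda>_. borel :: real measure"]
    by (subst measurable_cong_sets[OF sets_coef_prior refl])
  have "emeasure ?N {\<beta> \<in> space ?N. \<bar>\<beta> j\<bar> > C} = (\<integral>\<^sup>+\<beta>. indicator {\<beta> \<in> space ?N. \<bar>\<beta> j\<bar> > C} \<beta> \<partial>?N)"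
    by (rule nn_integral_indicator[symmetric]) measurable
  also have "\<dots> \<le> (\<integral>\<^sup>+\<beta>. ennreal (exp (- s * C)) * (ennreal (exp (s * \<beta> j)) + ennreal (exp ((- s) * \<beta> j))) \<partial>?N)"
  proof (rule nn_integral_mono)
    fix \<beta>
    show "indicator {\<beta> \<in> space ?N. \<bar>\<beta> j\<bar> > C} \<beta> \<le> ennreal (exp (- s * C)) * (ennreal (exp (s * \<beta> j)) + ennreal (exp ((- s) * \<beta> j)))"
    proof (cases "\<bar>\<beta> j\<bar> > C")
      case True
      have "exp (s * C) \<le> exp (s * \<bar>\<beta> j\<bar>)" using True s by simp
      also have "\<dots> \<le> exp (s * \<beta> j) + exp ((- s) * \<beta> j)"
        by (cases "\<beta> j \<ge> 0") (auto simp: add_increasing add_increasing2)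
      finally have "1 \<le> exp (- s * C) * (exp (s * \<beta> j) + exp ((- s) * \<beta> j))"
        by (simp add: exp_minus field_simps)
      then have "1 \<le> ennreal (exp (- s * C) * (exp (s * \<beta> j) + exp ((- s) * \<beta> j)))"
        by simp
      also have "\<dots> = ennreal (exp (- s * C)) * (ennreal (exp (s * \<beta> j)) + ennreal (exp ((- s) * \<beta> j)))"
        by (subst ennreal_mult) auto
      finally have "1 \<le> ennreal (exp (- s * C)) * (ennreal (exp (s * \<beta> j)) + ennreal (exp ((- s) * \<beta> j)))" .
      then show ?thesis by (simp add: indicator_def)
    qed simp
  qed
  also have "\<dots> = ennreal (exp (- s * C)) * ((\<integral>\<^sup>+\<beta>. ennreal (exp (s * \<beta> j)) \<partial>?N) + (\<integral>\<^sup>+\<beta>. ennreal (exp ((- s) * \<beta> j)) \<partial>?N))"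
    by (subst nn_integral_cmult, measurable) (subst nn_integral_add, auto)
  also have "(\<integral>\<^sup>+\<beta>. ennreal (exp (s * \<beta> j)) \<partial>?N) = ennreal (exp (s\<^sup>2 * V $$ (m, m) / 2))"
    using coef_prior_mgf[OF fin pd m(1), of s] unfolding m(2) .
  also have "(\<integral>\<^sup>+\<beta>. ennreal (exp ((- s) * \<beta> j)) \<partial>?N) = ennreal (exp (s\<^sup>2 * V $$ (m, m) / 2))"
    using coef_prior_mgf[OF fin pd m(1), of "- s"] unfolding m(2) by simp
  also have "ennreal (exp (- s * C)) * (ennreal (exp (s\<^sup>2 * V $$ (m, m) / 2)) + ennreal (exp (s\<^sup>2 * V $$ (m, m) / 2)))
     = ennreal (2 * exp (- s * C + s\<^sup>2 * V $$ (m, m) / 2))"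
    by (simp only: ennreal_plus[symmetric] ennreal_mult[symmetric] exp_ge_zero add_nonneg_nonneg exp_add) (simp add: algebra_simps)
  also have "\<dots> \<le> ennreal (2 * exp (- C\<^sup>2 / (2 * b)))"
  proof (rule ennreal_leI)
    have "s\<^sup>2 * V $$ (m, m) / 2 \<le> s\<^sup>2 * b / 2" using vb by (simp add: mult_left_mono)
    moreover have "- s * C + s\<^sup>2 * b / 2 = - C\<^sup>2 / (2 * b)"
      using b0 by (simp add: s_def power2_eq_square field_simps)
    ultimately show "2 * exp (- s * C + s\<^sup>2 * V $$ (m, m) / 2) \<le> 2 * exp (- C\<^sup>2 / (2 * b))" by simp
  qed
  finally show ?thesis .
qed

text \<open>The density is bounded below on the box by its smallest possible exponent and by Hadamard's bound
for the determinant; the remaining factor is the volume of the box.\<close>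

lemma coef_prior_box:
  assumes fin: "finite \<gamma>" and pd: "pos_def_mat (card \<gamma>) V"
    and b: "ch1 (inv_mat V) \<le> b" "b \<ge> 0" and c: "ch1 V \<le> c" and S: "S \<ge> 0" and \<eta>: "\<eta> \<ge> 0"
    and ne: "\<gamma> \<noteq> {}"
    and sub: "\<And>\<beta>. (\<And>j. j \<in> \<gamma> \<Longrightarrow> \<bar>\<beta> j - \<beta>0 j\<bar> \<le> \<eta>) \<Longrightarrow> (\<Sum>j\<in>\<gamma>. (\<beta> j)\<^sup>2) \<le> S"
  shows "ennreal (exp (- b * S / 2) / sqrt ((2 * pi * c) ^ card \<gamma>) * (2 * \<eta>) ^ card \<gamma>)
    \<le> emeasure (coef_prior V \<gamma>) (\<Pi>\<^sub>E j\<in>\<gamma>. {\<beta>0 j - \<eta>..\<beta>0 j + \<eta>})"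
proof -
  let ?k = "card \<gamma>" and ?M = "PiM \<gamma> (\<lambda>_. lborel) :: (nat \<Rightarrow> real) measure"
  let ?B = "\<Pi>\<^sub>E j\<in>\<gamma>. {\<beta>0 j - \<eta>..\<beta>0 j + \<eta>}"
  note P = inv_mat_props[OF pd]
  have k: "?k > 0" using fin ne by (simp add: card_gt_0_iff)
  have c0: "c > 0" using ch1_pos[OF pd k] c by simp
  have [measurable]: "?B \<in> sets ?M" using fin by (intro sets_PiM_I_finite) auto
  have low: "exp (- b * S / 2) / sqrt ((2 * pi * c) ^ ?k) \<le> mvn_density ?k V (coef_vec \<gamma> \<beta>)" if "\<beta> \<in> ?B" for \<beta>
  proof -
    have "qform ?k (\<lambda>i j. inv_mat V $$ (i, j)) (coord \<gamma> \<beta>) \<le> ch1 (inv_mat V) * (\<Sum>i<?k. (coord \<gamma> \<beta> i)\<^sup>2)"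
      by (rule qform_le_ch1[OF P(1,4)])
    also have "(\<Sum>i<?k. (coord \<gamma> \<beta> i)\<^sup>2) = (\<Sum>j\<in>\<gamma>. (\<beta> j)\<^sup>2)"
      by (rule sum_coord[OF fin, of "\<lambda>j. (\<beta> j)\<^sup>2"])
    also have "ch1 (inv_mat V) * \<dots> \<le> b * \<dots>"
      using b by (intro mult_right_mono sum_nonneg) auto
    also have "\<dots> \<le> b * S"
    proof (intro mult_left_mono sub b)
      fix j assume "j \<in> \<gamma>"
      then have "\<beta> j \<in> {\<beta>0 j - \<eta>..\<beta>0 j + \<eta>}" using that by (auto simp: PiE_def)
      then show "\<bar>\<beta> j - \<beta>0 j\<bar> \<le> \<eta>" by auto
    qed
    finally have 1: "exp (- b * S / 2) \<le> exp (- qform ?k (\<lambda>i j. inv_mat V $$ (i, j)) (coord \<gamma> \<beta>) / 2)" by simp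
    have "Determinant.det V \<le> c ^ ?k"
      using det_le_ch1_power[OF pd] power_mono[OF c, of ?k] ch1_pos[OF pd k] by linarith
    then have "sqrt ((2 * pi) ^ ?k * Determinant.det V) \<le> sqrt ((2 * pi * c) ^ ?k)"
      by (simp add: power_mult_distrib)
    moreover have "0 < sqrt ((2 * pi) ^ ?k * Determinant.det V)" using P(5) by simp
    ultimately show ?thesis unfolding mvn_density_coef_vec[OF pd] using 1 by (intro frac_le) auto
  qed
  let ?l = "exp (- b * S / 2) / sqrt ((2 * pi * c) ^ ?k)"
  have l: "?l \<ge> 0" using c0 by simp
  have "ennreal (?l * (2 * \<eta>) ^ ?k) = ennreal ?l * emeasure ?M ?B"
  proof -
    have "emeasure ?M ?B = (\<Prod>j\<in>\<gamma>. emeasure lborel {\<beta>0 j - \<eta>..\<beta>0 j + \<eta>})"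
      by (rule lborel_prod.emeasure_PiM[OF fin]) auto
    also have "\<dots> = (\<Prod>j\<in>\<gamma>. ennreal (2 * \<eta>))" using \<eta> by (intro prod.cong) auto
    also have "\<dots> = ennreal ((2 * \<eta>) ^ ?k)" using \<eta> by (simp add: ennreal_power)
    finally have e: "emeasure ?M ?B = ennreal ((2 * \<eta>) ^ ?k)" .
    show ?thesis unfolding e by (rule ennreal_mult) (use l \<eta> in auto)
  qed
  also have "\<dots> = (\<integral>\<^sup>+\<beta>. ennreal ?l * indicator ?B \<beta> \<partial>?M)"
    by (simp add: nn_integral_cmult_indicator)
  also have "\<dots> \<le> (\<integral>\<^sup>+\<beta>. ennreal (mvn_density ?k V (coef_vec \<gamma> \<beta>)) * indicator ?B \<beta> \<partial>?M)"
    by (intro nn_integral_mono) (use low in \<open>simp add: indicator_def ennreal_leI\<close>)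
  also have "\<dots> = emeasure (coef_prior V \<gamma>) ?B"
    unfolding coef_prior_def using measurable_mvn_density[OF fin pd]
    by (intro emeasure_density[symmetric]) auto
  finally show ?thesis .
qed

section \<open>Generalized linear models\<close>

locale glm =
  fixes a b c :: "real \<Rightarrow> real" and \<nu>y :: "real measure"
  assumes a_C1: "a C1_differentiable_on UNIV"
    and b_C1: "b C1_differentiable_on UNIV"
    and a_deriv: "\<And>h. deriv a h \<noteq> 0"
    and \<nu>y_sets: "sets \<nu>y = sets borel"
    and f_meas: "\<And>h. (\<lambda>y. glm_density a b c y h) \<in> borel_measurable \<nu>y"
    and f_dens: "\<And>h. (\<integral>\<^sup>+y. ennreal (glm_density a b c y h) \<partial>\<nu>y) = 1"
begin

abbreviation f where "f \<equiv> glm_density a b c"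

lemma f_pos: "f y h > 0" by (simp add: glm_density_def)

lemma space_\<nu>y: "space \<nu>y = UNIV" using sets_eq_imp_space_eq[OF \<nu>y_sets] by simp

lemma C1_deriv: assumes "g C1_differentiable_on UNIV"
  shows "(g has_real_derivative deriv g h) (at h)" "continuous_on UNIV (deriv g)"
proof -
  have 1: "\<And>x. g differentiable at x" and 2: "continuous_on UNIV (\<lambda>x. vector_derivative g (at x))"
    using assms unfolding C1_differentiable_on_eq by auto
  have 3: "(g has_real_derivative vector_derivative g (at h)) (at h)" for h
    using 1[of h] by (simp add: vector_derivative_works has_real_derivative_iff_has_vector_derivative)
  then have "deriv g = (\<lambda>x. vector_derivative g (at x))" by (auto intro: DERIV_imp_deriv)
  then show "(g has_real_derivative deriv g h) (at h)" "continuous_on UNIV (deriv g)" using 2 3[of h] by auto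
qed

lemmas a_has_deriv = C1_deriv[OF a_C1] and b_has_deriv = C1_deriv[OF b_C1]

lemma c_meas: "c \<in> borel_measurable borel"
proof -
  have "c = (\<lambda>y. ln (f y 0) - a 0 * y - b 0)" by (auto simp: glm_density_def)
  moreover have "(\<lambda>y. ln (f y 0) - a 0 * y - b 0) \<in> borel_measurable borel"
  proof -
    have [measurable]: "(\<lambda>y. f y 0) \<in> borel_measurable borel"
      using f_meas[of 0] measurable_cong_sets[OF \<nu>y_sets refl] by blast
    show ?thesis by measurable
  qed
  ultimately show ?thesis by simp
qed

lemma continuous_a: "continuous_on S a"
  using a_has_deriv(1) DERIV_isCont continuous_at_imp_continuous_on by blast

lemma continuous_b: "continuous_on S b"
  using b_has_deriv(1) DERIV_isCont continuous_at_imp_continuous_on by blast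

lemma a_meas [measurable]: "a \<in> borel_measurable borel"
  by (rule borel_measurable_continuous_onI) (rule continuous_a)

lemma b_meas [measurable]: "b \<in> borel_measurable borel"
  by (rule borel_measurable_continuous_onI) (rule continuous_b)

lemma f_meas2 [measurable]:
  assumes [measurable]: "y \<in> borel_measurable N" "h \<in> borel_measurable N"
  shows "(\<lambda>x. f (y x) (h x)) \<in> borel_measurable N"
  unfolding glm_density_def using measurable_compose[OF assms(1) c_meas] by measurable

text \<open>A measure that admits a strictly positive integrable function is \<open>\<sigma>\<close>-finite: the sets where the function
exceeds \<open>1 / (n + 1)\<close> exhaust the space and have finite measure.\<close>

lemma sigma_finite_\<nu>y: "sigma_finite_measure \<nu>y"
proof
  let ?A = "\<lambda>n::nat. {y \<in> space \<nu>y. 1 \<le> ennreal (real (Suc n)) * ennreal (f y 0)}"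
  note [measurable] = f_meas[of 0]
  have fin: "emeasure \<nu>y (?A n) \<noteq> \<infinity>" for n
  proof -
    have "emeasure \<nu>y (?A n) \<le> ennreal (real (Suc n)) * (\<integral>\<^sup>+y. ennreal (f y 0) * indicator (space \<nu>y) y \<partial>\<nu>y)"
      by (rule nn_integral_Markov_inequality) measurable
    also have "(\<integral>\<^sup>+y. ennreal (f y 0) * indicator (space \<nu>y) y \<partial>\<nu>y) = 1"
      using f_dens[of 0] by (simp add: space_\<nu>y)
    finally show ?thesis by (auto simp: top_unique)
  qed
  show "\<exists>A. countable A \<and> A \<subseteq> sets \<nu>y \<and> \<Union> A = space \<nu>y \<and> (\<forall>a\<in>A. emeasure \<nu>y a \<noteq> \<infinity>)"
  proof (intro exI[of _ "range ?A"] conjI)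
    show "\<Union> (range ?A) = space \<nu>y"
    proof (intro subset_antisym subsetI)
      fix y assume y: "y \<in> space \<nu>y"
      obtain n :: nat where "1 / f y 0 < real n" using reals_Archimedean2 by blast
      then have "1 \<le> real (Suc n) * f y 0" using f_pos[of y 0] by (simp add: field_simps)
      then have "1 \<le> ennreal (real (Suc n) * f y 0)" by simp
      then have "1 \<le> ennreal (real (Suc n)) * ennreal (f y 0)" using f_pos[of y 0] by (simp only: ennreal_mult less_imp_le of_nat_0_le_iff)
      then show "y \<in> \<Union> (range ?A)" using y by auto
    qed auto
    show "range ?A \<subseteq> sets \<nu>y" by auto
  qed (use fin in auto)
qed

text \<open>A Lipschitz constant of \<open>b\<close> on \<open>[-R, R]\<close>, since \<open>b' = - \<psi> a'\<close>. It is what \<open>growth_D\<close> multiplies by \<open>R\<close>.\<close>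

definition lip :: "real \<Rightarrow> real" where
  "lip R = (SUP h\<in>{h. \<bar>h\<bar> \<le> R}. \<bar>deriv a h\<bar>) * (SUP h\<in>{h. \<bar>h\<bar> \<le> R}. \<bar>glm_mean a b h\<bar>)"

lemma growth_D_lip: "growth_D a b R = 1 + R * lip R"
  by (simp add: growth_D_def lip_def)

lemma abs_le_sup:
  fixes g :: "real \<Rightarrow> real"
  assumes "continuous_on UNIV g" "\<bar>h\<bar> \<le> R"
  shows "\<bar>g h\<bar> \<le> (SUP h\<in>{h. \<bar>h\<bar> \<le> R}. \<bar>g h\<bar>)"
proof (rule cSUP_upper)
  have "{h::real. \<bar>h\<bar> \<le> R} = {-R..R}" by auto
  then have "compact ((\<lambda>h. \<bar>g h\<bar>) ` {h. \<bar>h\<bar> \<le> R})"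
    by (auto intro!: compact_continuous_image continuous_on_rabs continuous_on_subset[OF assms(1)])
  then show "bdd_above ((\<lambda>h. \<bar>g h\<bar>) ` {h. \<bar>h\<bar> \<le> R})"
    by (intro bounded_imp_bdd_above compact_imp_bounded)
qed (use assms in auto)

lemma glm_mean_cont: "continuous_on UNIV (glm_mean a b)"
  unfolding glm_mean_def using a_has_deriv(2) b_has_deriv(2) a_deriv
  by (intro continuous_intros) auto

lemma deriv_b_le: "\<bar>h\<bar> \<le> R \<Longrightarrow> \<bar>deriv b h\<bar> \<le> lip R"
proof -
  assume h: "\<bar>h\<bar> \<le> R"
  have "\<bar>deriv b h\<bar> = \<bar>deriv a h\<bar> * \<bar>glm_mean a b h\<bar>"
    using a_deriv[of h] by (simp add: glm_mean_def abs_mult abs_divide)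
  also have "\<dots> \<le> lip R" unfolding lip_def
    using abs_le_sup[OF a_has_deriv(2) h] abs_le_sup[OF glm_mean_cont h] by (intro mult_mono) auto
  finally show ?thesis .
qed

lemma lip_nonneg: "R \<ge> 0 \<Longrightarrow> lip R \<ge> 0"
  using deriv_b_le[of 0 R] by simp

lemma b_lipschitz: "\<bar>u\<bar> \<le> R \<Longrightarrow> \<bar>v\<bar> \<le> R \<Longrightarrow> \<bar>b u - b v\<bar> \<le> lip R * \<bar>u - v\<bar>"
  using field_differentiable_bound[of "{-R..R}" b "deriv b" "lip R" u v]
    b_has_deriv(1) deriv_b_le by (auto simp: abs_le_iff intro: has_field_derivative_at_within)

lemma midpoint: "\<exists>hm. min h1 h2 \<le> hm \<and> hm \<le> max h1 h2 \<and> a hm = (a h1 + a h2) / 2"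
proof -
  have "\<exists>hm. h1 \<le> hm \<and> hm \<le> h2 \<and> a hm = (a h1 + a h2) / 2" if "h1 \<le> h2" for h1 h2
  proof (cases "a h1 \<le> a h2")
    case True
    then show ?thesis using that IVT'[of a h1 "(a h1 + a h2) / 2" h2] continuous_a by auto
  next
    case False
    then show ?thesis using that IVT2'[of a h2 "(a h1 + a h2) / 2" h1] continuous_a by auto
  qed
  from this[of h1 h2] this[of h2 h1] show ?thesis
    by (cases "h1 \<le> h2") (auto simp: min_def max_def add.commute)
qed

text \<open>The product of the roots of two densities of the family is, up to the factor \<open>exp ((b h1 + b h2) / 2 - b hm)\<close>,
the density at the point \<open>hm\<close> where \<open>a\<close> takes the average of its two values. So the squared distance is an
explicit function of \<open>b\<close>, and the Lipschitz bound of \<open>b\<close> applies.\<close>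

lemma hellinger_le:
  assumes h1: "\<bar>h1\<bar> \<le> R" and h2: "\<bar>h2\<bar> \<le> R"
  shows "(\<integral>\<^sup>+y. ennreal ((sqrt (f y h1) - sqrt (f y h2))\<^sup>2) \<partial>\<nu>y) \<le> ennreal (lip R * \<bar>h1 - h2\<bar>)"
proof -
  obtain hm where hm: "min h1 h2 \<le> hm" "hm \<le> max h1 h2" "a hm = (a h1 + a h2) / 2" using midpoint by blast
  let ?t = "(b h1 + b h2) / 2 - b hm"
  let ?X = "\<integral>\<^sup>+y. ennreal ((sqrt (f y h1) - sqrt (f y h2))\<^sup>2) \<partial>\<nu>y"
  note [measurable] = f_meas
  have sq: "sqrt (f y h1) * sqrt (f y h2) = exp ?t * f y hm" for y
  proof -
    have "sqrt (f y h1) * sqrt (f y h2) = sqrt ((exp ((a h1 * y + b h1 + c y + (a h2 * y + b h2 + c y)) / 2))\<^sup>2)"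
      by (simp add: real_sqrt_mult[symmetric] glm_density_def exp_add[symmetric] exp_double[symmetric])
    also have "\<dots> = exp ((a h1 * y + b h1 + c y + (a h2 * y + b h2 + c y)) / 2)" by simp
    also have "(a h1 * y + b h1 + c y + (a h2 * y + b h2 + c y)) / 2 = ?t + (a hm * y + b hm + c y)"
      unfolding hm(3) by (simp add: field_simps)
    finally show ?thesis by (simp only: glm_density_def exp_add)
  qed
  have "?X + 2 * ennreal (exp ?t) = ?X + ennreal (2 * exp ?t) * (\<integral>\<^sup>+y. ennreal (f y hm) \<partial>\<nu>y)"
    by (simp add: f_dens ennreal_mult)
  also have "\<dots> = (\<integral>\<^sup>+y. ennreal ((sqrt (f y h1) - sqrt (f y h2))\<^sup>2) + ennreal (2 * exp ?t) * ennreal (f y hm) \<partial>\<nu>y)"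
    by (simp add: nn_integral_add nn_integral_cmult)
  also have "\<dots> = (\<integral>\<^sup>+y. ennreal (f y h1) + ennreal (f y h2) \<partial>\<nu>y)"
  proof (rule nn_integral_cong)
    fix y
    have "(sqrt (f y h1) - sqrt (f y h2))\<^sup>2 = f y h1 + f y h2 - 2 * (sqrt (f y h1) * sqrt (f y h2))"
      using f_pos[of y h1] f_pos[of y h2] by (simp add: power2_diff)
    then have "(sqrt (f y h1) - sqrt (f y h2))\<^sup>2 + 2 * exp ?t * f y hm = f y h1 + f y h2"
      unfolding sq by simp
    moreover have "ennreal ((sqrt (f y h1) - sqrt (f y h2))\<^sup>2) + ennreal (2 * exp ?t) * ennreal (f y hm)
      = ennreal ((sqrt (f y h1) - sqrt (f y h2))\<^sup>2 + 2 * exp ?t * f y hm)"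
      using f_pos[of y hm] by (subst ennreal_mult[symmetric]) (auto intro!: ennreal_plus[symmetric])
    moreover have "ennreal (f y h1 + f y h2) = ennreal (f y h1) + ennreal (f y h2)"
      using f_pos[of y h1] f_pos[of y h2] by (intro ennreal_plus) auto
    ultimately show "ennreal ((sqrt (f y h1) - sqrt (f y h2))\<^sup>2) + ennreal (2 * exp ?t) * ennreal (f y hm)
       = ennreal (f y h1) + ennreal (f y h2)" by simp
  qed
  also have "\<dots> = 2" by (simp add: nn_integral_add f_dens)
  finally have X: "?X + 2 * ennreal (exp ?t) = 2" .
  then have "?X \<le> 2" by (metis le_iff_add)
  then obtain x where x: "x \<ge> 0" "?X = ennreal x" by (cases ?X) (auto simp: top_unique)
  have "ennreal (x + 2 * exp ?t) = ennreal 2" using X x by (simp add: ennreal_mult)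
  then have "x + 2 * exp ?t = 2" using x by (subst (asm) ennreal_inj) auto
  moreover have "1 + ?t \<le> exp ?t" by (rule exp_ge_add_one_self)
  moreover have "x \<le> - 2 * t" if "x + 2 * e = 2" "1 + t \<le> e" for t e :: real using that by simp
  ultimately have "x \<le> - 2 * ?t" by blast
  also have "\<dots> = (b hm - b h1) + (b hm - b h2)" by (simp add: add_divide_distrib)
  also have "\<dots> \<le> lip R * \<bar>hm - h1\<bar> + lip R * \<bar>hm - h2\<bar>"
  proof -
    have "\<bar>hm\<bar> \<le> R" using hm h1 h2 by (auto simp: min_def max_def split: if_splits)
    then show ?thesis using b_lipschitz[of hm R h1] b_lipschitz[of hm R h2] h1 h2 by (intro add_mono) auto
  qed
  also have "\<dots> = lip R * \<bar>h1 - h2\<bar>"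
    unfolding distrib_left[symmetric] using hm by (intro arg_cong2[where f = "(*)"]) (auto simp: min_def max_def split: if_splits)
  finally show ?thesis using x by (simp add: ennreal_leI)
qed

end

text \<open>The slope of \<open>\<phi>\<close> on a compact interval lies between two positive constants. Moving by their ratio
times \<open>\<bar>h - u\<bar>\<close> therefore changes \<open>\<phi>\<close> at least as much as moving from \<open>u\<close> to \<open>h\<close> did.\<close>

lemma reflect_point:
  fixes \<phi> \<phi>' :: "real \<Rightarrow> real"
  assumes d: "\<And>h. (\<phi> has_real_derivative \<phi>' h) (at h)" and cont: "continuous_on UNIV \<phi>'"
    and pos: "\<And>h. \<phi>' h > 0" and M: "M \<ge> 0"
  shows "\<exists>C>0. \<forall>u h. \<bar>u\<bar> \<le> M \<longrightarrow> C * \<bar>h - u\<bar> \<le> 1 \<longrightarrow> \<bar>h - u\<bar> \<le> 1 \<and>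
    (\<exists>h'. \<phi> h' = 2 * \<phi> u - \<phi> h \<and> \<bar>h' - u\<bar> \<le> C * \<bar>h - u\<bar>)"
proof -
  let ?I = "{-M - 1..M + 1}"
  have cI: "continuous_on ?I \<phi>'" using cont continuous_on_subset by blast
  have ne: "?I \<noteq> {}" using M by auto
  obtain p where p: "p \<in> ?I" "\<And>x. x \<in> ?I \<Longrightarrow> \<phi>' p \<le> \<phi>' x"
    using continuous_attains_inf[OF compact_Icc ne cI] by blast
  obtain q where q: "q \<in> ?I" "\<And>x. x \<in> ?I \<Longrightarrow> \<phi>' x \<le> \<phi>' q"
    using continuous_attains_sup[OF compact_Icc ne cI] by blast
  define C where "C = \<phi>' q / \<phi>' p"
  have C1: "C \<ge> 1" using pos[of p] p(2)[OF q(1)] by (simp add: C_def)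
  have Cm: "C * \<phi>' p = \<phi>' q" using pos[of p] by (simp add: C_def)
  have low: "\<phi>' p * (y - x) \<le> \<phi> y - \<phi> x" and up: "\<phi> y - \<phi> x \<le> \<phi>' q * (y - x)"
    if "x \<le> y" "x \<in> ?I" "y \<in> ?I" for x y
  proof -
    have "\<phi>' p * (y - x) \<le> \<phi> y - \<phi> x \<and> \<phi> y - \<phi> x \<le> \<phi>' q * (y - x)"
    proof (cases "x = y")
      case False
      then have "x < y" using that by simp
      then obtain z where z: "z > x" "z < y" "\<phi> y - \<phi> x = (y - x) * \<phi>' z" using MVT2[of x y \<phi> \<phi>'] d by blast
      have "z \<in> ?I" using z that by auto
      then show ?thesis using p(2)[of z] q(2)[of z] z(3) \<open>x < y\<close> by (simp add: mult.commute)
    qed simp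
    then show "\<phi>' p * (y - x) \<le> \<phi> y - \<phi> x" and "\<phi> y - \<phi> x \<le> \<phi>' q * (y - x)" by auto
  qed
  have "\<bar>h - u\<bar> \<le> 1 \<and> (\<exists>h'. \<phi> h' = 2 * \<phi> u - \<phi> h \<and> \<bar>h' - u\<bar> \<le> C * \<bar>h - u\<bar>)"
    if u: "\<bar>u\<bar> \<le> M" and h: "C * \<bar>h - u\<bar> \<le> 1" for u h
  proof -
    define t where "t = C * \<bar>h - u\<bar>"
    have t: "0 \<le> t" "t \<le> 1" using h C1 by (auto simp: t_def)
    have h1: "\<bar>h - u\<bar> \<le> t" unfolding t_def using C1 mult_right_mono[of 1 C "\<bar>h - u\<bar>"] by simp
    have I: "u \<in> ?I" "h \<in> ?I" "u + t \<in> ?I" "u - t \<in> ?I" using u t h1 by auto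
    have dev: "\<bar>\<phi> h - \<phi> u\<bar> \<le> \<phi>' q * \<bar>h - u\<bar>"
    proof (cases "h \<ge> u")
      case True
      then have "0 \<le> \<phi>' p * (h - u)" using pos[of p] by (intro mult_nonneg_nonneg) auto
      then have "0 \<le> \<phi> h - \<phi> u" "\<phi> h - \<phi> u \<le> \<phi>' q * (h - u)" using low[of u h] up[of u h] I True by auto
      then show ?thesis using True by (simp add: abs_if)
    next
      case False
      then have le: "h \<le> u" by simp
      have "0 \<le> \<phi>' p * (u - h)" using le pos[of p] by (intro mult_nonneg_nonneg) auto
      then have "0 \<le> \<phi> u - \<phi> h" "\<phi> u - \<phi> h \<le> \<phi>' q * (u - h)" using low[of h u] up[of h u] I le by auto
      then show ?thesis using le by (simp add: abs_if)
    qed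
    have qt: "\<phi>' p * t = \<phi>' q * \<bar>h - u\<bar>" using Cm by (simp add: t_def mult.assoc[symmetric] mult.commute[of _ C])
    have 1: "\<phi> (u - t) \<le> 2 * \<phi> u - \<phi> h" "2 * \<phi> u - \<phi> h \<le> \<phi> (u + t)"
      using low[of "u - t" u] low[of u "u + t"] I t dev qt by auto
    have "continuous_on {u - t..u + t} \<phi>"
      using d DERIV_isCont continuous_at_imp_continuous_on by blast
    then obtain h' where "u - t \<le> h'" "h' \<le> u + t" "\<phi> h' = 2 * \<phi> u - \<phi> h"
      using IVT'[of \<phi> "u - t" "2 * \<phi> u - \<phi> h" "u + t"] 1 t by auto
    then show ?thesis using h1 t unfolding t_def[symmetric] by (intro conjI exI[of _ h']) auto
  qed
  then show ?thesis using C1 by (intro exI[of _ C]) auto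
qed

context glm
begin

text \<open>With \<open>a h' = 2 a u - a h\<close>, the quotient \<open>f(y,u)\<^sup>2 / f(y,h)\<close> equals \<open>f(y,h')\<close> times the exponential of
\<open>2 b u - b h - b h'\<close>. The density integrates to one, and the exponent is controlled by the Lipschitz
constant of \<open>b\<close>.\<close>

lemma chi_square_bound:
  assumes M: "M \<ge> 0"
  shows "\<exists>C>0. \<forall>u h. \<bar>u\<bar> \<le> M \<longrightarrow> C * \<bar>h - u\<bar> \<le> 1 \<longrightarrow>
    (\<integral>\<^sup>+y. ennreal (f y u * (f y u / f y h)) \<partial>\<nu>y) \<le> ennreal (exp (C * \<bar>h - u\<bar>))"
proof -
  have "\<exists>C>0. \<forall>u h. \<bar>u\<bar> \<le> M \<longrightarrow> C * \<bar>h - u\<bar> \<le> 1 \<longrightarrow> \<bar>h - u\<bar> \<le> 1 \<and>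
    (\<exists>h'. a h' = 2 * a u - a h \<and> \<bar>h' - u\<bar> \<le> C * \<bar>h - u\<bar>)"
  proof (cases "\<forall>h. deriv a h > 0")
    case True
    then show ?thesis using reflect_point[OF a_has_deriv _ M] by blast
  next
    case False
    then obtain p where p: "deriv a p < 0" using a_deriv[of p] by (meson a_deriv not_less_iff_gr_or_eq)
    have neg: "deriv a h < 0" for h
    proof (rule ccontr)
      assume "\<not> deriv a h < 0"
      then have "deriv a h > 0" using a_deriv[of h] by simp
      moreover have cs: "continuous_on S (deriv a)" for S using a_has_deriv(2) continuous_on_subset by blast
      ultimately have "\<exists>z. deriv a z = 0"
        using p IVT'[of "deriv a" p 0 h, OF _ _ _ cs] IVT2'[of "deriv a" p 0 h, OF _ _ _ cs]
        by (cases "p \<le> h") (auto simp: less_imp_le)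
      then show False using a_deriv by blast
    qed
    have "\<exists>C>0. \<forall>u h. \<bar>u\<bar> \<le> M \<longrightarrow> C * \<bar>h - u\<bar> \<le> 1 \<longrightarrow> \<bar>h - u\<bar> \<le> 1 \<and>
      (\<exists>h'. - a h' = 2 * (- a u) - (- a h) \<and> \<bar>h' - u\<bar> \<le> C * \<bar>h - u\<bar>)"
      using a_has_deriv neg M
      by (intro reflect_point[of "\<lambda>h. - a h" "\<lambda>h. - deriv a h"]) (auto intro!: derivative_eq_intros continuous_intros)
    moreover have "(- a h' = 2 * (- a u) - (- a h)) = (a h' = 2 * a u - a h)" for h' u h by auto
    ultimately show ?thesis by (simp only:)
  qed
  then obtain C where C: "C > 0" and CC: "\<And>u h. \<bar>u\<bar> \<le> M \<Longrightarrow> C * \<bar>h - u\<bar> \<le> 1 \<Longrightarrow> \<bar>h - u\<bar> \<le> 1 \<and>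
    (\<exists>h'. a h' = 2 * a u - a h \<and> \<bar>h' - u\<bar> \<le> C * \<bar>h - u\<bar>)" by blast
  let ?L = "lip (M + 1)"
  have L: "?L \<ge> 0" using M by (intro lip_nonneg) simp
  \<comment> \<open>One constant both for the range of validity and for the exponent.\<close>
  define C' where "C' = max C (?L * (1 + C))"
  have C': "C' > 0" "C \<le> C'" "?L * (1 + C) \<le> C'" using C by (auto simp: C'_def)
  have "(\<integral>\<^sup>+y. ennreal (f y u * (f y u / f y h)) \<partial>\<nu>y) \<le> ennreal (exp (C' * \<bar>h - u\<bar>))"
    if u: "\<bar>u\<bar> \<le> M" and h: "C' * \<bar>h - u\<bar> \<le> 1" for u h
  proof -
    have C1: "C * \<bar>h - u\<bar> \<le> 1" using h C'(2) mult_right_mono[of C C' "\<bar>h - u\<bar>"] by simp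
    from CC[OF u C1] obtain h' where h': "\<bar>h - u\<bar> \<le> 1" "a h' = 2 * a u - a h" "\<bar>h' - u\<bar> \<le> C * \<bar>h - u\<bar>" by blast
    have R: "\<bar>u\<bar> \<le> M + 1" "\<bar>h\<bar> \<le> M + 1" "\<bar>h'\<bar> \<le> M + 1" using u h' C1 by auto
    let ?t = "2 * b u - b h - b h'"
    have "f y u * (f y u / f y h) = exp ?t * f y h'" for y
      unfolding glm_density_def exp_diff[symmetric] exp_add[symmetric] h'(2) by (simp add: algebra_simps)
    then have "(\<integral>\<^sup>+y. ennreal (f y u * (f y u / f y h)) \<partial>\<nu>y) = (\<integral>\<^sup>+y. ennreal (exp ?t) * ennreal (f y h') \<partial>\<nu>y)"
      using f_pos by (simp add: ennreal_mult less_imp_le)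
    also have "\<dots> = ennreal (exp ?t)"
      by (subst nn_integral_cmult) (auto simp: f_dens intro: measurable_compose[OF f_meas])
    also have "?t \<le> ?L * \<bar>h - u\<bar> + ?L * \<bar>h' - u\<bar>"
      using b_lipschitz[OF R(2,1)] b_lipschitz[OF R(3,1)] by linarith
    also have "\<dots> \<le> ?L * \<bar>h - u\<bar> + ?L * (C * \<bar>h - u\<bar>)"
      using h'(3) L by (intro add_left_mono mult_left_mono)
    also have "\<dots> = ?L * (1 + C) * \<bar>h - u\<bar>" by (simp add: algebra_simps)
    also have "\<dots> \<le> C' * \<bar>h - u\<bar>" using C'(3) by (intro mult_right_mono) auto
    finally show ?thesis by (simp add: ennreal_leI)
  qed
  then show ?thesis using C' by blast
qed

end

section \<open>The prior on models\<close>

lemma sum_subsets_prod: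
  fixes p :: "'a \<Rightarrow> real"
  assumes "finite A"
  shows "(\<Sum>X\<in>Pow A. \<Prod>j\<in>A. if j \<in> X then p j else 1 - p j) = 1"
proof -
  have "(\<Prod>j\<in>A. if j \<in> X then p j else 1 - p j) = (\<Prod>j\<in>X. p j) * (\<Prod>j\<in>A - X. 1 - p j)"
    if "X \<in> Pow A" for X
    using that assms by (subst prod.subset_diff[of X A]) (auto intro: finite_subset)
  then show ?thesis using prod_add[OF assms, of p "\<lambda>j. 1 - p j"] by simp
qed

lemma model_weight_nonneg: "r \<le> K \<Longrightarrow> model_weight K r rbar \<gamma> \<ge> 0"
  unfolding model_weight_def by (intro mult_nonneg_nonneg prod_nonneg) (auto simp: divide_simps)

lemma model_weight_sum_le: "r \<le> K \<Longrightarrow> (\<Sum>\<gamma>\<in>Pow {..<K}. model_weight K r rbar \<gamma>) \<le> 1"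
proof -
  assume r: "r \<le> K"
  have "(\<Sum>\<gamma>\<in>Pow {..<K}. model_weight K r rbar \<gamma>)
    \<le> (\<Sum>\<gamma>\<in>Pow {..<K}. \<Prod>j<K. if j \<in> \<gamma> then real r / real K else 1 - real r / real K)"
    unfolding model_weight_def using r
    by (intro sum_mono mult_left_le prod_nonneg) (auto simp: divide_simps)
  then show ?thesis using sum_subsets_prod[of "{..<K}" "\<lambda>_. real r / real K"] by simp
qed

lemma model_prior_nonneg: "r \<le> K \<Longrightarrow> model_prior K r rbar \<gamma> \<ge> 0"
  unfolding model_prior_def by (intro divide_nonneg_nonneg sum_nonneg model_weight_nonneg)

lemma model_prior_sum_le: "(\<Sum>\<gamma>\<in>Pow {..<K}. model_prior K r rbar \<gamma>) \<le> 1"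
  unfolding model_prior_def sum_divide_distrib[symmetric] by simp

lemma model_prior_le_1: "r \<le> K \<Longrightarrow> \<gamma> \<subseteq> {..<K} \<Longrightarrow> model_prior K r rbar \<gamma> \<le> 1"
  using member_le_sum[of \<gamma> "Pow {..<K}" "model_prior K r rbar"] model_prior_sum_le[of K r rbar]
  by (auto simp: model_prior_nonneg)

lemma model_prior_eq_0: "card \<gamma> > rbar \<Longrightarrow> model_prior K r rbar \<gamma> = 0"
  by (simp add: model_prior_def model_weight_def)

text \<open>The unnormalized weight is \<open>(r/K)\<^sup>r (1 - r/K)\<^bsup>K - r\<^esup>\<close>, whose two factors are at least \<open>K\<^bsup>-r\<^esup>\<close> and \<open>exp (- r)\<close>.
Truncation only increases it, as the normalizing constant is at most one.\<close>

lemma model_prior_lower: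
  assumes r: "1 \<le> r" "r \<le> rbar" "r < K" and \<gamma>: "\<gamma> \<subseteq> {..<K}" "card \<gamma> = r"
  shows "exp (- (real r * ln (real K)) - real r) \<le> model_prior K r rbar \<gamma>"
proof -
  let ?l = "real r / real K"
  have K: "real K > 0" using r by simp
  have l: "0 < ?l" "?l < 1" using r by auto
  have fin: "finite \<gamma>" using \<gamma>(1) finite_subset by blast
  have w: "model_weight K r rbar \<gamma> = ?l ^ r * (1 - ?l) ^ (K - r)"
  proof -
    have "(\<Prod>j<K. if j \<in> \<gamma> then ?l else 1 - ?l) = (\<Prod>j\<in>\<gamma>. ?l) * (\<Prod>j\<in>{..<K} - \<gamma>. 1 - ?l)"
      using \<gamma>(1) by (subst prod.subset_diff[OF \<gamma>(1)]) (auto intro!: arg_cong2[where f = "(*)"] prod.cong)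
    then show ?thesis using \<gamma> r fin by (simp add: model_weight_def card_Diff_subset)
  qed
  have "exp (- (real r * ln (real K))) \<le> ?l ^ r"
  proof -
    have "exp (- (real r * ln (real K))) = (1 / real K) ^ r"
      using K by (simp add: exp_minus exp_of_nat_mult power_one_over inverse_eq_divide)
    also have "\<dots> \<le> ?l ^ r" using r by (intro power_mono divide_right_mono) auto
    finally show ?thesis .
  qed
  moreover have "exp (- real r) \<le> (1 - ?l) ^ (K - r)"
  proof -
    have "- (t / (1 - t)) \<le> ln (1 - t)" if t: "t < 1" for t :: real
    proof -
      have "ln (1 / (1 - t)) \<le> 1 / (1 - t) - 1" using t by (intro ln_le_minus_one) auto
      also have "\<dots> = t / (1 - t)" using t by (simp add: field_simps)
      also have "ln (1 / (1 - t)) = - ln (1 - t)" using t by (simp add: ln_div)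
      finally show ?thesis by simp
    qed
    from this[OF l(2)] have "ln (1 - ?l) \<ge> - (?l / (1 - ?l))" .
    then have "real (K - r) * ln (1 - ?l) \<ge> real (K - r) * - (?l / (1 - ?l))"
      by (intro mult_left_mono) auto
    also have "real (K - r) * - (?l / (1 - ?l)) = - real r"
      using r K by (simp add: of_nat_diff field_simps)
    finally have "exp (- real r) \<le> exp (real (K - r) * ln (1 - ?l))" by simp
    also have "\<dots> = (1 - ?l) ^ (K - r)" using l by (simp add: exp_of_nat_mult)
    finally show ?thesis .
  qed
  ultimately have "exp (- (real r * ln (real K))) * exp (- real r) \<le> model_weight K r rbar \<gamma>"
    unfolding w by (intro mult_mono) auto
  then have 1: "exp (- (real r * ln (real K)) - real r) \<le> model_weight K r rbar \<gamma>"
    by (simp add: exp_add[symmetric])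
  let ?W = "\<Sum>\<gamma>'\<in>Pow {..<K}. model_weight K r rbar \<gamma>'"
  have "model_weight K r rbar \<gamma> \<le> ?W"
    using \<gamma> r by (intro member_le_sum) (auto simp: model_weight_nonneg)
  moreover have "model_weight K r rbar \<gamma> > 0" using less_le_trans[OF exp_gt_zero 1] .
  ultimately have W: "?W > 0" by linarith
  have "?W \<le> 1" using r by (intro model_weight_sum_le) simp
  then have "model_weight K r rbar \<gamma> \<le> model_prior K r rbar \<gamma>"
    unfolding model_prior_def using W \<open>model_weight K r rbar \<gamma> > 0\<close> by (simp add: field_simps)
  then show ?thesis using 1 by simp
qed

lemma card_small_subsets: "card {\<gamma>. \<gamma> \<subseteq> {..<K} \<and> card \<gamma> \<le> s} \<le> (K + 1) ^ s"
proof (induction s)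
  case 0
  have "\<gamma> = {}" if "\<gamma> \<subseteq> {..<K}" "card \<gamma> \<le> 0" for \<gamma>
    using that finite_subset[OF that(1)] by simp
  then have "{\<gamma>. \<gamma> \<subseteq> {..<K} \<and> card \<gamma> \<le> 0} = {{}}" by auto
  then show ?case by simp
next
  case (Suc s)
  let ?S = "\<lambda>s. {\<gamma>. \<gamma> \<subseteq> {..<K} \<and> card \<gamma> \<le> s}"
  have "?S (Suc s) \<subseteq> (\<lambda>(\<gamma>, j). if j < K then insert j \<gamma> else \<gamma>) ` (?S s \<times> {..K})"
  proof
    fix \<gamma> assume g: "\<gamma> \<in> ?S (Suc s)"
    show "\<gamma> \<in> (\<lambda>(\<gamma>, j). if j < K then insert j \<gamma> else \<gamma>) ` (?S s \<times> {..K})"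
    proof (cases "card \<gamma> \<le> s")
      case True
      then show ?thesis using g by (intro image_eqI[of _ _ "(\<gamma>, K)"]) auto
    next
      case False
      have fin: "finite \<gamma>" using g finite_subset by blast
      have "\<gamma> \<noteq> {}" using False by auto
      then obtain j where j: "j \<in> \<gamma>" by blast
      then have "card (\<gamma> - {j}) \<le> s" using g fin by (auto simp: card_Diff_singleton)
      then show ?thesis using g j by (intro image_eqI[of _ _ "(\<gamma> - {j}, j)"]) auto
    qed
  qed
  moreover have fin: "finite (?S s)" by (rule finite_subset[of _ "Pow {..<K}"]) auto
  ultimately have "card (?S (Suc s)) \<le> card (?S s \<times> {..K})"
    by (meson card_image_le card_mono finite_SigmaI finite_atMost finite_imageI order_trans)
  also have "\<dots> = card (?S s) * (K + 1)" using fin by (simp add: card_cartesian_product)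
  also have "\<dots> \<le> (K + 1) ^ s * (K + 1)" by (rule mult_right_mono[OF Suc.IH]) simp
  finally show ?case by (simp add: mult.commute)
qed

section \<open>Likelihood ratios of the fitted densities\<close>

lemma measurable_coef_component [measurable (raw)]:
  "j \<in> \<gamma> \<Longrightarrow> (\<lambda>\<beta>. \<beta> j) \<in> borel_measurable (coef_prior W \<gamma>)"
  using measurable_component_singleton[of j \<gamma> "\<lambda>_. borel :: real measure"]
  by (subst measurable_cong_sets[OF sets_coef_prior refl])

text \<open>One sample size is fixed. Among the parameters added to those of \<open>glm\<close>, only \<open>M\<close> is common to all sample
sizes, so that constants derived from it may be used in the limit.\<close>

locale glm_model = glm a b c \<nu>y for a b c :: "real \<Rightarrow> real" and \<nu>y +
  fixes K r rbar :: nat and \<nu>x :: "(nat \<Rightarrow> real) measure" and \<beta>s :: "nat \<Rightarrow> real"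
    and V :: "nat set \<Rightarrow> real mat" and M :: real
  assumes \<nu>x_prob: "prob_space \<nu>x"
    and \<nu>x_sets: "sets \<nu>x = sets (PiM {..<K} (\<lambda>_. borel))"
    and x_bounded: "AE x in \<nu>x. \<forall>j<K. \<bar>x j\<bar> \<le> 1"
    and V_pos_def: "\<And>\<gamma>. \<gamma> \<subseteq> {..<K} \<Longrightarrow> pos_def_mat (card \<gamma>) (V \<gamma>)"
    and r_range: "1 \<le> r" "r \<le> rbar" "rbar < K"
    and \<beta>s_le: "(\<Sum>j<K. \<bar>\<beta>s j\<bar>) \<le> M"
begin

sublocale nx: prob_space \<nu>x by (rule \<nu>x_prob)
sublocale ny: sigma_finite_measure \<nu>y by (rule sigma_finite_\<nu>y)
sublocale xy: pair_sigma_finite \<nu>x \<nu>y ..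

abbreviation pst where "pst \<equiv> model_density f {..<K} \<beta>s"

text \<open>The true law of one observation \<open>(x, y)\<close>.\<close>

definition P where "P = density (\<nu>x \<Otimes>\<^sub>M \<nu>y) (\<lambda>z. ennreal (pst z))"

text \<open>In the ratio of fitted to true density the factor \<open>exp (c y)\<close> cancels, and relative to \<open>P\<close> the true
density becomes the constant 1.\<close>

definition lr where "lr \<gamma> \<beta> z = model_density f \<gamma> \<beta> z / pst z"

lemma model_density_pos: "model_density f \<gamma> \<beta> z > 0"
  by (simp add: model_density_def f_pos split: prod.split)

lemma lr_pos: "lr \<gamma> \<beta> z > 0"
  by (simp add: lr_def model_density_pos)

lemma finite_model: "\<gamma> \<subseteq> {..<K} \<Longrightarrow> finite \<gamma>"
  by (rule finite_subset) auto

lemma x_meas [measurable (raw)]: "j < K \<Longrightarrow> (\<lambda>x. x j) \<in> borel_measurable \<nu>x"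
  using measurable_component_singleton[of j "{..<K}" "\<lambda>_. borel :: real measure"]
  by (subst measurable_cong_sets[OF \<nu>x_sets refl]) auto

lemma lin_par_meas [measurable (raw)]:
  assumes "\<gamma> \<subseteq> {..<K}" and [measurable]: "X \<in> N \<rightarrow>\<^sub>M \<nu>x" and "B \<in> N \<rightarrow>\<^sub>M coef_prior W \<gamma>"
  shows "(\<lambda>u. lin_par \<gamma> (X u) (B u)) \<in> borel_measurable N"
  unfolding lin_par_def
proof (rule borel_measurable_sum)
  fix j assume j: "j \<in> \<gamma>"
  then have [measurable]: "(\<lambda>u. X u j) \<in> borel_measurable N" "(\<lambda>u. B u j) \<in> borel_measurable N"
    using assms measurable_compose[OF assms(2) x_meas[of j]]
      measurable_compose[OF assms(3) measurable_coef_component[of j]] by auto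
  show "(\<lambda>u. X u j * B u j) \<in> borel_measurable N" by measurable
qed

lemma lin_par_meas_fixed [measurable (raw)]:
  assumes "\<gamma> \<subseteq> {..<K}" and [measurable]: "X \<in> N \<rightarrow>\<^sub>M \<nu>x"
  shows "(\<lambda>u. lin_par \<gamma> (X u) \<beta>) \<in> borel_measurable N"
  unfolding lin_par_def
proof (rule borel_measurable_sum)
  fix j assume j: "j \<in> \<gamma>"
  then have [measurable]: "(\<lambda>u. X u j) \<in> borel_measurable N"
    using assms measurable_compose[OF assms(2) x_meas[of j]] by auto
  show "(\<lambda>u. X u j * \<beta> j) \<in> borel_measurable N" by measurable
qed

lemma y_meas [measurable]: "(\<lambda>y. y) \<in> borel_measurable \<nu>y"
  by (subst measurable_cong_sets[OF \<nu>y_sets refl]) simp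

lemma y_snd_meas [measurable (raw)]: "Y \<in> N \<rightarrow>\<^sub>M \<nu>y \<Longrightarrow> Y \<in> borel_measurable N"
  by (drule measurable_compose[OF _ y_meas])

lemma sets_P [simp, measurable_cong]: "sets P = sets (\<nu>x \<Otimes>\<^sub>M \<nu>y)"
  by (simp add: P_def)

lemma density_meas [measurable]:
  assumes "\<gamma> \<subseteq> {..<K}"
  shows "model_density f \<gamma> \<beta> \<in> borel_measurable (\<nu>x \<Otimes>\<^sub>M \<nu>y)"
  unfolding model_density_def case_prod_unfold
  by (intro f_meas2 lin_par_meas_fixed assms) measurable

lemma lr_meas:
  assumes "\<gamma> \<subseteq> {..<K}"
  shows "lr \<gamma> \<beta> \<in> borel_measurable P"
proof -
  have [measurable]: "model_density f \<gamma> \<beta> \<in> borel_measurable (\<nu>x \<Otimes>\<^sub>M \<nu>y)" "pst \<in> borel_measurable (\<nu>x \<Otimes>\<^sub>M \<nu>y)"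
    using density_meas assms by auto
  show ?thesis unfolding lr_def by measurable
qed

lemma lr_joint_meas:
  assumes "\<gamma> \<subseteq> {..<K}"
  shows "case_prod (lr \<gamma>) \<in> borel_measurable (coef_prior W \<gamma> \<Otimes>\<^sub>M P)"
proof -
  have [measurable]: "(\<lambda>u. snd (snd u)) \<in> borel_measurable (coef_prior W \<gamma> \<Otimes>\<^sub>M P)"
    by (rule y_snd_meas) measurable
  have "(\<lambda>u. fst (snd u)) \<in> coef_prior W \<gamma> \<Otimes>\<^sub>M P \<rightarrow>\<^sub>M \<nu>x" "fst \<in> coef_prior W \<gamma> \<Otimes>\<^sub>M P \<rightarrow>\<^sub>M coef_prior W \<gamma>"
    by measurable
  note [measurable] = lin_par_meas[OF assms this] lin_par_meas_fixed[OF order_refl this(1)]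
  show ?thesis unfolding lr_def model_density_def case_prod_unfold by measurable
qed

lemma nn_integral_P:
  assumes F: "F \<in> borel_measurable P"
  shows "(\<integral>\<^sup>+z. F z \<partial>P) = (\<integral>\<^sup>+x. (\<integral>\<^sup>+y. ennreal (f y (lin_par {..<K} x \<beta>s)) * F (x, y) \<partial>\<nu>y) \<partial>\<nu>x)"
proof -
  have [measurable]: "F \<in> borel_measurable (\<nu>x \<Otimes>\<^sub>M \<nu>y)"
    using F measurable_cong_sets[OF sets_P refl] by blast
  have [measurable]: "pst \<in> borel_measurable (\<nu>x \<Otimes>\<^sub>M \<nu>y)" by (rule density_meas) simp
  have "(\<integral>\<^sup>+z. F z \<partial>P) = (\<integral>\<^sup>+z. ennreal (pst z) * F z \<partial>(\<nu>x \<Otimes>\<^sub>M \<nu>y))"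
    unfolding P_def by (rule nn_integral_density) measurable
  also have "\<dots> = (\<integral>\<^sup>+x. (\<integral>\<^sup>+y. ennreal (pst (x, y)) * F (x, y) \<partial>\<nu>y) \<partial>\<nu>x)"
    by (rule ny.nn_integral_fst[symmetric]) measurable
  finally show ?thesis by (simp add: model_density_def)
qed

lemma prob_space_P: "prob_space P"
proof
  have "emeasure P (space P) = (\<integral>\<^sup>+z. 1 \<partial>P)" by simp
  also have "\<dots> = 1" by (subst nn_integral_P) (simp_all add: f_dens nx.emeasure_space_1)
  finally show "emeasure P (space P) = 1" .
qed

lemma lr_integral:
  assumes "\<gamma> \<subseteq> {..<K}"
  shows "(\<integral>\<^sup>+z. ennreal (lr \<gamma> \<beta> z) \<partial>P) = 1"
proof -
  note [measurable] = lr_meas[OF assms]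
  have "ennreal (f y (lin_par {..<K} x \<beta>s)) * ennreal (lr \<gamma> \<beta> (x, y)) = ennreal (f y (lin_par \<gamma> x \<beta>))" for x y
    using f_pos[of y "lin_par {..<K} x \<beta>s"] f_pos[of y "lin_par \<gamma> x \<beta>"]
    by (simp add: ennreal_mult[symmetric] lr_def model_density_def)
  then show ?thesis by (subst nn_integral_P) (simp_all add: f_dens nx.emeasure_space_1)
qed

lemma lr_hellinger_le:
  assumes \<gamma>: "\<gamma> \<subseteq> {..<K}" and R: "R \<ge> 0" and t: "t \<ge> 0"
    and ae: "AE x in \<nu>x. \<bar>lin_par \<gamma> x \<beta>1\<bar> \<le> R \<and> \<bar>lin_par \<gamma> x \<beta>2\<bar> \<le> R \<and> \<bar>lin_par \<gamma> x \<beta>1 - lin_par \<gamma> x \<beta>2\<bar> \<le> t"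
  shows "(\<integral>\<^sup>+z. ennreal ((sqrt (lr \<gamma> \<beta>1 z) - sqrt (lr \<gamma> \<beta>2 z))\<^sup>2) \<partial>P) \<le> ennreal (lip R * t)"
proof -
  note [measurable] = lr_meas[OF \<gamma>]
  have e: "ennreal (f y (lin_par {..<K} x \<beta>s)) * ennreal ((sqrt (lr \<gamma> \<beta>1 (x, y)) - sqrt (lr \<gamma> \<beta>2 (x, y)))\<^sup>2)
     = ennreal ((sqrt (f y (lin_par \<gamma> x \<beta>1)) - sqrt (f y (lin_par \<gamma> x \<beta>2)))\<^sup>2)" for x y
  proof -
    have "p * (sqrt (u / p) - sqrt (v / p))\<^sup>2 = (sqrt u - sqrt v)\<^sup>2" if "p > 0" for p u v :: real
      using that by (simp add: real_sqrt_divide diff_divide_distrib[symmetric] power_divide)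
    from this[OF f_pos] show ?thesis
      using f_pos[of y "lin_par {..<K} x \<beta>s"]
      by (subst ennreal_mult[symmetric]) (auto simp: lr_def model_density_def)
  qed
  have "(\<integral>\<^sup>+z. ennreal ((sqrt (lr \<gamma> \<beta>1 z) - sqrt (lr \<gamma> \<beta>2 z))\<^sup>2) \<partial>P)
    = (\<integral>\<^sup>+x. (\<integral>\<^sup>+y. ennreal ((sqrt (f y (lin_par \<gamma> x \<beta>1)) - sqrt (f y (lin_par \<gamma> x \<beta>2)))\<^sup>2) \<partial>\<nu>y) \<partial>\<nu>x)"
    by (subst nn_integral_P) (simp_all add: e)
  also have "\<dots> \<le> (\<integral>\<^sup>+x. ennreal (lip R * t) \<partial>\<nu>x)"
  proof (rule nn_integral_mono_AE, use ae in eventually_elim)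
    fix x assume x: "\<bar>lin_par \<gamma> x \<beta>1\<bar> \<le> R \<and> \<bar>lin_par \<gamma> x \<beta>2\<bar> \<le> R \<and> \<bar>lin_par \<gamma> x \<beta>1 - lin_par \<gamma> x \<beta>2\<bar> \<le> t"
    then have "(\<integral>\<^sup>+y. ennreal ((sqrt (f y (lin_par \<gamma> x \<beta>1)) - sqrt (f y (lin_par \<gamma> x \<beta>2)))\<^sup>2) \<partial>\<nu>y)
       \<le> ennreal (lip R * \<bar>lin_par \<gamma> x \<beta>1 - lin_par \<gamma> x \<beta>2\<bar>)" by (intro hellinger_le) auto
    also have "\<dots> \<le> ennreal (lip R * t)" using x lip_nonneg[OF R] by (intro ennreal_leI mult_left_mono) auto
    finally show "(\<integral>\<^sup>+y. ennreal ((sqrt (f y (lin_par \<gamma> x \<beta>1)) - sqrt (f y (lin_par \<gamma> x \<beta>2)))\<^sup>2) \<partial>\<nu>y) \<le> ennreal (lip R * t)" .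
  qed
  finally show ?thesis by (simp add: nx.emeasure_space_1)
qed

lemma inverse_lr_integral_le:
  assumes \<gamma>: "\<gamma> \<subseteq> {..<K}" and C: "C > 0"
    and chi: "\<And>u h. \<bar>u\<bar> \<le> M \<Longrightarrow> C * \<bar>h - u\<bar> \<le> 1 \<Longrightarrow>
      (\<integral>\<^sup>+y. ennreal (f y u * (f y u / f y h)) \<partial>\<nu>y) \<le> ennreal (exp (C * \<bar>h - u\<bar>))"
    and t: "C * t \<le> 1"
    and ae: "AE x in \<nu>x. \<bar>lin_par {..<K} x \<beta>s\<bar> \<le> M \<and> \<bar>lin_par \<gamma> x \<beta> - lin_par {..<K} x \<beta>s\<bar> \<le> t"
  shows "(\<integral>\<^sup>+z. ennreal (1 / lr \<gamma> \<beta> z) \<partial>P) \<le> ennreal (exp (C * t))"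
proof -
  note [measurable] = lr_meas[OF \<gamma>]
  have e: "ennreal (f y (lin_par {..<K} x \<beta>s)) * ennreal (1 / lr \<gamma> \<beta> (x, y))
     = ennreal (f y (lin_par {..<K} x \<beta>s) * (f y (lin_par {..<K} x \<beta>s) / f y (lin_par \<gamma> x \<beta>)))" for x y
    using f_pos[of y "lin_par {..<K} x \<beta>s"] f_pos[of y "lin_par \<gamma> x \<beta>"]
    by (subst ennreal_mult[symmetric]) (auto simp: lr_def model_density_def)
  have "(\<integral>\<^sup>+z. ennreal (1 / lr \<gamma> \<beta> z) \<partial>P)
    = (\<integral>\<^sup>+x. (\<integral>\<^sup>+y. ennreal (f y (lin_par {..<K} x \<beta>s) * (f y (lin_par {..<K} x \<beta>s) / f y (lin_par \<gamma> x \<beta>))) \<partial>\<nu>y) \<partial>\<nu>x)"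
    by (subst nn_integral_P) (simp_all add: e)
  also have "\<dots> \<le> (\<integral>\<^sup>+x. ennreal (exp (C * t)) \<partial>\<nu>x)"
  proof (rule nn_integral_mono_AE, use ae in eventually_elim)
    fix x assume x: "\<bar>lin_par {..<K} x \<beta>s\<bar> \<le> M \<and> \<bar>lin_par \<gamma> x \<beta> - lin_par {..<K} x \<beta>s\<bar> \<le> t"
    then have le: "C * \<bar>lin_par \<gamma> x \<beta> - lin_par {..<K} x \<beta>s\<bar> \<le> C * t" using C by (intro mult_left_mono) auto
    have "(\<integral>\<^sup>+y. ennreal (f y (lin_par {..<K} x \<beta>s) * (f y (lin_par {..<K} x \<beta>s) / f y (lin_par \<gamma> x \<beta>))) \<partial>\<nu>y)
       \<le> ennreal (exp (C * \<bar>lin_par \<gamma> x \<beta> - lin_par {..<K} x \<beta>s\<bar>))"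
      using x le t by (intro chi) auto
    also have "\<dots> \<le> ennreal (exp (C * t))" using le by (intro ennreal_leI) simp
    finally show "(\<integral>\<^sup>+y. ennreal (f y (lin_par {..<K} x \<beta>s) * (f y (lin_par {..<K} x \<beta>s) / f y (lin_par \<gamma> x \<beta>))) \<partial>\<nu>y) \<le> ennreal (exp (C * t))" .
  qed
  finally show ?thesis by (simp add: nx.emeasure_space_1)
qed

abbreviation "hell \<gamma> \<beta> \<equiv> hellinger_dist \<nu>x \<nu>y (model_density f \<gamma> \<beta>) pst"

text \<open>The squared Hellinger distance in terms of the likelihood ratio. As a nonnegative
integral over the product space it is defined for every \<open>\<beta>\<close> and measurable in \<open>\<beta>\<close> by Fubini's theorem.\<close>

definition hell_sq where "hell_sq \<gamma> \<beta> = (\<integral>\<^sup>+z. ennreal ((sqrt (lr \<gamma> \<beta> z) - 1)\<^sup>2) \<partial>P)"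

lemma hellinger_dist_eq:
  assumes \<gamma>: "\<gamma> \<subseteq> {..<K}"
  shows "hell_sq \<gamma> \<beta> = ennreal ((hell \<gamma> \<beta>)\<^sup>2)"
    and "hell \<gamma> \<beta> = sqrt (enn2real (hell_sq \<gamma> \<beta>))"
proof -
  note [measurable] = lr_meas[OF \<gamma>] density_meas[OF \<gamma>] density_meas[OF order_refl]
  let ?p = "model_density f \<gamma> \<beta>"
  define G where "G = (\<lambda>x. \<integral>\<^sup>+y. ennreal ((sqrt (?p (x, y)) - sqrt (pst (x, y)))\<^sup>2) \<partial>\<nu>y)"
  have Gm [measurable]: "G \<in> borel_measurable \<nu>x" unfolding G_def by measurable
  have G2: "G x \<le> 2" for x
  proof -
    have "G x \<le> (\<integral>\<^sup>+y. ennreal (f y (lin_par \<gamma> x \<beta>)) + ennreal (f y (lin_par {..<K} x \<beta>s)) \<partial>\<nu>y)"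
      unfolding G_def
    proof (rule nn_integral_mono)
      fix y
      have "(sqrt u - sqrt v)\<^sup>2 \<le> u + v" if "u > 0" "v > 0" for u v :: real
        using that by (simp add: power2_diff)
      then have "(sqrt (?p (x, y)) - sqrt (pst (x, y)))\<^sup>2 \<le> ?p (x, y) + pst (x, y)"
        using model_density_pos by blast
      then show "ennreal ((sqrt (?p (x, y)) - sqrt (pst (x, y)))\<^sup>2) \<le> ennreal (f y (lin_par \<gamma> x \<beta>)) + ennreal (f y (lin_par {..<K} x \<beta>s))"
        using f_pos by (simp add: model_density_def ennreal_plus[symmetric] less_imp_le ennreal_leI del: ennreal_plus)
    qed
    also have "\<dots> = 2" by (subst nn_integral_add) (auto simp: f_dens intro: measurable_compose[OF f_meas])
    finally show ?thesis .
  qed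
  have e: "ennreal (f y (lin_par {..<K} x \<beta>s)) * ennreal ((sqrt (lr \<gamma> \<beta> (x, y)) - 1)\<^sup>2)
     = ennreal ((sqrt (?p (x, y)) - sqrt (pst (x, y)))\<^sup>2)" for x y
  proof -
    have "p * (sqrt (u / p) - 1)\<^sup>2 = (sqrt u - sqrt p)\<^sup>2" if p: "p > 0" for p u :: real
    proof -
      have "sqrt (u / p) - 1 = (sqrt u - sqrt p) / sqrt p" using p by (simp add: real_sqrt_divide diff_divide_distrib)
      then show ?thesis using p by (simp add: power_divide)
    qed
    from this[OF model_density_pos[of "{..<K}" \<beta>s "(x, y)"], of "?p (x, y)"] show ?thesis
      using f_pos[of y "lin_par {..<K} x \<beta>s"]
      by (subst ennreal_mult[symmetric]) (auto simp: lr_def model_density_def)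
  qed
  have H: "hell_sq \<gamma> \<beta> = (\<integral>\<^sup>+x. G x \<partial>\<nu>x)"
    unfolding hell_sq_def G_def by (subst nn_integral_P) (simp_all add: e)
  have "hell_sq \<gamma> \<beta> \<le> (\<integral>\<^sup>+x. 2 \<partial>\<nu>x)" unfolding H by (intro nn_integral_mono G2)
  then have H2: "hell_sq \<gamma> \<beta> \<le> 2" by (simp add: nx.emeasure_space_1)
  have "(\<integral>y. \<bar>sqrt (?p (x, y)) - sqrt (pst (x, y))\<bar>\<^sup>2 \<partial>\<nu>y) = enn2real (G x)" if "x \<in> space \<nu>x" for x
    unfolding G_def using that by (subst integral_eq_nn_integral) auto
  then have "(\<integral>x. (\<integral>y. \<bar>sqrt (?p (x, y)) - sqrt (pst (x, y))\<bar>\<^sup>2 \<partial>\<nu>y) \<partial>\<nu>x) = (\<integral>x. enn2real (G x) \<partial>\<nu>x)"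
    by (intro Bochner_Integration.integral_cong) auto
  also have "\<dots> = enn2real (\<integral>\<^sup>+x. ennreal (enn2real (G x)) \<partial>\<nu>x)"
    by (rule integral_eq_nn_integral) auto
  also have "\<dots> = enn2real (hell_sq \<gamma> \<beta>)"
  proof -
    have "ennreal (enn2real (G x)) = G x" for x
      using G2[of x] by (intro ennreal_enn2real) (auto simp: less_top[symmetric] top_unique)
    then show ?thesis unfolding H by simp
  qed
  finally show hd: "hell \<gamma> \<beta> = sqrt (enn2real (hell_sq \<gamma> \<beta>))"
    unfolding hellinger_dist_def by simp
  show "hell_sq \<gamma> \<beta> = ennreal ((hell \<gamma> \<beta>)\<^sup>2)"
    unfolding hd using H2 by (cases "hell_sq \<gamma> \<beta>") (auto simp: top_unique)
qed

lemma hellinger_dist_meas: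
  assumes \<gamma>: "\<gamma> \<subseteq> {..<K}"
  shows "(\<lambda>\<beta>. hell \<gamma> \<beta>) \<in> borel_measurable (coef_prior W \<gamma>)"
proof -
  interpret P: prob_space P by (rule prob_space_P)
  note [measurable] = lr_joint_meas[OF \<gamma>, of W]
  have [measurable]: "(\<lambda>\<beta>. hell_sq \<gamma> \<beta>) \<in> borel_measurable (coef_prior W \<gamma>)"
    unfolding hell_sq_def by measurable
  show ?thesis unfolding hellinger_dist_eq(2)[OF \<gamma>] by measurable
qed

lemma lin_par_le:
  assumes "\<gamma> \<subseteq> {..<K}" "\<forall>j<K. \<bar>x j\<bar> \<le> 1"
  shows "\<bar>lin_par \<gamma> x \<beta>\<bar> \<le> (\<Sum>j\<in>\<gamma>. \<bar>\<beta> j\<bar>)"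
proof -
  have "\<bar>lin_par \<gamma> x \<beta>\<bar> \<le> (\<Sum>j\<in>\<gamma>. \<bar>x j * \<beta> j\<bar>)" unfolding lin_par_def by (rule sum_abs)
  also have "\<dots> \<le> (\<Sum>j\<in>\<gamma>. \<bar>\<beta> j\<bar>)"
    using assms by (intro sum_mono) (auto simp: abs_mult intro!: mult_left_le_one_le)
  finally show ?thesis .
qed

lemma lin_par_diff: "lin_par \<gamma> x \<beta>1 - lin_par \<gamma> x \<beta>2 = lin_par \<gamma> x (\<lambda>j. \<beta>1 j - \<beta>2 j)"
  by (simp add: lin_par_def sum_subtractf[symmetric] algebra_simps)

end

section \<open>The posterior as a ratio of integrated likelihood ratios\<close>

lemma ennreal_inverse_antimono: "x \<le> y \<Longrightarrow> inverse y \<le> inverse (x :: ennreal)"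
  by (cases "x = 0"; cases x; cases y) (auto simp: inverse_ennreal le_imp_inverse_le top_unique)

lemma ennreal_mult_divide_cancel:
  assumes "c > 0"
  shows "ennreal c * x / (ennreal c * y) = x / y"
  using divide_mult_eq[of "ennreal c" x y] assms by (simp add: mult.commute)

context glm_model
begin

abbreviation "N \<gamma> \<equiv> coef_prior (V \<gamma>) \<gamma>"
abbreviation "Q n \<equiv> PiM {..<n::nat} (\<lambda>_. P)"
abbreviation "\<pi>\<^sub>K \<equiv> model_prior K r rbar"
abbreviation "slice A \<gamma> \<equiv> {\<beta> \<in> space (N \<gamma>). (\<gamma>, \<beta>) \<in> A}"

lemma data_law_eq: "data_law \<nu>x \<nu>y pst n = Q n"
  by (simp add: data_law_def P_def)

lemma N_prob: "\<gamma> \<subseteq> {..<K} \<Longrightarrow> prob_space (N \<gamma>)"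
  by (intro prob_space_coef_prior V_pos_def finite_model)

lemma N_sf: "\<gamma> \<subseteq> {..<K} \<Longrightarrow> sigma_finite_measure (N \<gamma>)"
  by (intro prob_space_imp_sigma_finite N_prob)

definition lrprod where "lrprod n \<gamma> D \<beta> = (\<Prod>i<n::nat. lr \<gamma> \<beta> (D i))"

abbreviation "evid n D \<gamma> B \<equiv> \<integral>\<^sup>+\<beta>. ennreal (lrprod n \<gamma> D \<beta>) * indicator B \<beta> \<partial>N \<gamma>"

lemma lrprod_pos: "lrprod n \<gamma> D \<beta> > 0"
  unfolding lrprod_def by (intro prod_pos) (simp add: lr_pos)

lemma lrprod_meas: "\<gamma> \<subseteq> {..<K} \<Longrightarrow> (\<lambda>(D, \<beta>). lrprod n \<gamma> D \<beta>) \<in> borel_measurable (Q n \<Otimes>\<^sub>M coef_prior W \<gamma>)"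
  unfolding lrprod_def by (intro measurable_prod_likelihood lr_joint_meas)

text \<open>Measurability of every section, as additivity of the posterior requires. There is no ambient
\<open>\<sigma>\<close>-algebra on the pairs \<open>(\<gamma>, \<beta>)\<close>, because the coefficient space depends on the model.\<close>

definition model_event :: "(nat set \<times> (nat \<Rightarrow> real)) set \<Rightarrow> bool" where
  "model_event A \<longleftrightarrow> (\<forall>\<gamma>\<subseteq>{..<K}. slice A \<gamma> \<in> sets (N \<gamma>))"

lemma slice_sets: "model_event A \<Longrightarrow> \<gamma> \<subseteq> {..<K} \<Longrightarrow> slice A \<gamma> \<in> sets (N \<gamma>)"
  by (simp add: model_event_def)

lemma evid_meas:
  assumes "\<gamma> \<subseteq> {..<K}" and [measurable]: "B \<in> sets (N \<gamma>)"
  shows "(\<lambda>D. evid n D \<gamma> B) \<in> borel_measurable (Q n)"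
proof -
  interpret N: sigma_finite_measure "N \<gamma>" by (rule N_sf) fact
  note [measurable] = lrprod_meas[OF assms(1)]
  show ?thesis by measurable
qed

text \<open>Joint mass of likelihood and prior after division by the true likelihood. The division cancels in the
posterior.\<close>

definition J where
  "J n D A = (\<Sum>\<gamma>\<in>Pow {..<K}. ennreal (\<pi>\<^sub>K \<gamma>) * evid n D \<gamma> (slice A \<gamma>))"

lemma J_meas: "model_event A \<Longrightarrow> (\<lambda>D. J n D A) \<in> borel_measurable (Q n)"
  unfolding J_def
proof (rule borel_measurable_sum)
  fix \<gamma> assume "model_event A" "\<gamma> \<in> Pow {..<K}"
  then have [measurable]: "(\<lambda>D. evid n D \<gamma> (slice A \<gamma>)) \<in> borel_measurable (Q n)"
    by (intro evid_meas slice_sets) auto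
  show "(\<lambda>D. ennreal (\<pi>\<^sub>K \<gamma>) * evid n D \<gamma> (slice A \<gamma>)) \<in> borel_measurable (Q n)"
    by measurable
qed

lemma joint_mass_eq:
  assumes A: "model_event A" and D: "D \<in> space (Q n)"
  shows "joint_mass f K r rbar V n D A = ennreal (\<Prod>i<n. pst (D i)) * J n D A"
proof -
  have L: "likelihood f n D \<gamma> \<beta> = (\<Prod>i<n. pst (D i)) * lrprod n \<gamma> D \<beta>" for \<gamma> \<beta>
    unfolding likelihood_def lrprod_def lr_def prod.distrib[symmetric]
    using model_density_pos[of "{..<K}" \<beta>s] by (intro prod.cong refl) (simp add: less_imp_neq[symmetric])
  have p: "(\<Prod>i<n. pst (D i)) \<ge> 0" by (intro prod_nonneg) (simp add: model_density_pos less_imp_le)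
  show ?thesis unfolding joint_mass_def J_def sum_distrib_left
  proof (rule sum.cong[OF refl])
    fix \<gamma> assume "\<gamma> \<in> Pow {..<K}"
    then have \<gamma>: "\<gamma> \<subseteq> {..<K}" by simp
    note [measurable] = slice_sets[OF A \<gamma>] measurable_Pair2[OF lrprod_meas[OF \<gamma>] D, simplified]
    have "(\<integral>\<^sup>+\<beta>. ennreal (likelihood f n D \<gamma> \<beta>) * indicator A (\<gamma>, \<beta>) \<partial>N \<gamma>)
      = (\<integral>\<^sup>+\<beta>. ennreal (\<Prod>i<n. pst (D i)) * (ennreal (lrprod n \<gamma> D \<beta>) * indicator (slice A \<gamma>) \<beta>) \<partial>N \<gamma>)"
      using p lrprod_pos
      by (intro nn_integral_cong) (simp add: L ennreal_mult less_imp_le mult.assoc indicator_def)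
    also have "\<dots> = ennreal (\<Prod>i<n. pst (D i)) * evid n D \<gamma> (slice A \<gamma>)"
      by (rule nn_integral_cmult) measurable
    finally show "ennreal (\<pi>\<^sub>K \<gamma>) * (\<integral>\<^sup>+\<beta>. ennreal (likelihood f n D \<gamma> \<beta>) * indicator A (\<gamma>, \<beta>) \<partial>N \<gamma>)
      = ennreal (\<Prod>i<n. pst (D i)) * (ennreal (\<pi>\<^sub>K \<gamma>) * evid n D \<gamma> (slice A \<gamma>))"
      by (simp add: mult.left_commute)
  qed
qed

lemma model_event_UNIV: "model_event UNIV"
  unfolding model_event_def by (simp only: UNIV_I simp_thms Collect_mem_eq sets.top)

lemma posterior_eq:
  assumes A: "model_event A" and D: "D \<in> space (Q n)"
  shows "posterior f K r rbar V n D A = enn2real (J n D A / J n D UNIV)"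
proof -
  have "(\<Prod>i<n. pst (D i)) > 0" by (intro prod_pos) (simp add: model_density_pos)
  then show ?thesis
    unfolding posterior_def joint_mass_eq[OF A D] joint_mass_eq[OF model_event_UNIV D]
    by (simp add: ennreal_mult_divide_cancel)
qed

lemma J_mono: "(\<And>\<gamma> \<beta>. \<gamma> \<subseteq> {..<K} \<Longrightarrow> (\<gamma>, \<beta>) \<in> A \<Longrightarrow> (\<gamma>, \<beta>) \<in> B) \<Longrightarrow> J n D A \<le> J n D B"
  unfolding J_def
  by (intro sum_mono mult_left_mono nn_integral_mono) (auto simp: indicator_def)

lemma J_add:
  assumes A: "model_event A" and B: "model_event B" and AB: "A \<inter> B = {}" and D: "D \<in> space (Q n)"
  shows "J n D (A \<union> B) = J n D A + J n D B"
  unfolding J_def sum.distrib[symmetric]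
proof (rule sum.cong[OF refl])
  fix \<gamma> assume "\<gamma> \<in> Pow {..<K}"
  then have \<gamma>: "\<gamma> \<subseteq> {..<K}" by simp
  note [measurable] = slice_sets[OF A \<gamma>] slice_sets[OF B \<gamma>] measurable_Pair2[OF lrprod_meas[OF \<gamma>] D, simplified]
  have "indicator (slice (A \<union> B) \<gamma>) u = (indicator (slice A \<gamma>) u + indicator (slice B \<gamma>) u :: ennreal)" for u
    using AB by (auto simp: indicator_def)
  then have "evid n D \<gamma> (slice (A \<union> B) \<gamma>)
    = (\<integral>\<^sup>+\<beta>. ennreal (lrprod n \<gamma> D \<beta>) * indicator (slice A \<gamma>) \<beta> + ennreal (lrprod n \<gamma> D \<beta>) * indicator (slice B \<gamma>) \<beta> \<partial>N \<gamma>)"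
    by (simp only: distrib_left)
  also have "\<dots> = evid n D \<gamma> (slice A \<gamma>) + evid n D \<gamma> (slice B \<gamma>)"
    by (rule nn_integral_add) measurable
  finally show "ennreal (\<pi>\<^sub>K \<gamma>) * evid n D \<gamma> (slice (A \<union> B) \<gamma>)
    = ennreal (\<pi>\<^sub>K \<gamma>) * evid n D \<gamma> (slice A \<gamma>) + ennreal (\<pi>\<^sub>K \<gamma>) * evid n D \<gamma> (slice B \<gamma>)"
    by (simp only: distrib_left)
qed

lemma model_event_hellinger:
  "model_event {(\<gamma>, \<beta>). hell \<gamma> \<beta> > \<epsilon>}" (is "model_event ?A")
  "model_event {(\<gamma>, \<beta>). hell \<gamma> \<beta> \<le> \<epsilon>}" (is "model_event ?A'")
proof -
  have "slice ?A \<gamma> \<in> sets (N \<gamma>) \<and> slice ?A' \<gamma> \<in> sets (N \<gamma>)" if \<gamma>: "\<gamma> \<subseteq> {..<K}" for \<gamma>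
  proof -
    note [measurable] = hellinger_dist_meas[OF \<gamma>, of "V \<gamma>"]
    have "{\<beta> \<in> space (N \<gamma>). hell \<gamma> \<beta> > \<epsilon>} \<in> sets (N \<gamma>)" "{\<beta> \<in> space (N \<gamma>). hell \<gamma> \<beta> \<le> \<epsilon>} \<in> sets (N \<gamma>)"
      by measurable
    then show ?thesis by simp
  qed
  then show "model_event ?A" "model_event ?A'" unfolding model_event_def by blast+
qed

lemma model_event_Diff_Int:
  assumes A: "model_event A" and B: "model_event B"
  shows "model_event (A - B)" "model_event (A \<inter> B)"
proof -
  have "slice (A - B) \<gamma> \<in> sets (N \<gamma>) \<and> slice (A \<inter> B) \<gamma> \<in> sets (N \<gamma>)" if \<gamma>: "\<gamma> \<subseteq> {..<K}" for \<gamma>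
  proof -
    have e: "slice (A - B) \<gamma> = slice A \<gamma> - slice B \<gamma>" "slice (A \<inter> B) \<gamma> = slice A \<gamma> \<inter> slice B \<gamma>" by auto
    show ?thesis unfolding e using slice_sets[OF A \<gamma>] slice_sets[OF B \<gamma>] by (intro conjI sets.Diff sets.Int)
  qed
  then show "model_event (A - B)" "model_event (A \<inter> B)" unfolding model_event_def by blast+
qed

end

section \<open>Evidence, large coefficients and cells of the sieve\<close>

context glm_model
begin

text \<open>Restricting the prior to a measurable set \<open>B\<close> turns statements about the set into statements about
integrated likelihoods against a finite measure.\<close>

lemma restricted_prior:
  assumes \<gamma>: "\<gamma> \<subseteq> {..<K}" and B [measurable]: "B \<in> sets (N \<gamma>)"
  defines "T \<equiv> density (N \<gamma>) (indicator B)"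
  shows "finite_measure T" "sigma_finite_measure T" "emeasure T (space T) = emeasure (N \<gamma>) B"
    and "case_prod (lr \<gamma>) \<in> borel_measurable (T \<Otimes>\<^sub>M P)"
    and "D \<in> space (Q n) \<Longrightarrow> (\<integral>\<^sup>+\<beta>. ennreal (\<Prod>i<n. lr \<gamma> \<beta> (D i)) \<partial>T) = evid n D \<gamma> B"
    and "(\<And>\<beta>. \<beta> \<in> B \<Longrightarrow> R \<beta>) \<Longrightarrow> AE \<beta> in T. R \<beta>"
proof -
  interpret N: prob_space "N \<gamma>" by (rule N_prob) fact
  have T: "emeasure T (space T) = emeasure (N \<gamma>) B"
  proof -
    have "emeasure T (space T) = (\<integral>\<^sup>+\<beta>. indicator B \<beta> * indicator (space (N \<gamma>)) \<beta> \<partial>N \<gamma>)"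
      unfolding T_def space_density using B by (intro emeasure_density borel_measurable_indicator sets.top)
    also have "\<dots> = (\<integral>\<^sup>+\<beta>. indicator B \<beta> \<partial>N \<gamma>)" by (intro nn_integral_cong) (simp add: indicator_def)
    also have "\<dots> = emeasure (N \<gamma>) B" by (rule nn_integral_indicator[OF B])
    finally show ?thesis .
  qed
  then show "emeasure T (space T) = emeasure (N \<gamma>) B" .
  show "finite_measure T" using T by (intro finite_measureI) simp
  then show "sigma_finite_measure T" by (rule finite_measure.axioms(1))
  have "sets (T \<Otimes>\<^sub>M P) = sets (N \<gamma> \<Otimes>\<^sub>M P)"
    by (intro sets_pair_measure_cong) (simp_all add: T_def)
  then show "case_prod (lr \<gamma>) \<in> borel_measurable (T \<Otimes>\<^sub>M P)"
    using lr_joint_meas[OF \<gamma>, of "V \<gamma>"] measurable_cong_sets[OF _ refl] by blast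
  show "AE \<beta> in T. R \<beta>" if "\<And>\<beta>. \<beta> \<in> B \<Longrightarrow> R \<beta>"
    unfolding T_def using that by (subst AE_density) (auto simp: indicator_def)
  show "(\<integral>\<^sup>+\<beta>. ennreal (\<Prod>i<n. lr \<gamma> \<beta> (D i)) \<partial>T) = evid n D \<gamma> B"
    if D: "D \<in> space (Q n)"
  proof -
    note [measurable] = measurable_Pair2[OF lrprod_meas[OF \<gamma>] D, simplified]
    show ?thesis unfolding T_def lrprod_def[symmetric]
      by (subst nn_integral_density) (auto simp: mult.commute)
  qed
qed

text \<open>The evidence is at least the contribution of one model \<open>\<gamma>\<close> and of a box of half-width \<open>\<eta>\<close> around the
true coefficients, on which the linear parameter is off by at most \<open>t\<close>.\<close>

lemma expected_inverse_marginal: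
  assumes \<gamma>: "\<gamma> \<subseteq> {..<K}" "card \<gamma> = r" and C: "C > 0"
    and chi: "\<And>u h. \<bar>u\<bar> \<le> M \<Longrightarrow> C * \<bar>h - u\<bar> \<le> 1 \<Longrightarrow>
      (\<integral>\<^sup>+y. ennreal (f y u * (f y u / f y h)) \<partial>\<nu>y) \<le> ennreal (exp (C * \<bar>h - u\<bar>))"
    and \<eta>: "\<eta> \<ge> 0" and t: "(\<Sum>j\<in>{..<K} - \<gamma>. \<bar>\<beta>s j\<bar>) + real r * \<eta> \<le> t" "C * t \<le> 1"
    and w: "0 < w" "ennreal w \<le> emeasure (N \<gamma>) (\<Pi>\<^sub>E j\<in>\<gamma>. {\<beta>s j - \<eta>..\<beta>s j + \<eta>})"
    and \<pi>0: "0 < \<pi>0" "\<pi>0 \<le> \<pi>\<^sub>K \<gamma>"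
  shows "(\<integral>\<^sup>+D. 1 / J n D UNIV \<partial>Q n) \<le> ennreal (exp (C * t) ^ n / (\<pi>0 * w))"
proof -
  let ?B = "\<Pi>\<^sub>E j\<in>\<gamma>. {\<beta>s j - \<eta>..\<beta>s j + \<eta>}"
  have fin: "finite \<gamma>" using \<gamma>(1) by (rule finite_model)
  have B: "?B \<in> sets (N \<gamma>)" using fin by (auto intro!: sets_PiM_I_finite)
  define T where "T = density (N \<gamma>) (indicator ?B)"
  note R = restricted_prior[OF \<gamma>(1) B, folded T_def]
  have ae: "AE x in \<nu>x. \<bar>lin_par {..<K} x \<beta>s\<bar> \<le> M \<and> \<bar>lin_par \<gamma> x \<beta> - lin_par {..<K} x \<beta>s\<bar> \<le> t"
    if \<beta>: "\<beta> \<in> ?B" for \<beta>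
    using x_bounded
  proof eventually_elim
    fix x :: "nat \<Rightarrow> real" assume x: "\<forall>j<K. \<bar>x j\<bar> \<le> 1"
    have "lin_par {..<K} x \<beta>s = lin_par \<gamma> x \<beta>s + lin_par ({..<K} - \<gamma>) x \<beta>s"
      unfolding lin_par_def using \<gamma>(1) by (simp add: sum.subset_diff)
    then have "\<bar>lin_par \<gamma> x \<beta> - lin_par {..<K} x \<beta>s\<bar>
      \<le> \<bar>lin_par \<gamma> x \<beta> - lin_par \<gamma> x \<beta>s\<bar> + \<bar>lin_par ({..<K} - \<gamma>) x \<beta>s\<bar>" by linarith
    also have "\<bar>lin_par ({..<K} - \<gamma>) x \<beta>s\<bar> \<le> (\<Sum>j\<in>{..<K} - \<gamma>. \<bar>\<beta>s j\<bar>)"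
      using x by (intro lin_par_le) auto
    also have "\<bar>lin_par \<gamma> x \<beta> - lin_par \<gamma> x \<beta>s\<bar> \<le> (\<Sum>j\<in>\<gamma>. \<bar>\<beta> j - \<beta>s j\<bar>)"
      unfolding lin_par_diff using x \<gamma>(1) by (intro lin_par_le) auto
    also have "\<dots> \<le> (\<Sum>j\<in>\<gamma>. \<eta>)"
    proof (rule sum_mono)
      fix j assume "j \<in> \<gamma>"
      then have "\<beta> j \<in> {\<beta>s j - \<eta>..\<beta>s j + \<eta>}" using \<beta> by (auto simp: PiE_def)
      then show "\<bar>\<beta> j - \<beta>s j\<bar> \<le> \<eta>" by auto
    qed
    also have "\<dots> = real r * \<eta>" using \<gamma>(2) by simp
    finally have 1: "\<bar>lin_par \<gamma> x \<beta> - lin_par {..<K} x \<beta>s\<bar> \<le> t" using t by simp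
    have "\<bar>lin_par {..<K} x \<beta>s\<bar> \<le> M" using lin_par_le[OF order_refl x, of \<beta>s] \<beta>s_le by simp
    with 1 show "\<bar>lin_par {..<K} x \<beta>s\<bar> \<le> M \<and> \<bar>lin_par \<gamma> x \<beta> - lin_par {..<K} x \<beta>s\<bar> \<le> t" by simp
  qed
  have T1: "(\<integral>\<^sup>+D. 1 / (\<integral>\<^sup>+\<beta>. ennreal (\<Prod>i<n. lr \<gamma> \<beta> (D i)) \<partial>T) \<partial>Q n) \<le> ennreal (exp (C * t) ^ n / w)"
  proof (rule expected_inverse_evidence[OF prob_space_P R(1,4) lr_pos _ _ w(1)])
    show "AE \<beta> in T. (\<integral>\<^sup>+z. ennreal (1 / lr \<gamma> \<beta> z) \<partial>P) \<le> ennreal (exp (C * t))"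
      by (rule R(6)) (intro inverse_lr_integral_le[OF \<gamma>(1) C chi t(2) ae])
    show "ennreal w \<le> emeasure T (space T)" unfolding R(3) by (rule w(2))
  qed simp
  let ?I = "\<lambda>D. \<integral>\<^sup>+\<beta>. ennreal (\<Prod>i<n. lr \<gamma> \<beta> (D i)) \<partial>T"
  have "(\<integral>\<^sup>+D. 1 / J n D UNIV \<partial>Q n) \<le> (\<integral>\<^sup>+D. ennreal (1 / \<pi>0) * (1 / ?I D) \<partial>Q n)"
  proof (rule nn_integral_mono)
    fix D assume D: "D \<in> space (Q n)"
    have "ennreal \<pi>0 * ?I D \<le> ennreal (\<pi>\<^sub>K \<gamma>) * evid n D \<gamma> (slice UNIV \<gamma>)"
      unfolding R(5)[OF D] using \<pi>0(2)
      by (intro mult_mono ennreal_leI nn_integral_mono) (auto simp: indicator_def)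
    also have "\<dots> \<le> J n D UNIV"
      unfolding J_def using \<gamma>(1) by (intro member_le_sum) auto
    finally have le: "ennreal \<pi>0 * ?I D \<le> J n D UNIV" .
    have "1 / J n D UNIV \<le> 1 / (ennreal \<pi>0 * ?I D)"
      unfolding divide_ennreal_def by (intro mult_left_mono ennreal_inverse_antimono le) simp
    also have "\<dots> = ennreal \<pi>0 * ennreal (1 / \<pi>0) / (ennreal \<pi>0 * ?I D)"
      using \<pi>0 by (simp add: ennreal_mult[symmetric])
    also have "\<dots> = ennreal (1 / \<pi>0) * (1 / ?I D)"
      unfolding ennreal_mult_divide_cancel[OF \<pi>0(1)] by (simp add: divide_ennreal_def)
    finally show "1 / J n D UNIV \<le> ennreal (1 / \<pi>0) * (1 / ?I D)" .
  qed
  also have "\<dots> = ennreal (1 / \<pi>0) * (\<integral>\<^sup>+D. 1 / ?I D \<partial>Q n)"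
  proof (rule nn_integral_cmult)
    interpret T: finite_measure T by (rule R(1))
    note [measurable] = measurable_prod_likelihood[OF R(4), of n]
    show "(\<lambda>D. 1 / ?I D) \<in> borel_measurable (Q n)" by measurable
  qed
  also have "\<dots> \<le> ennreal (1 / \<pi>0) * ennreal (exp (C * t) ^ n / w)"
    by (intro mult_left_mono T1) simp
  also have "\<dots> = ennreal (exp (C * t) ^ n / (\<pi>0 * w))"
    using \<pi>0 w by (simp add: ennreal_mult[symmetric])
  finally show ?thesis .
qed

definition large_coef :: "real \<Rightarrow> (nat set \<times> (nat \<Rightarrow> real)) set" where
  "large_coef Cn = {(\<gamma>, \<beta>). \<exists>j\<in>\<gamma>. \<bar>\<beta> j\<bar> > Cn}"

lemma model_event_large_coef: "model_event (large_coef Cn)"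
  unfolding model_event_def
proof (intro allI impI)
  fix \<gamma> assume "\<gamma> \<subseteq> {..<K}"
  then have fin: "finite \<gamma>" by (rule finite_model)
  have "slice (large_coef Cn) \<gamma>
     = (\<Union>j\<in>\<gamma>. {\<beta> \<in> space (N \<gamma>). \<bar>\<beta> j\<bar> > Cn})" by (auto simp: large_coef_def)
  also have "\<dots> \<in> sets (N \<gamma>)"
  proof (intro sets.finite_UN fin)
    fix j assume [measurable]: "j \<in> \<gamma>"
    show "{\<beta> \<in> space (N \<gamma>). \<bar>\<beta> j\<bar> > Cn} \<in> sets (N \<gamma>)"
      by measurable
  qed
  finally show "slice (large_coef Cn) \<gamma> \<in> sets (N \<gamma>)" .
qed

lemma expected_J:
  assumes A: "model_event A"
  shows "(\<integral>\<^sup>+D. J n D A \<partial>Q n) \<le> (\<Sum>\<gamma>\<in>Pow {..<K}. ennreal (\<pi>\<^sub>K \<gamma>) * emeasure (N \<gamma>) (slice A \<gamma>))"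
proof -
  have "(\<integral>\<^sup>+D. J n D A \<partial>Q n)
    = (\<Sum>\<gamma>\<in>Pow {..<K}. ennreal (\<pi>\<^sub>K \<gamma>) * (\<integral>\<^sup>+D. evid n D \<gamma> (slice A \<gamma>) \<partial>Q n))"
    unfolding J_def using evid_meas slice_sets[OF A]
    by (subst nn_integral_sum) (auto intro!: sum.cong nn_integral_cmult)
  also have "\<dots> \<le> (\<Sum>\<gamma>\<in>Pow {..<K}. ennreal (\<pi>\<^sub>K \<gamma>) * emeasure (N \<gamma>) (slice A \<gamma>))"
  proof (intro sum_mono mult_left_mono)
    fix \<gamma> assume "\<gamma> \<in> Pow {..<K}"
    then have \<gamma>: "\<gamma> \<subseteq> {..<K}" by simp
    let ?B = "slice A \<gamma>"
    have B: "?B \<in> sets (N \<gamma>)" by (rule slice_sets[OF A \<gamma>])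
    define T where "T = density (N \<gamma>) (indicator ?B)"
    note R = restricted_prior[OF \<gamma> B, folded T_def]
    have "(\<integral>\<^sup>+D. evid n D \<gamma> (slice A \<gamma>) \<partial>Q n)
      = (\<integral>\<^sup>+D. (\<integral>\<^sup>+\<beta>. ennreal (\<Prod>i<n. lr \<gamma> \<beta> (D i)) \<partial>T) \<partial>Q n)"
      by (intro nn_integral_cong) (auto simp: R(5) indicator_def intro!: nn_integral_cong)
    also have "\<dots> \<le> ennreal (1 ^ n) * emeasure T (space T)"
      by (rule expected_integrated_likelihood[OF prob_space_P R(2,4)])
        (auto simp: lr_pos less_imp_le lr_integral[OF \<gamma>])
    finally show "(\<integral>\<^sup>+D. evid n D \<gamma> (slice A \<gamma>) \<partial>Q n) \<le> emeasure (N \<gamma>) ?B"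
      unfolding R(3) by simp
  qed simp
  finally show ?thesis .
qed

lemma sum_prior_le:
  assumes "\<And>\<gamma>. \<gamma> \<subseteq> {..<K} \<Longrightarrow> card \<gamma> \<le> rbar \<Longrightarrow> F \<gamma> \<le> ennreal q" "q \<ge> 0"
  shows "(\<Sum>\<gamma>\<in>Pow {..<K}. ennreal (\<pi>\<^sub>K \<gamma>) * F \<gamma>) \<le> ennreal q"
proof -
  have nn: "\<pi>\<^sub>K \<gamma> \<ge> 0" for \<gamma> using r_range by (intro model_prior_nonneg) simp
  have "(\<Sum>\<gamma>\<in>Pow {..<K}. ennreal (\<pi>\<^sub>K \<gamma>) * F \<gamma>) \<le> (\<Sum>\<gamma>\<in>Pow {..<K}. ennreal (\<pi>\<^sub>K \<gamma>) * ennreal q)"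
  proof (rule sum_mono)
    fix \<gamma> assume "\<gamma> \<in> Pow {..<K}"
    then show "ennreal (\<pi>\<^sub>K \<gamma>) * F \<gamma> \<le> ennreal (\<pi>\<^sub>K \<gamma>) * ennreal q"
      using assms(1)[of \<gamma>] by (cases "card \<gamma> \<le> rbar") (auto simp: model_prior_eq_0 intro: mult_left_mono)
  qed
  also have "\<dots> = ennreal ((\<Sum>\<gamma>\<in>Pow {..<K}. \<pi>\<^sub>K \<gamma>) * q)"
    using nn assms(2) by (simp add: sum_distrib_right[symmetric] ennreal_mult sum_nonneg)
  also have "\<dots> \<le> ennreal q"
    using model_prior_sum_le[of K r rbar] assms(2) nn
    by (intro ennreal_leI mult_left_le_one_le sum_nonneg) auto
  finally show ?thesis .
qed

lemma expected_large_coef: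
  assumes Cn: "Cn > 0" and bb: "\<And>\<gamma>. \<gamma> \<subseteq> {..<K} \<Longrightarrow> \<gamma> \<noteq> {} \<Longrightarrow> card \<gamma> \<le> rbar \<Longrightarrow> ch1 (V \<gamma>) \<le> bb"
  shows "(\<integral>\<^sup>+D. J n D (large_coef Cn) \<partial>Q n) \<le> ennreal (real rbar * (2 * exp (- Cn\<^sup>2 / (2 * bb))))"
proof -
  let ?q = "2 * exp (- Cn\<^sup>2 / (2 * bb))"
  have "(\<integral>\<^sup>+D. J n D (large_coef Cn) \<partial>Q n) \<le> (\<Sum>\<gamma>\<in>Pow {..<K}. ennreal (\<pi>\<^sub>K \<gamma>) * emeasure (N \<gamma>) (slice (large_coef Cn) \<gamma>))"
    by (rule expected_J) (rule model_event_large_coef)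
  also have "\<dots> \<le> ennreal (real rbar * ?q)"
  proof (rule sum_prior_le)
    fix \<gamma> assume \<gamma>: "\<gamma> \<subseteq> {..<K}" "card \<gamma> \<le> rbar"
    have fin: "finite \<gamma>" using \<gamma>(1) by (rule finite_model)
    have "slice (large_coef Cn) \<gamma> = (\<Union>j\<in>\<gamma>. {\<beta> \<in> space (N \<gamma>). \<bar>\<beta> j\<bar> > Cn})"
      by (auto simp: large_coef_def)
    then have "emeasure (N \<gamma>) (slice (large_coef Cn) \<gamma>)
      \<le> (\<Sum>j\<in>\<gamma>. emeasure (N \<gamma>) {\<beta> \<in> space (N \<gamma>). \<bar>\<beta> j\<bar> > Cn})"
    proof (simp only:, intro emeasure_subadditive_finite fin)
      show "(\<lambda>j. {\<beta> \<in> space (N \<gamma>). \<bar>\<beta> j\<bar> > Cn}) ` \<gamma> \<subseteq> sets (N \<gamma>)"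
      proof
        fix S assume "S \<in> (\<lambda>j. {\<beta> \<in> space (N \<gamma>). \<bar>\<beta> j\<bar> > Cn}) ` \<gamma>"
        then obtain j where S: "S = {\<beta> \<in> space (N \<gamma>). \<bar>\<beta> j\<bar> > Cn}" and [measurable]: "j \<in> \<gamma>" by blast
        have [measurable]: "(\<lambda>\<beta>. \<beta> j) \<in> borel_measurable (N \<gamma>)" by (rule measurable_coef_component) fact
        show "S \<in> sets (N \<gamma>)" unfolding S by measurable
      qed
    qed
    also have "\<dots> \<le> (\<Sum>j\<in>\<gamma>. ennreal ?q)"
      using \<gamma> by (intro sum_mono coef_prior_tail fin V_pos_def bb Cn) auto
    also have "\<dots> = ennreal (real (card \<gamma>) * ?q)" by (simp add: ennreal_mult ennreal_of_nat_eq_real_of_nat)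
    also have "\<dots> \<le> ennreal (real rbar * ?q)" using \<gamma>(2) by (intro ennreal_leI mult_right_mono) auto
    finally show "emeasure (N \<gamma>) (slice (large_coef Cn) \<gamma>) \<le> ennreal (real rbar * ?q)" .
  qed simp
  finally show ?thesis .
qed

text \<open>The cubes are half-open, so that a bounded coefficient vector lies in exactly one of them, with \<open>k\<close>
the vector of the integer parts of \<open>\<beta> j / w\<close>.\<close>

definition cell :: "real \<Rightarrow> real \<Rightarrow> nat set \<Rightarrow> (nat \<Rightarrow> int) \<Rightarrow> (nat \<Rightarrow> real) set" where
  "cell Cn w \<gamma> k = {\<beta> \<in> space (N \<gamma>). \<forall>j\<in>\<gamma>. \<bar>\<beta> j\<bar> \<le> Cn \<and> of_int (k j) * w \<le> \<beta> j \<and> \<beta> j < (of_int (k j) + 1) * w}"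

lemma cell_sets [measurable]: assumes "\<gamma> \<subseteq> {..<K}" shows "cell Cn w \<gamma> k \<in> sets (N \<gamma>)"
proof -
  have fin: "finite \<gamma>" using assms by (rule finite_model)
  show ?thesis unfolding cell_def
  proof (intro sets.sets_Collect_finite_All fin)
    fix j assume "j \<in> \<gamma>"
    then have [measurable]: "(\<lambda>\<beta>. \<beta> j) \<in> borel_measurable (N \<gamma>)" by (rule measurable_coef_component)
    show "{\<beta> \<in> space (N \<gamma>). \<bar>\<beta> j\<bar> \<le> Cn \<and> of_int (k j) * w \<le> \<beta> j \<and> \<beta> j < (of_int (k j) + 1) * w} \<in> sets (N \<gamma>)"
      by measurable
  qed
qed

lemma cell_event_sets:
  assumes A: "model_event A" and \<gamma>: "\<gamma> \<subseteq> {..<K}"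
  shows "{\<beta> \<in> cell Cn w \<gamma> k. (\<gamma>, \<beta>) \<in> A} \<in> sets (N \<gamma>)"
proof -
  have "slice A \<gamma> \<in> sets (N \<gamma>)" by (rule slice_sets[OF A \<gamma>])
  then have "cell Cn w \<gamma> k \<inter> slice A \<gamma> \<in> sets (N \<gamma>)" using cell_sets[OF \<gamma>] by blast
  also have "cell Cn w \<gamma> k \<inter> slice A \<gamma> = {\<beta> \<in> cell Cn w \<gamma> k. (\<gamma>, \<beta>) \<in> A}" by (auto simp: cell_def)
  finally show ?thesis .
qed

lemma expected_sqrt_cell:
  assumes \<gamma>: "\<gamma> \<subseteq> {..<K}" "card \<gamma> \<le> rbar" and B: "B \<in> sets (N \<gamma>)" "B \<subseteq> cell Cn w \<gamma> k"
    and far: "\<And>\<beta>. \<beta> \<in> B \<Longrightarrow> hell \<gamma> \<beta> > \<epsilon>"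
    and \<epsilon>: "0 < \<epsilon>" "\<epsilon> \<le> 1" and Cn: "Cn \<ge> 0" and w: "w \<ge> 0"
    and fine: "lip (real rbar * Cn) * (real rbar * w) \<le> \<epsilon>\<^sup>2 / 4"
  shows "(\<integral>\<^sup>+D. esqrt (evid n D \<gamma> B) \<partial>Q n) \<le> ennreal ((1 - \<epsilon>\<^sup>2 / 8) ^ n)"
proof (cases "B = {}")
  case True
  then show ?thesis by (simp add: esqrt_def)
next
  case False
  then obtain \<beta>1 where \<beta>1: "\<beta>1 \<in> B" by blast
  define T where "T = density (N \<gamma>) (indicator B)"
  note R = restricted_prior[OF \<gamma>(1) B(1), folded T_def]
  have e1: "\<epsilon>\<^sup>2 \<le> 1" using \<epsilon> by (simp add: power_le_one)
  have bound: "AE x in \<nu>x. \<bar>lin_par \<gamma> x \<beta>\<bar> \<le> real rbar * Cn" if "\<beta> \<in> B" for \<beta>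
    using x_bounded
  proof eventually_elim
    fix x :: "nat \<Rightarrow> real" assume x: "\<forall>j<K. \<bar>x j\<bar> \<le> 1"
    have "\<bar>lin_par \<gamma> x \<beta>\<bar> \<le> (\<Sum>j\<in>\<gamma>. \<bar>\<beta> j\<bar>)" by (rule lin_par_le[OF \<gamma>(1) x])
    also have "\<dots> \<le> (\<Sum>j\<in>\<gamma>. Cn)" using that B(2) by (intro sum_mono) (auto simp: cell_def)
    also have "\<dots> \<le> real rbar * Cn" using \<gamma>(2) Cn by (simp add: mult_right_mono)
    finally show "\<bar>lin_par \<gamma> x \<beta>\<bar> \<le> real rbar * Cn" .
  qed
  have near: "AE x in \<nu>x. \<bar>lin_par \<gamma> x \<beta> - lin_par \<gamma> x \<beta>1\<bar> \<le> real rbar * w" if \<beta>: "\<beta> \<in> B" for \<beta>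
    using x_bounded
  proof eventually_elim
    fix x :: "nat \<Rightarrow> real" assume x: "\<forall>j<K. \<bar>x j\<bar> \<le> 1"
    have "\<bar>lin_par \<gamma> x \<beta> - lin_par \<gamma> x \<beta>1\<bar> \<le> (\<Sum>j\<in>\<gamma>. \<bar>\<beta> j - \<beta>1 j\<bar>)"
      unfolding lin_par_diff by (rule lin_par_le[OF \<gamma>(1) x])
    also have "\<dots> \<le> (\<Sum>j\<in>\<gamma>. w)"
    proof (rule sum_mono)
      fix j assume j: "j \<in> \<gamma>"
      have "of_int (k j) * w \<le> \<beta> j" "\<beta> j < (of_int (k j) + 1) * w" "of_int (k j) * w \<le> \<beta>1 j" "\<beta>1 j < (of_int (k j) + 1) * w"
        using \<beta> \<beta>1 B(2) j by (auto simp: cell_def)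
      then show "\<bar>\<beta> j - \<beta>1 j\<bar> \<le> w" by (simp add: distrib_right)
    qed
    also have "\<dots> \<le> real rbar * w" using \<gamma>(2) w by (simp add: mult_right_mono)
    finally show "\<bar>lin_par \<gamma> x \<beta> - lin_par \<gamma> x \<beta>1\<bar> \<le> real rbar * w" .
  qed
  have "(\<integral>\<^sup>+D. esqrt (evid n D \<gamma> B) \<partial>Q n)
    = (\<integral>\<^sup>+D. esqrt (\<integral>\<^sup>+\<beta>. ennreal (\<Prod>i<n. lr \<gamma> \<beta> (D i)) \<partial>T) \<partial>Q n)"
    by (intro nn_integral_cong) (simp add: R(5))
  also have "\<dots> \<le> ennreal ((1 - \<epsilon>\<^sup>2 / 8) ^ n) * esqrt (emeasure T (space T))"
  proof (rule sqrt_integrated_likelihood_decay[OF prob_space_P R(2,4) lr_meas[OF \<gamma>(1), of \<beta>1]])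
    show "AE \<beta> in T. (\<integral>\<^sup>+z. ennreal (lr \<gamma> \<beta> z) \<partial>P) = 1" by (simp add: lr_integral[OF \<gamma>(1)])
    show "AE \<beta> in T. (\<integral>\<^sup>+z. ennreal ((sqrt (lr \<gamma> \<beta> z) - sqrt (lr \<gamma> \<beta>1 z))\<^sup>2) \<partial>P) \<le> ennreal (\<epsilon>\<^sup>2 / 4)"
    proof (rule R(6))
      fix \<beta> assume \<beta>: "\<beta> \<in> B"
      have "(\<integral>\<^sup>+z. ennreal ((sqrt (lr \<gamma> \<beta> z) - sqrt (lr \<gamma> \<beta>1 z))\<^sup>2) \<partial>P) \<le> ennreal (lip (real rbar * Cn) * (real rbar * w))"
      proof (rule lr_hellinger_le[OF \<gamma>(1)])
        show "AE x in \<nu>x. \<bar>lin_par \<gamma> x \<beta>\<bar> \<le> real rbar * Cn \<and> \<bar>lin_par \<gamma> x \<beta>1\<bar> \<le> real rbar * Cn \<and> \<bar>lin_par \<gamma> x \<beta> - lin_par \<gamma> x \<beta>1\<bar> \<le> real rbar * w"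
          using bound[OF \<beta>] bound[OF \<beta>1] near[OF \<beta>] by eventually_elim simp
      qed (use Cn w in auto)
      also have "\<dots> \<le> ennreal (\<epsilon>\<^sup>2 / 4)" by (intro ennreal_leI fine)
      finally show "(\<integral>\<^sup>+z. ennreal ((sqrt (lr \<gamma> \<beta> z) - sqrt (lr \<gamma> \<beta>1 z))\<^sup>2) \<partial>P) \<le> ennreal (\<epsilon>\<^sup>2 / 4)" .
    qed
    have "ennreal (\<epsilon>\<^sup>2) \<le> ennreal ((hell \<gamma> \<beta>1)\<^sup>2)"
      using far[OF \<beta>1] \<epsilon> by (intro ennreal_leI power_mono) auto
    also have "\<dots> = (\<integral>\<^sup>+z. ennreal ((sqrt (lr \<gamma> \<beta>1 z) - 1)\<^sup>2) \<partial>P)"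
      unfolding hellinger_dist_eq(1)[OF \<gamma>(1), symmetric] hell_sq_def ..
    finally show "ennreal (\<epsilon>\<^sup>2) \<le> (\<integral>\<^sup>+z. ennreal ((sqrt (lr \<gamma> \<beta>1 z) - 1)\<^sup>2) \<partial>P)" .
  qed (use e1 lr_pos in \<open>auto intro: less_imp_le\<close>)
  also have "\<dots> \<le> ennreal ((1 - \<epsilon>\<^sup>2 / 8) ^ n) * 1"
  proof (rule mult_left_mono)
    interpret N: prob_space "N \<gamma>" by (rule N_prob) fact
    have "esqrt (emeasure T (space T)) \<le> esqrt 1"
      unfolding R(3) by (rule esqrt_mono) (simp add: N.emeasure_le_1)
    also have "esqrt 1 = 1" by (simp add: esqrt_def)
    finally show "esqrt (emeasure T (space T)) \<le> 1" .
  qed simp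
  finally show ?thesis by simp
qed

lemma sieve_mass_le_cells:
  assumes A: "model_event A" and D: "D \<in> space (Q n)" and Cn: "Cn \<ge> 0" and w: "w > 0" and m: "Cn \<le> real m * w"
  shows "J n D (A - large_coef Cn) \<le> (\<Sum>\<gamma>\<in>{\<gamma>. \<gamma> \<subseteq> {..<K} \<and> card \<gamma> \<le> rbar}. \<Sum>k\<in>\<gamma> \<rightarrow>\<^sub>E {- int m..int m}.
    evid n D \<gamma> {\<beta> \<in> cell Cn w \<gamma> k. (\<gamma>, \<beta>) \<in> A})"
proof -
  let ?S = "A - large_coef Cn"
  let ?I = "\<lambda>\<gamma>. evid n D \<gamma> (slice ?S \<gamma>)"
  have "J n D ?S = (\<Sum>\<gamma>\<in>{\<gamma>. \<gamma> \<subseteq> {..<K} \<and> card \<gamma> \<le> rbar}. ennreal (\<pi>\<^sub>K \<gamma>) * ?I \<gamma>)"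
    unfolding J_def by (rule sum.mono_neutral_right) (auto simp: model_prior_eq_0 not_le)
  also have "\<dots> \<le> (\<Sum>\<gamma>\<in>{\<gamma>. \<gamma> \<subseteq> {..<K} \<and> card \<gamma> \<le> rbar}. \<Sum>k\<in>\<gamma> \<rightarrow>\<^sub>E {- int m..int m}.
    evid n D \<gamma> {\<beta> \<in> cell Cn w \<gamma> k. (\<gamma>, \<beta>) \<in> A})"
  proof (rule sum_mono)
    fix \<gamma> assume "\<gamma> \<in> {\<gamma>. \<gamma> \<subseteq> {..<K} \<and> card \<gamma> \<le> rbar}"
    then have \<gamma>: "\<gamma> \<subseteq> {..<K}" by simp
    let ?PE = "\<gamma> \<rightarrow>\<^sub>E {- int m..int m}"
    let ?C = "\<lambda>k. {\<beta> \<in> cell Cn w \<gamma> k. (\<gamma>, \<beta>) \<in> A}"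
    have fin: "finite ?PE" by (intro finite_PiE finite_model \<gamma>) simp
    note [measurable] = cell_event_sets[OF A \<gamma>]
    note [measurable] = measurable_Pair2[OF lrprod_meas[OF \<gamma>] D, simplified]
    have "\<pi>\<^sub>K \<gamma> \<le> 1" using r_range \<gamma> by (intro model_prior_le_1) auto
    then have "ennreal (\<pi>\<^sub>K \<gamma>) * ?I \<gamma> \<le> 1 * ?I \<gamma>" by (intro mult_right_mono) (simp_all add: ennreal_le_1)
    also have "1 * ?I \<gamma> \<le> (\<integral>\<^sup>+\<beta>. (\<Sum>k\<in>?PE. ennreal (lrprod n \<gamma> D \<beta>) * indicator (?C k) \<beta>) \<partial>N \<gamma>)"
      unfolding mult_1
    proof (rule nn_integral_mono)
      fix \<beta> assume \<beta>: "\<beta> \<in> space (N \<gamma>)"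
      show "ennreal (lrprod n \<gamma> D \<beta>) * indicator (slice ?S \<gamma>) \<beta> \<le> (\<Sum>k\<in>?PE. ennreal (lrprod n \<gamma> D \<beta>) * indicator (?C k) \<beta>)"
      proof (cases "(\<gamma>, \<beta>) \<in> ?S")
        case True
        define k where "k = (\<lambda>j\<in>\<gamma>. \<lfloor>\<beta> j / w\<rfloor>)"
        have b: "\<bar>\<beta> j\<bar> \<le> Cn" if "j \<in> \<gamma>" for j using True that by (force simp: large_coef_def)
        have k1: "of_int (k j) * w \<le> \<beta> j" "\<beta> j < (of_int (k j) + 1) * w" if "j \<in> \<gamma>" for j
        proof -
          have "of_int \<lfloor>\<beta> j / w\<rfloor> \<le> \<beta> j / w" "\<beta> j / w < of_int \<lfloor>\<beta> j / w\<rfloor> + 1" by linarith+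
          then show "of_int (k j) * w \<le> \<beta> j" "\<beta> j < (of_int (k j) + 1) * w"
            using that w by (simp_all add: k_def pos_le_divide_eq[symmetric] pos_divide_less_eq[symmetric])
        qed
        have "k \<in> ?PE"
        proof (rule PiE_I)
          fix j assume j: "j \<in> \<gamma>"
          have "\<bar>\<beta> j\<bar> \<le> real m * w" using b[OF j] m by simp
          then have "- real m \<le> \<beta> j / w" "\<beta> j / w \<le> real m"
            using w by (auto simp: pos_le_divide_eq pos_divide_le_eq abs_le_iff)
          then have "- int m \<le> \<lfloor>\<beta> j / w\<rfloor>" "\<lfloor>\<beta> j / w\<rfloor> \<le> int m" by linarith+
          then show "k j \<in> {- int m..int m}" using j by (simp add: k_def)
        qed (simp add: k_def)
        moreover have "\<beta> \<in> ?C k" using True b k1 \<beta> by (auto simp: cell_def)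
        ultimately have "ennreal (lrprod n \<gamma> D \<beta>) * indicator (?C k) \<beta> \<le> (\<Sum>k\<in>?PE. ennreal (lrprod n \<gamma> D \<beta>) * indicator (?C k) \<beta>)"
          using fin by (intro member_le_sum) auto
        then show ?thesis using True \<beta> \<open>\<beta> \<in> ?C k\<close> by simp
      qed simp
    qed
    also have "\<dots> = (\<Sum>k\<in>?PE. evid n D \<gamma> (?C k))"
      by (rule nn_integral_sum) measurable
    finally show "ennreal (\<pi>\<^sub>K \<gamma>) * ?I \<gamma> \<le> (\<Sum>k\<in>?PE. evid n D \<gamma> (?C k))" .
  qed
  finally show ?thesis .
qed

text \<open>Here \<open>JA / Z\<close> is a posterior probability, and \<open>\<delta>\<close> separates two cases. If the evidence \<open>Z\<close> is below \<open>\<delta>\<close>,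
then 1 is at most \<open>\<delta> / Z\<close>. Otherwise \<open>1 / Z \<le> 1 / \<delta>\<close>, and \<open>U / Z \<le> 1\<close> is at most its own root.\<close>

lemma posterior_ratio_le:
  fixes JA JT U Z :: ennreal
  assumes \<delta>: "\<delta> > 0" and JA: "JA \<le> JT + U" and UZ: "U \<le> Z" and AZ: "JA \<le> Z" and US: "esqrt U \<le> S"
  shows "JA / Z \<le> ennreal \<delta> * (1 / Z) + ennreal (1 / \<delta>) * JT + ennreal (1 / sqrt \<delta>) * S"
proof (cases Z)
  case top
  then show ?thesis by (simp add: divide_ennreal_def)
next
  case (real z)
  have nz: "JA / Z \<le> 1"
  proof (cases "z = 0")
    case True
    then show ?thesis using real AZ by (simp add: divide_ennreal_def)
  next
    case False
    have "JA / Z \<le> Z / Z" using AZ by (rule divide_right_mono_ennreal)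
    also have "\<dots> = 1" using False real by (simp add: divide_ennreal)
    finally show ?thesis .
  qed
  show ?thesis
  proof (cases "z < \<delta>")
    case True
    have "1 \<le> ennreal \<delta> * (1 / Z)"
    proof (cases "z = 0")
      case True
      then show ?thesis using real \<delta> by (simp add: divide_ennreal_def ennreal_mult_top)
    next
      case False
      then have z: "z > 0" using real by simp
      have "1 / Z = ennreal (1 / z)" using z real by (simp add: divide_ennreal[symmetric])
      then have "ennreal \<delta> * (1 / Z) = ennreal (\<delta> / z)" using \<delta> z by (simp add: ennreal_mult[symmetric])
      then show ?thesis using True z by simp
    qed
    also have "\<dots> \<le> ennreal \<delta> * (1 / Z) + (ennreal (1 / \<delta>) * JT + ennreal (1 / sqrt \<delta>) * S)" by simp
    finally show ?thesis using nz by (simp add: add.assoc)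
  next
    case False
    then have z: "z \<ge> \<delta>" "z > 0" using \<delta> by auto
    have iz: "inverse Z \<le> ennreal (1 / \<delta>)"
      using z \<delta> real by (simp add: inverse_ennreal ennreal_leI frac_le inverse_eq_divide)
    have "U / Z \<le> 1"
    proof -
      have "U / Z \<le> Z / Z" using UZ by (rule divide_right_mono_ennreal)
      also have "\<dots> = 1" using z real by (simp add: divide_ennreal)
      finally show ?thesis .
    qed
    then have "U / Z \<le> esqrt (U / Z)" by (rule le_one_imp_le_esqrt)
    also have "\<dots> \<le> esqrt (ennreal (1 / \<delta>) * U)"
      unfolding divide_ennreal_def using iz by (intro esqrt_mono) (simp add: mult.commute mult_left_mono)
    also have "\<dots> = ennreal (1 / sqrt \<delta>) * esqrt U"
      using \<delta> by (simp add: esqrt_mult_ennreal real_sqrt_divide)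
    also have "\<dots> \<le> ennreal (1 / sqrt \<delta>) * S" using US by (rule mult_left_mono) simp
    finally have u: "U / Z \<le> ennreal (1 / sqrt \<delta>) * S" .
    have "JA / Z \<le> (JT + U) / Z" using JA by (rule divide_right_mono_ennreal)
    also have "\<dots> = JT * inverse Z + U / Z" by (simp add: divide_ennreal_def distrib_right)
    also have "\<dots> \<le> ennreal (1 / \<delta>) * JT + ennreal (1 / sqrt \<delta>) * S"
      using iz u by (intro add_mono) (simp_all add: mult.commute mult_left_mono)
    also have "\<dots> \<le> ennreal \<delta> * (1 / Z) + (ennreal (1 / \<delta>) * JT + ennreal (1 / sqrt \<delta>) * S)" by simp
    finally show ?thesis by (simp add: add.assoc)
  qed
qed

text \<open>The three summands are the contributions of small evidence, of large coefficients, and of the cells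
of the sieve. The last one is the number of models times the number of cells times the decay per cell.\<close>

lemma expected_posterior:
  fixes \<epsilon> :: real
  defines "A \<equiv> {(\<gamma>, \<beta>). hell \<gamma> \<beta> > \<epsilon>}"
  assumes \<epsilon>: "0 < \<epsilon>" "\<epsilon> \<le> 1" and \<delta>: "\<delta> > 0"
    and ev: "(\<integral>\<^sup>+D. 1 / J n D UNIV \<partial>Q n) \<le> ennreal E"
    and bb: "\<And>\<gamma>. \<gamma> \<subseteq> {..<K} \<Longrightarrow> \<gamma> \<noteq> {} \<Longrightarrow> card \<gamma> \<le> rbar \<Longrightarrow> ch1 (V \<gamma>) \<le> bb"
    and Cn: "Cn > 0" and w: "w > 0" and m: "Cn \<le> real m * w" and E: "E \<ge> 0"
    and fine: "lip (real rbar * Cn) * (real rbar * w) \<le> \<epsilon>\<^sup>2 / 4"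
  shows "(\<integral>\<^sup>+D. J n D A / J n D UNIV \<partial>Q n) \<le> ennreal (\<delta> * E + 1 / \<delta> * (real rbar * (2 * exp (- Cn\<^sup>2 / (2 * bb))))
     + 1 / sqrt \<delta> * (real ((K + 1) ^ rbar * (2 * m + 1) ^ rbar) * (1 - \<epsilon>\<^sup>2 / 8) ^ n))"
proof -
  have A: "model_event A" unfolding A_def by (rule model_event_hellinger)
  let ?G = "{\<gamma>. \<gamma> \<subseteq> {..<K} \<and> card \<gamma> \<le> rbar}"
  let ?PE = "\<lambda>\<gamma>. \<gamma> \<rightarrow>\<^sub>E {- int m..int m}"
  let ?C = "\<lambda>\<gamma> k. {\<beta> \<in> cell Cn w \<gamma> k. (\<gamma>, \<beta>) \<in> A}"
  define I where "I = (\<lambda>\<gamma> k D. evid n D \<gamma> (?C \<gamma> k))"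
  have finG: "finite ?G" by (rule finite_subset[of _ "Pow {..<K}"]) auto
  have finPE: "finite (?PE \<gamma>)" if "\<gamma> \<in> ?G" for \<gamma> using that finite_model by (intro finite_PiE) auto
  note C_sets = cell_event_sets[OF A]
  have I_meas: "I \<gamma> k \<in> borel_measurable (Q n)" if "\<gamma> \<subseteq> {..<K}" for \<gamma> k
    unfolding I_def by (intro evid_meas C_sets that)
  have [measurable]: "(\<lambda>D. J n D UNIV) \<in> borel_measurable (Q n)" "(\<lambda>D. J n D (large_coef Cn)) \<in> borel_measurable (Q n)"
    by (intro J_meas model_event_UNIV model_event_large_coef)+
  let ?S = "\<lambda>D. \<Sum>\<gamma>\<in>?G. \<Sum>k\<in>?PE \<gamma>. esqrt (I \<gamma> k D)"
  have [measurable]: "?S \<in> borel_measurable (Q n)"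
    by (intro borel_measurable_sum measurable_compose[OF I_meas measurable_esqrt]) auto
  have "(\<integral>\<^sup>+D. J n D A / J n D UNIV \<partial>Q n) \<le> (\<integral>\<^sup>+D. ennreal \<delta> * (1 / J n D UNIV) + ennreal (1 / \<delta>) * J n D (large_coef Cn) + ennreal (1 / sqrt \<delta>) * ?S D \<partial>Q n)"
  proof (rule nn_integral_mono, rule posterior_ratio_le[OF \<delta>])
    fix D assume D: "D \<in> space (Q n)"
    let ?U = "J n D (A - large_coef Cn)"
    note A' = model_event_Diff_Int[OF A model_event_large_coef, of Cn]
    have "J n D A = J n D (A \<inter> large_coef Cn) + ?U"
      using J_add[OF A'(2,1) _ D] by (simp add: Int_Diff_Un Int_Diff_disjoint)
    also have "\<dots> \<le> J n D (large_coef Cn) + ?U" by (intro add_right_mono J_mono) auto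
    finally show "J n D A \<le> J n D (large_coef Cn) + ?U" .
    show "?U \<le> J n D UNIV" "J n D A \<le> J n D UNIV" by (intro J_mono; simp)+
    have "?U \<le> (\<Sum>\<gamma>\<in>?G. \<Sum>k\<in>?PE \<gamma>. I \<gamma> k D)"
      unfolding I_def using Cn by (intro sieve_mass_le_cells A D w m) simp
    then have "esqrt ?U \<le> esqrt (\<Sum>\<gamma>\<in>?G. \<Sum>k\<in>?PE \<gamma>. I \<gamma> k D)" by (rule esqrt_mono)
    also have "\<dots> \<le> (\<Sum>\<gamma>\<in>?G. esqrt (\<Sum>k\<in>?PE \<gamma>. I \<gamma> k D))" by (rule esqrt_sum_le[OF finG])
    also have "\<dots> \<le> ?S D" by (intro sum_mono esqrt_sum_le finPE)
    finally show "esqrt ?U \<le> ?S D" .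
  qed
  also have "\<dots> = ennreal \<delta> * (\<integral>\<^sup>+D. 1 / J n D UNIV \<partial>Q n) + ennreal (1 / \<delta>) * (\<integral>\<^sup>+D. J n D (large_coef Cn) \<partial>Q n) + ennreal (1 / sqrt \<delta>) * (\<integral>\<^sup>+D. ?S D \<partial>Q n)"
    by (simp add: nn_integral_add nn_integral_cmult)
  also have "\<dots> \<le> ennreal \<delta> * ennreal E + ennreal (1 / \<delta>) * ennreal (real rbar * (2 * exp (- Cn\<^sup>2 / (2 * bb))))
     + ennreal (1 / sqrt \<delta>) * ennreal (real ((K + 1) ^ rbar * (2 * m + 1) ^ rbar) * (1 - \<epsilon>\<^sup>2 / 8) ^ n)"
  proof (intro add_mono mult_left_mono ev expected_large_coef Cn bb)
    let ?q = "(1 - \<epsilon>\<^sup>2 / 8) ^ n"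
    have "\<epsilon>\<^sup>2 \<le> 1" using \<epsilon> by (simp add: power_le_one)
    then have q: "?q \<ge> 0" by (intro zero_le_power) simp
    have "(\<integral>\<^sup>+D. ?S D \<partial>Q n) = (\<Sum>\<gamma>\<in>?G. \<Sum>k\<in>?PE \<gamma>. (\<integral>\<^sup>+D. esqrt (I \<gamma> k D) \<partial>Q n))"
    proof -
      have m1: "(\<lambda>D. esqrt (I \<gamma> k D)) \<in> borel_measurable (Q n)" if "\<gamma> \<in> ?G" for \<gamma> k
        by (rule measurable_compose[OF I_meas measurable_esqrt]) (use that in simp)
      have "(\<integral>\<^sup>+D. ?S D \<partial>Q n) = (\<Sum>\<gamma>\<in>?G. (\<integral>\<^sup>+D. (\<Sum>k\<in>?PE \<gamma>. esqrt (I \<gamma> k D)) \<partial>Q n))"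
        by (intro nn_integral_sum borel_measurable_sum m1)
      also have "\<dots> = (\<Sum>\<gamma>\<in>?G. \<Sum>k\<in>?PE \<gamma>. (\<integral>\<^sup>+D. esqrt (I \<gamma> k D) \<partial>Q n))"
        by (intro sum.cong refl nn_integral_sum m1)
      finally show ?thesis .
    qed
    also have "\<dots> \<le> (\<Sum>\<gamma>\<in>?G. \<Sum>k\<in>?PE \<gamma>. ennreal ?q)"
    proof (intro sum_mono)
      fix \<gamma> k assume g: "\<gamma> \<in> ?G"
      then have \<gamma>: "\<gamma> \<subseteq> {..<K}" "card \<gamma> \<le> rbar" by auto
      show "(\<integral>\<^sup>+D. esqrt (I \<gamma> k D) \<partial>Q n) \<le> ennreal ?q"
        unfolding I_def using Cn w
        by (intro expected_sqrt_cell[OF \<gamma> C_sets[OF \<gamma>(1)] _ _ \<epsilon> _ _ fine, where k = k]) (auto simp: A_def)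
    qed
    also have "\<dots> \<le> (\<Sum>\<gamma>\<in>?G. ennreal (real ((2 * m + 1) ^ rbar) * ?q))"
    proof (rule sum_mono)
      fix \<gamma> assume g: "\<gamma> \<in> ?G"
      then have fin: "finite \<gamma>" using finite_model by auto
      have "card {- int m..int m} = 2 * m + 1" unfolding card_atLeastAtMost_int by linarith
      then have "card (?PE \<gamma>) = (2 * m + 1) ^ card \<gamma>" using fin by (simp only: card_PiE prod_constant)
      also have "\<dots> \<le> (2 * m + 1) ^ rbar" using g by (intro power_increasing) auto
      finally have "real (card (?PE \<gamma>)) * ?q \<le> real ((2 * m + 1) ^ rbar) * ?q"
        using q by (intro mult_right_mono) (simp_all only: of_nat_le_iff)
      then show "(\<Sum>k\<in>?PE \<gamma>. ennreal ?q) \<le> ennreal (real ((2 * m + 1) ^ rbar) * ?q)"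
        using q by (simp add: ennreal_of_nat_eq_real_of_nat ennreal_mult[symmetric] ennreal_leI del: of_nat_power)
    qed
    also have "\<dots> \<le> ennreal (real ((K + 1) ^ rbar * (2 * m + 1) ^ rbar) * ?q)"
    proof -
      have "real (card ?G) * (real ((2 * m + 1) ^ rbar) * ?q) \<le> real ((K + 1) ^ rbar) * (real ((2 * m + 1) ^ rbar) * ?q)"
        using card_small_subsets[of K rbar] q by (intro mult_right_mono) (simp_all only: of_nat_le_iff, simp)
      then show ?thesis using q
        by (simp add: ennreal_of_nat_eq_real_of_nat ennreal_mult[symmetric] ennreal_leI mult.assoc del: of_nat_power)
    qed
    finally show "(\<integral>\<^sup>+D. ?S D \<partial>Q n) \<le> ennreal (real ((K + 1) ^ rbar * (2 * m + 1) ^ rbar) * ?q)" .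
  qed auto
  also have "\<dots> = ennreal (\<delta> * E + 1 / \<delta> * (real rbar * (2 * exp (- Cn\<^sup>2 / (2 * bb))))
     + 1 / sqrt \<delta> * (real ((K + 1) ^ rbar * (2 * m + 1) ^ rbar) * (1 - \<epsilon>\<^sup>2 / 8) ^ n))"
  proof -
    have "\<epsilon>\<^sup>2 \<le> 1" using \<epsilon> by (simp add: power_le_one)
    then have q: "(1 - \<epsilon>\<^sup>2 / 8) ^ n \<ge> 0" by (intro zero_le_power) simp
    have "ennreal x * ennreal x' + ennreal y * ennreal y' + ennreal z * ennreal z' = ennreal (x * x' + y * y' + z * z')"
      if "x \<ge> 0" "x' \<ge> 0" "y \<ge> 0" "y' \<ge> 0" "z \<ge> 0" "z' \<ge> 0" for x x' y y' z z' :: real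
      using that by (simp add: ennreal_plus ennreal_mult)
    then show ?thesis using \<delta> E q by auto
  qed
  finally show ?thesis .
qed

end

section \<open>The contraction rate\<close>

context glm_model
begin

lemma finite_models: "finite (models_of_size K s)"
  by (rule finite_subset[of _ "Pow {..<K}"]) (auto simp: models_of_size_def)

lemma tail_sum_attained:
  assumes "s \<le> K"
  shows "\<exists>\<gamma>\<in>models_of_size K s. tail_sum K \<beta>s s = (\<Sum>j\<in>{..<K} - \<gamma>. \<bar>\<beta>s j\<bar>)"
proof -
  have "{..<s} \<in> models_of_size K s" using assms by (auto simp: models_of_size_def)
  then have ne: "models_of_size K s \<noteq> {}" by blast
  let ?I = "(\<lambda>\<gamma>. \<Sum>j\<in>{..<K} - \<gamma>. \<bar>\<beta>s j\<bar>) ` models_of_size K s"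
  have "Inf ?I = Min ?I" using ne finite_models by (intro cInf_eq_Min) auto
  moreover have "Min ?I \<in> ?I" using ne finite_models by (intro Min_in) auto
  ultimately show ?thesis unfolding tail_sum_def by auto
qed

lemma ch1_le_sup:
  assumes "\<gamma> \<in> models_of_size K s"
  shows "ch1 (V \<gamma>) \<le> sup_ch1 K V s" "ch1 (inv_mat (V \<gamma>)) \<le> sup_ch1_inv K V s"
  unfolding sup_ch1_def sup_ch1_inv_def
  by (intro cSUP_upper assms bdd_above_finite finite_imageI finite_models)+

lemma ch1_le_sup_upto:
  assumes "\<gamma> \<subseteq> {..<K}" "\<gamma> \<noteq> {}" "card \<gamma> \<le> rbar"
  shows "ch1 (V \<gamma>) \<le> sup_ch1_upto K V rbar"
proof -
  have "finite {\<gamma>. \<gamma> \<subseteq> {..<K} \<and> \<gamma> \<noteq> {} \<and> card \<gamma> \<le> rbar}"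
    by (rule finite_subset[of _ "Pow {..<K}"]) auto
  then show ?thesis unfolding sup_ch1_upto_def using assms
    by (intro cSUP_upper bdd_above_finite finite_imageI) auto
qed

lemma sup_ch1_upto_pos: "sup_ch1_upto K V rbar > 0"
proof -
  have "{0} \<subseteq> {..<K}" using r_range by auto
  then have "0 < ch1 (V {0})" using ch1_pos[OF V_pos_def[of "{0}"]] by simp
  also have "\<dots> \<le> sup_ch1_upto K V rbar" using r_range by (intro ch1_le_sup_upto) auto
  finally show ?thesis .
qed

text \<open>All terms of the negative logarithm of the prior mass of the box are small fractions of \<open>n \<epsilon>\<^sup>2\<close>. The
half-width \<open>\<eta> = \<epsilon>\<^sup>2 / (80 C r)\<close> is chosen so that box and neglected coefficients each contribute at most
\<open>\<epsilon>\<^sup>2 / 80\<close> to \<open>C t\<close>. Terms of the form constant times \<open>r\<close> are absorbed into \<open>r ln K\<close>.\<close>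

lemma expected_inverse_marginal_rate:
  fixes \<epsilon> :: real and n :: nat
  defines "N0 \<equiv> real n * \<epsilon>\<^sup>2"
  assumes \<epsilon>: "0 < \<epsilon>" "\<epsilon> \<le> 1" and C: "C > 0"
    and chi: "\<And>u h. \<bar>u\<bar> \<le> M \<Longrightarrow> C * \<bar>h - u\<bar> \<le> 1 \<Longrightarrow>
      (\<integral>\<^sup>+y. ennreal (f y u * (f y u / f y h)) \<partial>\<nu>y) \<le> ennreal (exp (C * \<bar>h - u\<bar>))"
    and lnK: "3 + \<bar>ln (40 * C)\<bar> + \<bar>ln (2 * pi)\<bar> \<le> ln (real K)"
    and c_eps: "real rbar * ln (1 / \<epsilon>\<^sup>2) \<le> N0 / 400"
    and c_K: "real rbar * ln (real K) \<le> N0 / 400"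
    and c_B: "sup_ch1_inv K V r * (M + 1 / (80 * C))\<^sup>2 \<le> N0 / 400"
    and c_Bbar: "real r * ln (sup_ch1 K V r) \<le> N0 / 400"
    and c_Delta: "C * tail_sum K \<beta>s r \<le> \<epsilon>\<^sup>2 / 80"
  shows "(\<integral>\<^sup>+D. 1 / J n D UNIV \<partial>Q n) \<le> ennreal (exp (N0 / 20))"
proof -
  have r0: "real r \<ge> 1" using r_range by simp
  have K0: "real K > 0" using r_range by simp
  have e2: "0 < \<epsilon>\<^sup>2" "\<epsilon>\<^sup>2 \<le> 1" using \<epsilon> by (auto simp: power_le_one)
  obtain \<gamma> where \<gamma>: "\<gamma> \<in> models_of_size K r" and tl: "tail_sum K \<beta>s r = (\<Sum>j\<in>{..<K} - \<gamma>. \<bar>\<beta>s j\<bar>)"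
    using tail_sum_attained[of r] r_range by auto
  have \<gamma>': "\<gamma> \<subseteq> {..<K}" "card \<gamma> = r" using \<gamma> by (auto simp: models_of_size_def)
  have fin: "finite \<gamma>" using \<gamma>'(1) by (rule finite_model)
  have ne: "\<gamma> \<noteq> {}" using \<gamma>'(2) r_range by auto
  define \<eta> where "\<eta> = \<epsilon>\<^sup>2 / (80 * C * real r)"
  have \<eta>: "\<eta> > 0" using e2 C r0 by (simp add: \<eta>_def)
  have r\<eta>: "real r * \<eta> = \<epsilon>\<^sup>2 / (80 * C)" using r0 by (simp add: \<eta>_def)
  define t where "t = tail_sum K \<beta>s r + real r * \<eta>"
  have Ct: "C * t \<le> \<epsilon>\<^sup>2 / 40"
    unfolding t_def distrib_left r\<eta> using c_Delta C by simp
  let ?B = "sup_ch1_inv K V r" and ?Bb = "sup_ch1 K V r" and ?S = "(M + 1 / (80 * C))\<^sup>2"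
  have pd: "pos_def_mat (card \<gamma>) (V \<gamma>)" by (rule V_pos_def[OF \<gamma>'(1)])
  have Bb: "?Bb > 0" using ch1_pos[OF pd] ch1_le_sup(1)[OF \<gamma>] r_range \<gamma>'(2) by simp
  have B: "?B \<ge> 0"
  proof -
    have "0 < inv_mat (V \<gamma>) $$ (0, 0)" using pos_def_form_diag[OF inv_mat_props(7)[OF pd], of 0] r_range \<gamma>'(2) by simp
    also have "\<dots> \<le> ch1 (inv_mat (V \<gamma>))" using diag_le_ch1[OF inv_mat_props(1,4)[OF pd], of 0] r_range \<gamma>'(2) by simp
    also have "\<dots> \<le> ?B" by (rule ch1_le_sup(2)[OF \<gamma>])
    finally show ?thesis by simp
  qed
  have M0: "M \<ge> 0" using \<beta>s_le order_trans[OF sum_nonneg \<beta>s_le] by simp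
  define w0 where "w0 = exp (- ?B * ?S / 2) / sqrt ((2 * pi * ?Bb) ^ r) * (2 * \<eta>) ^ r"
  define \<pi>0 where "\<pi>0 = exp (- (real r * ln (real K)) - real r)"
  have w0: "w0 > 0" using Bb \<eta> by (simp add: w0_def)
  have box: "ennreal w0 \<le> emeasure (N \<gamma>) (\<Pi>\<^sub>E j\<in>\<gamma>. {\<beta>s j - \<eta>..\<beta>s j + \<eta>})"
    unfolding w0_def \<gamma>'(2)[symmetric]
  proof (rule coef_prior_box[OF fin pd])
    show "ch1 (inv_mat (V \<gamma>)) \<le> sup_ch1_inv K V (card \<gamma>)" "ch1 (V \<gamma>) \<le> sup_ch1 K V (card \<gamma>)"
      unfolding \<gamma>'(2) by (rule ch1_le_sup[OF \<gamma>])+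
    show "0 \<le> sup_ch1_inv K V (card \<gamma>)" unfolding \<gamma>'(2) by (rule B)
    show "(\<Sum>j\<in>\<gamma>. (\<beta> j)\<^sup>2) \<le> ?S" if \<beta>: "\<And>j. j \<in> \<gamma> \<Longrightarrow> \<bar>\<beta> j - \<beta>s j\<bar> \<le> \<eta>" for \<beta>
    proof -
      have "(\<Sum>j\<in>\<gamma>. \<bar>\<beta> j\<bar>) \<le> (\<Sum>j\<in>\<gamma>. \<bar>\<beta>s j\<bar> + \<eta>)"
      proof (rule sum_mono)
        fix j assume "j \<in> \<gamma>"
        then show "\<bar>\<beta> j\<bar> \<le> \<bar>\<beta>s j\<bar> + \<eta>" using \<beta>[of j] by linarith
      qed
      also have "\<dots> = (\<Sum>j\<in>\<gamma>. \<bar>\<beta>s j\<bar>) + real r * \<eta>" using \<gamma>'(2) by (simp add: sum.distrib)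
      also have "(\<Sum>j\<in>\<gamma>. \<bar>\<beta>s j\<bar>) \<le> (\<Sum>j<K. \<bar>\<beta>s j\<bar>)" using \<gamma>'(1) by (intro sum_mono2) auto
      also have "\<dots> \<le> M" by (rule \<beta>s_le)
      also have "real r * \<eta> \<le> 1 / (80 * C)" unfolding r\<eta> using e2 C by (intro divide_right_mono) auto
      finally have s: "(\<Sum>j\<in>\<gamma>. \<bar>\<beta> j\<bar>) \<le> M + 1 / (80 * C)" by simp
      have "(\<Sum>j\<in>\<gamma>. (\<beta> j)\<^sup>2) = (\<Sum>j\<in>\<gamma>. \<bar>\<beta> j\<bar> * \<bar>\<beta> j\<bar>)" by (simp add: power2_eq_square)
      also have "\<dots> \<le> (\<Sum>j\<in>\<gamma>. \<bar>\<beta> j\<bar> * (\<Sum>j\<in>\<gamma>. \<bar>\<beta> j\<bar>))"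
        using fin by (intro sum_mono mult_left_mono member_le_sum) auto
      also have "\<dots> = (\<Sum>j\<in>\<gamma>. \<bar>\<beta> j\<bar>)\<^sup>2" by (simp add: sum_distrib_right[symmetric] power2_eq_square)
      also have "\<dots> \<le> ?S" using s by (intro power_mono sum_nonneg) auto
      finally show ?thesis .
    qed
  qed (use \<eta> ne in auto)
  have prior: "\<pi>0 \<le> \<pi>\<^sub>K \<gamma>"
    unfolding \<pi>0_def using r_range \<gamma>' by (intro model_prior_lower) auto
  have "(\<integral>\<^sup>+D. 1 / J n D UNIV \<partial>Q n) \<le> ennreal (exp (C * t) ^ n / (\<pi>0 * w0))"
  proof (rule expected_inverse_marginal[OF \<gamma>' C chi])
    show "(\<Sum>j\<in>{..<K} - \<gamma>. \<bar>\<beta>s j\<bar>) + real r * \<eta> \<le> t" by (simp add: t_def tl)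
    show "C * t \<le> 1" using Ct e2 by simp
  qed (use \<eta> w0 box prior in \<open>auto simp: \<pi>0_def\<close>)
  also have "\<dots> \<le> ennreal (exp (N0 / 20))"
  proof (rule ennreal_leI)
    have 1: "exp (C * t) ^ n \<le> exp (N0 / 40)"
    proof -
      have "real n * (C * t) \<le> real n * (\<epsilon>\<^sup>2 / 40)" using Ct by (intro mult_left_mono) auto
      then show ?thesis by (simp add: exp_of_nat_mult[symmetric] N0_def)
    qed
    have l\<eta>: "ln (2 * \<eta>) = - (ln (40 * C) + ln (real r) + ln (1 / \<epsilon>\<^sup>2))"
    proof -
      have "2 * \<eta> = 1 / (40 * C * real r * (1 / \<epsilon>\<^sup>2))" by (simp add: \<eta>_def)
      then have "ln (2 * \<eta>) = - ln (40 * C * real r * (1 / \<epsilon>\<^sup>2))" using C r0 e2 by (simp add: ln_div)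
      also have "ln (40 * C * real r * (1 / \<epsilon>\<^sup>2)) = ln (40 * C) + ln (real r) + ln (1 / \<epsilon>\<^sup>2)"
        using C r0 e2 by (subst ln_mult, simp, simp, subst ln_mult) auto
      finally show ?thesis .
    qed
    have lw: "ln w0 = - ?B * ?S / 2 - real r / 2 * (ln (2 * pi) + ln ?Bb) + real r * ln (2 * \<eta>)"
    proof -
      have "ln w0 = ln (exp (- ?B * ?S / 2)) - ln (sqrt ((2 * pi * ?Bb) ^ r)) + ln ((2 * \<eta>) ^ r)"
        unfolding w0_def using Bb \<eta> by (simp add: ln_mult ln_div)
      also have "ln (sqrt ((2 * pi * ?Bb) ^ r)) = real r / 2 * (ln (2 * pi) + ln ?Bb)"
        using Bb by (simp add: ln_sqrt ln_realpow ln_mult)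
      also have "ln ((2 * \<eta>) ^ r) = real r * ln (2 * \<eta>)" by (rule ln_realpow)
      finally show ?thesis by simp
    qed
    define LK where "LK = real r * ln (real K)"
    have lnK0: "ln (real K) \<ge> 0" using lnK by simp
    have LK: "LK \<le> N0 / 400"
    proof -
      have "LK \<le> real rbar * ln (real K)" unfolding LK_def using r_range lnK0 by (intro mult_right_mono) auto
      then show ?thesis using c_K by simp
    qed
    have lr: "real r * ln (real r) \<le> LK" unfolding LK_def using r_range r0 by (intro mult_left_mono) auto
    have leps0: "ln (1 / \<epsilon>\<^sup>2) \<ge> 0" using e2 by simp
    have le: "real r * ln (1 / \<epsilon>\<^sup>2) \<le> N0 / 400"
    proof -
      have "real r * ln (1 / \<epsilon>\<^sup>2) \<le> real rbar * ln (1 / \<epsilon>\<^sup>2)" using r_range leps0 by (intro mult_right_mono) auto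
      then show ?thesis using c_eps by simp
    qed
    have lc: "real r * (1 + ln (2 * pi) / 2 + ln (40 * C)) \<le> LK"
      unfolding LK_def using lnK r0 by (intro mult_left_mono) linarith+
    have Npos: "N0 \<ge> 0" by (simp add: N0_def)
    have "- ln (\<pi>0 * w0) = LK + real r + ?B * ?S / 2 + real r / 2 * (ln (2 * pi) + ln ?Bb) + real r * (ln (40 * C) + ln (real r) + ln (1 / \<epsilon>\<^sup>2))"
    proof -
      have "ln (\<pi>0 * w0) = ln \<pi>0 + ln w0" using w0 by (subst ln_mult) (auto simp: \<pi>0_def)
      moreover have "ln \<pi>0 = - LK - real r" by (simp add: \<pi>0_def LK_def)
      ultimately show ?thesis unfolding lw l\<eta> by (simp add: right_diff_distrib distrib_left)
    qed
    also have "\<dots> = LK + real r * (1 + ln (2 * pi) / 2 + ln (40 * C)) + ?B * ?S / 2 + (real r * ln ?Bb) / 2 + real r * ln (real r) + real r * ln (1 / \<epsilon>\<^sup>2)"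
      by (simp add: field_simps)
    also have "\<dots> \<le> N0 / 400 + N0 / 400 + N0 / 400 + N0 / 400 + N0 / 400 + N0 / 400"
    proof -
      have "?B * ?S / 2 \<le> N0 / 400" using c_B Npos by simp
      moreover have "(real r * ln ?Bb) / 2 \<le> N0 / 400" using c_Bbar Npos by simp
      ultimately show ?thesis using LK lr lc le by linarith
    qed
    also have "\<dots> \<le> N0 / 40" using Npos by simp
    finally have "- ln (\<pi>0 * w0) \<le> N0 / 40" .
    moreover have p0: "\<pi>0 * w0 > 0" using w0 by (simp add: \<pi>0_def)
    ultimately have 2: "1 / (\<pi>0 * w0) \<le> exp (N0 / 40)"
      by (metis exp_le_cancel_iff exp_ln exp_minus inverse_eq_divide)
    have "exp (C * t) ^ n / (\<pi>0 * w0) = exp (C * t) ^ n * (1 / (\<pi>0 * w0))" by simp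
    also have "\<dots> \<le> exp (N0 / 40) * exp (N0 / 40)" using 1 2 p0 by (intro mult_mono) auto
    also have "\<dots> = exp (N0 / 20)" by (simp add: exp_add[symmetric])
    finally show "exp (C * t) ^ n / (\<pi>0 * w0) \<le> exp (N0 / 20)" .
  qed
  finally show ?thesis .
qed

text \<open>The threshold for the evidence is \<open>exp (- 3 n \<epsilon>\<^sup>2 / 40)\<close>. It beats \<open>exp (n \<epsilon>\<^sup>2 / 20)\<close> in the first summand, and
its inverse and inverse root are beaten by the tail \<open>exp (- n \<epsilon>\<^sup>2 / 2)\<close> and the decay \<open>exp (- n \<epsilon>\<^sup>2 / 8)\<close>.\<close>

lemma expected_posterior_rate:
  fixes \<epsilon> :: real and n :: nat
  defines "N0 \<equiv> real n * \<epsilon>\<^sup>2" and "A \<equiv> {(\<gamma>, \<beta>). hell \<gamma> \<beta> > \<epsilon>}"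
  assumes \<epsilon>: "0 < \<epsilon>" "\<epsilon> \<le> 1"
    and ev: "(\<integral>\<^sup>+D. 1 / J n D UNIV \<partial>Q n) \<le> ennreal (exp (N0 / 20))"
    and lnK: "3 \<le> ln (real K)"
    and c_eps: "real rbar * ln (1 / \<epsilon>\<^sup>2) \<le> N0 / 400"
    and c_K: "real rbar * ln (real K) \<le> N0 / 400"
    and c_D: "real rbar * ln (growth_D a b (real rbar * sqrt (N0 * sup_ch1_upto K V rbar))) \<le> N0 / 400"
    and large: "N0 \<ge> 160"
  shows "(\<integral>\<^sup>+D. J n D A / J n D UNIV \<partial>Q n) \<le> ennreal (exp (- (1 / 80) * N0))"
proof -
  have e2: "0 < \<epsilon>\<^sup>2" "\<epsilon>\<^sup>2 \<le> 1" using \<epsilon> by (auto simp: power_le_one)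
  have rb: "real rbar \<ge> 1" using r_range by simp
  have K0: "real K \<ge> 2" using r_range by simp
  let ?Bt = "sup_ch1_upto K V rbar"
  define Cn where "Cn = sqrt (N0 * ?Bt)"
  have Cn: "Cn > 0" using large sup_ch1_upto_pos by (simp add: Cn_def)
  define R where "R = real rbar * Cn"
  have R: "R > 0" using rb Cn by (simp add: R_def)
  define G where "G = growth_D a b R"
  have G: "G = 1 + R * lip R" unfolding G_def by (rule growth_D_lip)
  have G1: "G \<ge> 1" using R lip_nonneg[of R] by (simp add: G)
  \<comment> \<open>With \<open>R = rbar * Cn\<close>, this width makes \<open>lip R * rbar * w \<le> \<epsilon>\<^sup>2 / 4\<close>, as \<open>R * lip R \<le> G\<close>.\<close>
  define w where "w = Cn * \<epsilon>\<^sup>2 / (4 * G)"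
  have w: "w > 0" using Cn e2 G1 by (simp add: w_def)
  define m where "m = nat \<lceil>Cn / w\<rceil>"
  have Cw: "Cn / w = 4 * G / \<epsilon>\<^sup>2" using Cn e2 G1 by (simp add: w_def)
  have m1: "Cn \<le> real m * w"
  proof -
    have "Cn / w \<le> real m" using Cn w unfolding m_def by linarith
    then show ?thesis using w by (simp add: pos_divide_le_eq)
  qed
  have Ge: "1 \<le> G / \<epsilon>\<^sup>2" using G1 e2 by (simp add: le_divide_eq)
  have m2: "real (2 * m + 1) \<le> exp (3 + ln G + ln (1 / \<epsilon>\<^sup>2))"
  proof -
    have "0 \<le> Cn / w" using Cn w by simp
    then have "real m \<le> Cn / w + 1" unfolding m_def by linarith
    then have "real m \<le> 4 * (G / \<epsilon>\<^sup>2) + 1" unfolding Cw by simp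
    then have "real (2 * m + 1) \<le> 11 * (G / \<epsilon>\<^sup>2)" using Ge by simp
    also have "\<dots> \<le> exp 3 * (G / \<epsilon>\<^sup>2)"
    proof -
      \<comment> \<open>There are at most \<open>2 m + 1 \<le> 8 G / \<epsilon>\<^sup>2 + 3\<close> cells per coordinate, and \<open>11 \<le> e\<^sup>3\<close>.\<close>
      have "(5 / 2 :: real) ^ 3 \<le> exp 1 ^ 3"
      proof (rule power_mono)
        have "1 + 1 + (1::real)\<^sup>2 / 2 \<le> exp 1" by (rule exp_lower_Taylor_quadratic) simp
        then show "5 / 2 \<le> exp (1::real)" by simp
      qed simp
      moreover have "exp 1 ^ 3 = exp (3::real)" by (simp add: exp_of_nat_mult[symmetric])
      ultimately have "(11::real) \<le> exp 3" by (simp add: power3_eq_cube)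
      then show ?thesis using Ge by (intro mult_right_mono) auto
    qed
    also have "\<dots> = exp (3 + ln G + ln (1 / \<epsilon>\<^sup>2))" using G1 e2 by (simp add: exp_add)
    finally show ?thesis .
  qed
  have fine: "lip (real rbar * Cn) * (real rbar * w) \<le> \<epsilon>\<^sup>2 / 4"
  proof -
    have "lip R * (real rbar * w) = (R * lip R) / G * (\<epsilon>\<^sup>2 / 4)" by (simp add: w_def R_def mult_ac)
    also have "\<dots> \<le> 1 * (\<epsilon>\<^sup>2 / 4)" using G G1 e2 by (intro mult_right_mono) (auto simp: divide_le_eq)
    finally show ?thesis by (simp add: R_def)
  qed
  let ?T2 = "real rbar * (2 * exp (- Cn\<^sup>2 / (2 * ?Bt)))"
  let ?T3 = "real ((K + 1) ^ rbar * (2 * m + 1) ^ rbar) * (1 - \<epsilon>\<^sup>2 / 8) ^ n"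
  have "(\<integral>\<^sup>+D. J n D A / J n D UNIV \<partial>Q n) \<le> ennreal (exp (- 3 / 40 * N0) * exp (N0 / 20) + 1 / exp (- 3 / 40 * N0) * ?T2 + 1 / sqrt (exp (- 3 / 40 * N0)) * ?T3)"
    unfolding A_def using ch1_le_sup_upto
    by (intro expected_posterior[OF \<epsilon> _ ev _ Cn w m1 _ fine]) auto
  also have "\<dots> \<le> ennreal (exp (- (1 / 80) * N0))"
  proof (rule ennreal_leI)
    have i1: "exp (- 3 / 40 * N0) * exp (N0 / 20) = exp (- N0 / 40)"
      by (simp add: exp_add[symmetric])
    have "?T2 \<le> exp (N0 / 400) * (2 * exp (- N0 / 2))"
    proof (rule mult_mono)
      have "real rbar \<le> exp (ln (real K))" using r_range by simp
      also have "ln (real K) \<le> real rbar * ln (real K)" using rb lnK mult_right_mono[of 1 "real rbar" "ln (real K)"] by simp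
      finally show "real rbar \<le> exp (N0 / 400)" using c_K by (simp add: order_trans)
      have "Cn\<^sup>2 / (2 * ?Bt) = N0 / 2" using large sup_ch1_upto_pos by (simp add: Cn_def)
      then show "2 * exp (- Cn\<^sup>2 / (2 * ?Bt)) \<le> 2 * exp (- N0 / 2)" by simp
    qed auto
    then have "1 / exp (- 3 / 40 * N0) * ?T2 \<le> exp (3 / 40 * N0) * (exp (N0 / 400) * (2 * exp (- N0 / 2)))"
      by (simp add: exp_minus inverse_eq_divide[symmetric])
    also have "\<dots> = 2 * exp (3 / 40 * N0 + (N0 / 400 + - N0 / 2))" by (simp only: exp_add mult.left_commute mult_ac)
    also have "\<dots> \<le> 2 * exp (- N0 / 40)" using large by simp
    finally have i2: "1 / exp (- 3 / 40 * N0) * ?T2 \<le> 2 * exp (- N0 / 40)" .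
    have t3: "?T3 \<le> exp (5 * N0 / 400) * exp (- N0 / 8)"
    proof (rule mult_mono)
      have "real (K + 1) \<le> (real K)\<^sup>2"
      proof -
        have "2 * real K \<le> real K * real K" using K0 by (intro mult_right_mono) auto
        moreover have "real (K + 1) = real K + 1" by simp
        ultimately show ?thesis using K0 unfolding power2_eq_square by linarith
      qed
      also have "\<dots> = exp (2 * ln (real K))" using K0 by (simp add: exp_double)
      finally have k1: "real (K + 1) ^ rbar \<le> exp (2 * ln (real K)) ^ rbar" by (intro power_mono) auto
      have k2: "real (2 * m + 1) ^ rbar \<le> exp (3 + ln G + ln (1 / \<epsilon>\<^sup>2)) ^ rbar" using m2 by (intro power_mono) auto
      have "real ((K + 1) ^ rbar * (2 * m + 1) ^ rbar) = real (K + 1) ^ rbar * real (2 * m + 1) ^ rbar"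
        by (simp only: of_nat_mult of_nat_power)
      also have "\<dots> \<le> exp (2 * ln (real K)) ^ rbar * exp (3 + ln G + ln (1 / \<epsilon>\<^sup>2)) ^ rbar"
        using k1 k2 by (intro mult_mono) auto
      also have "\<dots> = exp (real rbar * (2 * ln (real K)) + real rbar * (3 + ln G + ln (1 / \<epsilon>\<^sup>2)))"
        by (simp only: exp_of_nat_mult exp_add)
      also have "\<dots> \<le> exp (5 * N0 / 400)"
      proof -
        have "real rbar * 3 \<le> real rbar * ln (real K)" using lnK by (intro mult_left_mono) auto
        moreover have "real rbar * ln G \<le> N0 / 400" using c_D unfolding G_def R_def Cn_def .
        ultimately show ?thesis using c_K c_eps by (simp add: distrib_left)
      qed
      finally show "real ((K + 1) ^ rbar * (2 * m + 1) ^ rbar) \<le> exp (5 * N0 / 400)" .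
      have "1 - \<epsilon>\<^sup>2 / 8 \<le> exp (- \<epsilon>\<^sup>2 / 8)" using exp_ge_add_one_self[of "- \<epsilon>\<^sup>2 / 8"] by simp
      then have "(1 - \<epsilon>\<^sup>2 / 8) ^ n \<le> exp (- \<epsilon>\<^sup>2 / 8) ^ n" using e2 by (intro power_mono) auto
      also have "\<dots> = exp (- N0 / 8)" by (simp add: exp_of_nat_mult[symmetric] N0_def)
      finally show "(1 - \<epsilon>\<^sup>2 / 8) ^ n \<le> exp (- N0 / 8)" .
      show "0 \<le> (1 - \<epsilon>\<^sup>2 / 8) ^ n" using e2 by (intro zero_le_power) simp
    qed auto
    have sq: "sqrt (exp (- 3 / 40 * N0)) = exp (- 3 / 80 * N0)"
      by (rule real_sqrt_unique) (simp_all add: exp_double[symmetric])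
    have "1 / sqrt (exp (- 3 / 40 * N0)) * ?T3 \<le> exp (3 / 80 * N0) * (exp (5 * N0 / 400) * exp (- N0 / 8))"
      unfolding sq using t3 by (simp add: exp_minus inverse_eq_divide[symmetric])
    also have "\<dots> = exp (3 / 80 * N0 + (5 * N0 / 400 + - N0 / 8))" by (simp only: exp_add)
    also have "\<dots> \<le> exp (- N0 / 40)" using large by simp
    finally have i3: "1 / sqrt (exp (- 3 / 40 * N0)) * ?T3 \<le> exp (- N0 / 40)" .
    have "exp (- 3 / 40 * N0) * exp (N0 / 20) + 1 / exp (- 3 / 40 * N0) * ?T2 + 1 / sqrt (exp (- 3 / 40 * N0)) * ?T3
      \<le> exp (- N0 / 40) + 2 * exp (- N0 / 40) + exp (- N0 / 40)"
      unfolding i1 using i2 i3 by (intro add_mono) auto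
    also have "\<dots> = 4 * exp (- N0 / 40)" by simp
    also have "\<dots> \<le> exp 2 * exp (- N0 / 40)"
    proof -
      have "(2::real) * 2 \<le> exp 1 * exp 1" by (intro mult_mono) (use exp_ge_add_one_self[of 1] in auto)
      then have "(4::real) \<le> exp 2" by (simp add: exp_add[symmetric])
      then show ?thesis by simp
    qed
    also have "\<dots> = exp (2 + - N0 / 40)" by (simp only: exp_add)
    also have "\<dots> \<le> exp (- (1 / 80) * N0)" using large by simp
    finally show "exp (- 3 / 40 * N0) * exp (N0 / 20) + 1 / exp (- 3 / 40 * N0) * ?T2 + 1 / sqrt (exp (- 3 / 40 * N0)) * ?T3 \<le> exp (- (1 / 80) * N0)" .
  qed
  finally show ?thesis .
qed

text \<open>Markov's inequality, and the passage from \<open>{d > \<epsilon>}\<close> to its complement. The latter needs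
the evidence to be positive and finite, which holds almost surely because \<open>1 / Z\<close> and \<open>Z\<close> have finite
expectation.\<close>

lemma posterior_conclusions:
  fixes \<epsilon> :: real and n :: nat
  defines "A \<equiv> {(\<gamma>, \<beta>). hell \<gamma> \<beta> > \<epsilon>}"
    and "A' \<equiv> {(\<gamma>, \<beta>). hell \<gamma> \<beta> \<le> \<epsilon>}"
    and "post \<equiv> posterior f K r rbar V n"
  assumes ev: "(\<integral>\<^sup>+D. 1 / J n D UNIV \<partial>Q n) \<le> ennreal E"
    and ep: "(\<integral>\<^sup>+D. J n D A / J n D UNIV \<partial>Q n) \<le> ennreal q" and q: "q \<ge> 0" and s: "s > 0"
  shows "(\<integral>D. post D A \<partial>Q n) \<le> q"
    and "measure (Q n) {D \<in> space (Q n). post D A \<ge> s} \<le> q / s"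
    and "1 - q / s \<le> measure (Q n) {D \<in> space (Q n). post D A' \<ge> 1 - s}"
    and "measure (Q n) {D \<in> space (Q n). post D A' \<ge> 1 - s} \<le> 1"
proof -
  interpret Q: prob_space "Q n" by (intro prob_space_PiM prob_space_P)
  have ev_meas: "model_event A" "model_event A'"
    unfolding A_def A'_def by (rule model_event_hellinger)+
  note [measurable] = J_meas[OF ev_meas(1), of n] J_meas[OF ev_meas(2), of n] J_meas[OF model_event_UNIV, of n]
  have post: "post D A = enn2real (J n D A / J n D UNIV)" "post D A' = enn2real (J n D A' / J n D UNIV)"
    if "D \<in> space (Q n)" for D
    unfolding post_def using posterior_eq ev_meas that by blast+
  have [measurable]: "(\<lambda>D. post D A) \<in> borel_measurable (Q n)" "(\<lambda>D. post D A') \<in> borel_measurable (Q n)"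
  proof -
    have "(\<lambda>D. enn2real (J n D A / J n D UNIV)) \<in> borel_measurable (Q n)" "(\<lambda>D. enn2real (J n D A' / J n D UNIV)) \<in> borel_measurable (Q n)"
      by measurable
    then show "(\<lambda>D. post D A) \<in> borel_measurable (Q n)" "(\<lambda>D. post D A') \<in> borel_measurable (Q n)"
      by (simp_all add: post cong: measurable_cong)
  qed
  have pos: "0 \<le> post D S" for D S unfolding post_def posterior_def by simp
  have le: "ennreal (post D A) \<le> J n D A / J n D UNIV" if "D \<in> space (Q n)" for D
    unfolding post(1)[OF that] by (cases "J n D A / J n D UNIV") auto
  have int: "(\<integral>\<^sup>+D. ennreal (post D A) \<partial>Q n) \<le> ennreal q"
    using order_trans[OF nn_integral_mono[OF le] ep] by simp
  have "(\<integral>D. post D A \<partial>Q n) = enn2real (\<integral>\<^sup>+D. ennreal (post D A) \<partial>Q n)"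
    by (rule integral_eq_nn_integral) (auto simp: pos)
  also have "\<dots> \<le> enn2real (ennreal q)" by (intro enn2real_mono int) auto
  finally show "(\<integral>D. post D A \<partial>Q n) \<le> q" using q by simp
  have "emeasure (Q n) {D \<in> space (Q n). post D A \<ge> s} \<le> emeasure (Q n) {D \<in> space (Q n). 1 \<le> ennreal (1 / s) * ennreal (post D A)}"
  proof (rule emeasure_mono)
    show "{D \<in> space (Q n). post D A \<ge> s} \<subseteq> {D \<in> space (Q n). 1 \<le> ennreal (1 / s) * ennreal (post D A)}"
      using s pos by (auto simp: ennreal_mult[symmetric])
  qed measurable
  also have "\<dots> \<le> ennreal (1 / s) * (\<integral>\<^sup>+D. ennreal (post D A) * indicator (space (Q n)) D \<partial>Q n)"
    by (rule nn_integral_Markov_inequality) measurable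
  also have "(\<integral>\<^sup>+D. ennreal (post D A) * indicator (space (Q n)) D \<partial>Q n) = (\<integral>\<^sup>+D. ennreal (post D A) \<partial>Q n)"
    by (intro nn_integral_cong) simp
  also have "ennreal (1 / s) * \<dots> \<le> ennreal (1 / s) * ennreal q" using int by (rule mult_left_mono) simp
  also have "\<dots> = ennreal (q / s)" using s q by (simp add: ennreal_mult[symmetric])
  finally show markov: "measure (Q n) {D \<in> space (Q n). post D A \<ge> s} \<le> q / s"
    using s q by (simp add: Q.emeasure_eq_measure)
  have "AE D in Q n. J n D UNIV \<noteq> \<infinity>"
  proof (rule nn_integral_PInf_AE)
    have "(\<integral>\<^sup>+D. J n D UNIV \<partial>Q n) \<le> (\<Sum>\<gamma>\<in>Pow {..<K}. ennreal (\<pi>\<^sub>K \<gamma>) * emeasure (N \<gamma>) {\<beta> \<in> space (N \<gamma>). (\<gamma>, \<beta>) \<in> UNIV})"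
      by (rule expected_J[OF model_event_UNIV])
    also have "\<dots> \<le> ennreal 1"
      by (rule sum_prior_le) (simp_all add: prob_space.emeasure_le_1[OF N_prob])
    finally show "(\<integral>\<^sup>+D. J n D UNIV \<partial>Q n) \<noteq> \<infinity>" by (auto simp: top_unique)
  qed measurable
  moreover have "AE D in Q n. 1 / J n D UNIV \<noteq> \<infinity>"
  proof (rule nn_integral_PInf_AE)
    show "(\<integral>\<^sup>+D. 1 / J n D UNIV \<partial>Q n) \<noteq> \<infinity>" using ev by (auto simp: top_unique)
  qed measurable
  ultimately have "AE D in Q n. \<not> post D A \<ge> s \<longrightarrow> post D A' \<ge> 1 - s"
    using AE_space
  proof eventually_elim
    fix D assume fin: "J n D UNIV \<noteq> \<infinity>" and nz: "1 / J n D UNIV \<noteq> \<infinity>" and D: "D \<in> space (Q n)"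
    have "J n D UNIV \<noteq> 0" using nz by (auto simp: divide_ennreal_def)
    then obtain z where z: "z > 0" "J n D UNIV = ennreal z"
      using fin by (cases "J n D UNIV") (auto simp: less_le)
    have "A \<union> A' = UNIV" "A \<inter> A' = {}" by (auto simp: A_def A'_def)
    then have sum: "J n D A + J n D A' = ennreal z" using J_add[OF ev_meas _ D] z by simp
    then obtain x where x: "x \<ge> 0" "J n D A = ennreal x" by (cases "J n D A") auto
    obtain y where y: "y \<ge> 0" "J n D A' = ennreal y" using sum by (cases "J n D A'") auto
    have "x + y = z" using sum x y z by (simp add: ennreal_plus[symmetric] del: ennreal_plus)
    then have "post D A + post D A' = 1"
      unfolding post[OF D] using x y z by (simp add: divide_ennreal add_divide_distrib[symmetric])
    then show "\<not> post D A \<ge> s \<longrightarrow> post D A' \<ge> 1 - s" by simp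
  qed
  then have "Q.prob {D \<in> space (Q n). \<not> post D A \<ge> s} \<le> Q.prob {D \<in> space (Q n). post D A' \<ge> 1 - s}"
    by (intro Q.finite_measure_mono_AE) auto
  moreover have "Q.prob {D \<in> space (Q n). \<not> post D A \<ge> s} = 1 - Q.prob {D \<in> space (Q n). post D A \<ge> s}"
    by (rule Q.prob_neg) measurable
  ultimately show "1 - q / s \<le> measure (Q n) {D \<in> space (Q n). post D A' \<ge> 1 - s}" using markov by simp
  show "measure (Q n) {D \<in> space (Q n). post D A' \<ge> 1 - s} \<le> 1" by (rule Q.prob_le_1)
qed

end

context glm_model
begin

text \<open>The rate conditions enter as inequalities with explicit constants at a single sample size, so that the
asymptotic statement only has to check that each of them holds eventually.\<close>

lemma finite_sample_rate:
  fixes \<epsilon> :: real and n :: nat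
  defines "N0 \<equiv> real n * \<epsilon>\<^sup>2" and "post \<equiv> posterior f K r rbar V n" and "Pn \<equiv> data_law \<nu>x \<nu>y pst n"
    and "dH \<equiv> (\<lambda>(\<gamma>, \<beta>). hell \<gamma> \<beta>)"
  assumes \<epsilon>: "0 < \<epsilon>" "\<epsilon> \<le> 1" and C: "C > 0"
    and chi: "\<And>u h. \<bar>u\<bar> \<le> M \<Longrightarrow> C * \<bar>h - u\<bar> \<le> 1 \<Longrightarrow>
      (\<integral>\<^sup>+y. ennreal (f y u * (f y u / f y h)) \<partial>\<nu>y) \<le> ennreal (exp (C * \<bar>h - u\<bar>))"
    and lnK: "3 + \<bar>ln (40 * C)\<bar> + \<bar>ln (2 * pi)\<bar> \<le> ln (real K)"
    and c_eps: "real rbar * ln (1 / \<epsilon>\<^sup>2) \<le> N0 / 400"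
    and c_K: "real rbar * ln (real K) \<le> N0 / 400"
    and c_D: "real rbar * ln (growth_D a b (real rbar * sqrt (N0 * sup_ch1_upto K V rbar))) \<le> N0 / 400"
    and c_B: "sup_ch1_inv K V r * (M + 1 / (80 * C))\<^sup>2 \<le> N0 / 400"
    and c_Bbar: "real r * ln (sup_ch1 K V r) \<le> N0 / 400"
    and c_Delta: "C * tail_sum K \<beta>s r \<le> \<epsilon>\<^sup>2 / 80"
    and large: "N0 \<ge> 160"
  shows "(\<integral>D. post D {\<theta>. dH \<theta> > \<epsilon>} \<partial>Pn) \<le> exp (- (1 / 80) * N0)"
    and "measure Pn {D \<in> space Pn. post D {\<theta>. dH \<theta> > \<epsilon>} \<ge> exp (- (1 / 160) * N0)} \<le> exp (- (1 / 160) * N0)"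
    and "1 - exp (- (1 / 160) * N0) \<le> measure Pn {D \<in> space Pn. post D {\<theta>. dH \<theta> \<le> \<epsilon>} \<ge> 1 - exp (- (1 / 160) * N0)}"
    and "measure Pn {D \<in> space Pn. post D {\<theta>. dH \<theta> \<le> \<epsilon>} \<ge> 1 - exp (- (1 / 160) * N0)} \<le> 1"
proof -
  have ev: "(\<integral>\<^sup>+D. 1 / J n D UNIV \<partial>Q n) \<le> ennreal (exp (N0 / 20))"
    unfolding N0_def using assms(5-) unfolding N0_def by (intro expected_inverse_marginal_rate[OF \<epsilon> C chi]) auto
  have ep: "(\<integral>\<^sup>+D. J n D {(\<gamma>, \<beta>). hell \<gamma> \<beta> > \<epsilon>} / J n D UNIV \<partial>Q n) \<le> ennreal (exp (- (1 / 80) * N0))"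
    unfolding N0_def
    by (rule expected_posterior_rate[OF \<epsilon>])
      (use ev lnK c_eps c_K c_D large in \<open>auto simp: N0_def\<close>)
  have s: "{\<theta>. dH \<theta> > \<epsilon>} = {(\<gamma>, \<beta>). hell \<gamma> \<beta> > \<epsilon>}"
    "{\<theta>. dH \<theta> \<le> \<epsilon>} = {(\<gamma>, \<beta>). hell \<gamma> \<beta> \<le> \<epsilon>}"
    by (auto simp: dH_def)
  have qs: "exp (- (1 / 80) * N0) / exp (- (1 / 160) * N0) = exp (- (1 / 160) * N0)"
    by (simp add: exp_diff[symmetric])
  note concl = posterior_conclusions[OF ev ep exp_ge_zero exp_gt_zero[of "- (1 / 160) * N0"], unfolded qs]
  show "(\<integral>D. post D {\<theta>. dH \<theta> > \<epsilon>} \<partial>Pn) \<le> exp (- (1 / 80) * N0)"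
    and "measure Pn {D \<in> space Pn. post D {\<theta>. dH \<theta> > \<epsilon>} \<ge> exp (- (1 / 160) * N0)} \<le> exp (- (1 / 160) * N0)"
    and "1 - exp (- (1 / 160) * N0) \<le> measure Pn {D \<in> space Pn. post D {\<theta>. dH \<theta> \<le> \<epsilon>} \<ge> 1 - exp (- (1 / 160) * N0)}"
    and "measure Pn {D \<in> space Pn. post D {\<theta>. dH \<theta> \<le> \<epsilon>} \<ge> 1 - exp (- (1 / 160) * N0)} \<le> 1"
    unfolding s Pn_def data_law_eq post_def by (rule concl)+
qed

end

lemma seq_precD:
  assumes "u \<lless> v" "c > 0" and pos: "\<forall>\<^sub>F n in sequentially. v n > 0"
  shows "\<forall>\<^sub>F n in sequentially. u n \<le> c * v n"
proof -
  have "\<forall>\<^sub>F n in sequentially. u n / v n < c"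
    using assms(1,2) unfolding seq_prec_def by (rule order_tendstoD)
  then show ?thesis using pos
    by eventually_elim (simp add: pos_divide_less_eq)
qed

theorem theorem1:
  fixes a b c :: "real \<Rightarrow> real"
    and \<nu>y :: "real measure"
    and K r rbar :: "nat \<Rightarrow> nat"
    and \<nu>x :: "nat \<Rightarrow> (nat \<Rightarrow> real) measure"
    and \<beta>s :: "nat \<Rightarrow> nat \<Rightarrow> real"
    and V :: "nat \<Rightarrow> nat set \<Rightarrow> real mat"
    and \<epsilon> :: "nat \<Rightarrow> real"
  defines "f \<equiv> glm_density a b c"
    and "pstar \<equiv> (\<lambda>n. model_density (glm_density a b c) {..<K n} (\<beta>s n))"
    and "\<Delta> \<equiv> (\<lambda>n. tail_sum (K n) (\<beta>s n) (r n))"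
    and "B \<equiv> (\<lambda>n. sup_ch1_inv (K n) (V n) (r n))"
    and "Bbar \<equiv> (\<lambda>n. sup_ch1 (K n) (V n) (r n))"
    and "Btilde \<equiv> (\<lambda>n. sup_ch1_upto (K n) (V n) (rbar n))"
    and "rate \<equiv> (\<lambda>n. real n * (\<epsilon> n)\<^sup>2)"
  defines "Pstar \<equiv> (\<lambda>n. data_law (\<nu>x n) \<nu>y (pstar n) n)"
    and "d \<equiv> (\<lambda>n (\<gamma>, \<beta>). hellinger_dist (\<nu>x n) \<nu>y (model_density f \<gamma> \<beta>) (pstar n))"
    and "post \<equiv> (\<lambda>n. posterior f (K n) (r n) (rbar n) (V n) n)"
  assumes a_C1: "a C1_differentiable_on UNIV"
    and b_C1: "b C1_differentiable_on UNIV"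
    and a_deriv: "\<And>h. deriv a h \<noteq> 0"
    and \<nu>y_sets: "sets \<nu>y = sets borel"
    and f_meas: "\<And>h. (\<lambda>y. f y h) \<in> borel_measurable \<nu>y"
    and f_dens: "\<And>h. (\<integral>\<^sup>+y. ennreal (f y h) \<partial>\<nu>y) = 1"
    and \<nu>x_prob: "\<And>n. n \<ge> 1 \<Longrightarrow> prob_space (\<nu>x n)"
    and \<nu>x_sets: "\<And>n. n \<ge> 1 \<Longrightarrow> sets (\<nu>x n) = sets (PiM {..<K n} (\<lambda>_. borel))"
    and x_bounded: "\<And>n. n \<ge> 1 \<Longrightarrow> AE x in \<nu>x n. \<forall>j<K n. \<bar>x j\<bar> \<le> 1"
    and K_mono: "mono_on {1..} K"
    and \<beta>s_summable: "convergent (\<lambda>n. \<Sum>j<K n. \<bar>\<beta>s n j\<bar>)"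
    and V_pos_def: "\<And>n \<gamma>. n \<ge> 1 \<Longrightarrow> \<gamma> \<subseteq> {..<K n} \<Longrightarrow> pos_def_mat (card \<gamma>) (V n \<gamma>)"
    and \<epsilon>_range: "\<And>n. n \<ge> 1 \<Longrightarrow> 0 < \<epsilon> n \<and> \<epsilon> n \<le> 1"
    and rate_large: "(\<lambda>_. 1) \<lless> rate"
    and cond_eps: "(\<lambda>n. real (rbar n) * ln (1 / (\<epsilon> n)\<^sup>2)) \<lless> rate"
    and cond_K: "(\<lambda>n. real (rbar n) * ln (real (K n))) \<lless> rate"
    and cond_D: "(\<lambda>n. real (rbar n) * ln (growth_D a b (real (rbar n) * sqrt (rate n * Btilde n)))) \<lless> rate"
    and r_range: "\<And>n. n \<ge> 1 \<Longrightarrow> 1 \<le> r n \<and> r n \<le> rbar n \<and> rbar n < K n"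
    and r_large: "(\<lambda>_. 1) \<lless> (\<lambda>n. real (r n))"
    and r_small: "(\<lambda>n. real (r n)) \<lless> (\<lambda>n. real (K n))"
    and cond_Delta: "\<Delta> \<lless> (\<lambda>n. (\<epsilon> n)\<^sup>2)"
    and cond_B: "B \<lless> rate"
    and cond_Bbar: "(\<lambda>n. real (r n) * ln (Bbar n)) \<lless> rate"
  shows
    "(\<exists>r0>0. (\<lambda>n. measure (Pstar n)
          {D \<in> space (Pstar n). post n D {\<theta>. d n \<theta> \<le> \<epsilon> n} \<ge> 1 - exp (- r0 * rate n)}) \<longlonglongrightarrow> 1)
     \<and> (\<exists>c1>0. \<forall>\<^sub>F n in sequentially.
          measure (Pstar n)
            {D \<in> space (Pstar n). post n D {\<theta>. d n \<theta> > \<epsilon> n} \<ge> exp (- 0.5 * c1 * rate n)}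
          \<le> exp (- 0.5 * c1 * rate n))
     \<and> (\<exists>c1>0. \<forall>\<^sub>F n in sequentially.
          (\<integral>D. post n D {\<theta>. d n \<theta> > \<epsilon> n} \<partial>Pstar n) \<le> exp (- c1 * rate n))"
proof -
  have glm: "glm a b c \<nu>y"
    using a_C1 b_C1 a_deriv \<nu>y_sets f_meas f_dens unfolding f_def by unfold_locales
  interpret G: glm a b c \<nu>y by (rule glm)
  obtain M where M: "M > 0" "\<And>n. (\<Sum>j<K n. \<bar>\<beta>s n j\<bar>) \<le> M"
  proof -
    obtain B where "B > 0" "\<And>n. norm (\<Sum>j<K n. \<bar>\<beta>s n j\<bar>) \<le> B"
      using BseqE[OF convergent_imp_Bseq[OF \<beta>s_summable]] by metis
    then show ?thesis by (intro that[of B]) (auto simp: abs_le_iff)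
  qed
  have "M \<ge> 0" using M(1) by simp
  from G.chi_square_bound[OF this] obtain C where C: "C > 0"
    and chi: "\<And>u h. \<bar>u\<bar> \<le> M \<Longrightarrow> C * \<bar>h - u\<bar> \<le> 1 \<Longrightarrow>
      (\<integral>\<^sup>+y. ennreal (glm_density a b c y u * (glm_density a b c y u / glm_density a b c y h)) \<partial>\<nu>y) \<le> ennreal (exp (C * \<bar>h - u\<bar>))"
    by blast
  have model: "glm_model a b c \<nu>y (K n) (r n) (rbar n) (\<nu>x n) (\<beta>s n) (V n) M" if "n \<ge> 1" for n
    by (intro glm_model.intro glm glm_model_axioms.intro \<nu>x_prob \<nu>x_sets x_bounded V_pos_def M(2))
      (use that r_range[OF that] in auto)
  have n1: "\<forall>\<^sub>F n::nat in sequentially. n \<ge> 1" by (rule eventually_ge_at_top)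
  then have rate_pos: "\<forall>\<^sub>F n in sequentially. rate n > 0"
  proof eventually_elim
    case (elim n)
    then have "\<epsilon> n > 0" using \<epsilon>_range by simp
    then show ?case using elim by (simp add: rate_def)
  qed
  from n1 have eps_pos: "\<forall>\<^sub>F n in sequentially. (\<epsilon> n)\<^sup>2 > 0"
  proof eventually_elim
    case (elim n)
    then have "\<epsilon> n > 0" using \<epsilon>_range by simp
    then show ?case by simp
  qed
  from n1 have r_pos: "\<forall>\<^sub>F n in sequentially. real (r n) > 0"
    by eventually_elim (use r_range in fastforce)
  \<comment> \<open>\<open>ln K\<close> eventually exceeds this constant, and so absorbs the terms of order \<open>r\<close>.\<close>
  define L where "L = 3 + \<bar>ln (40 * C)\<bar> + \<bar>ln (2 * pi)\<bar>"
  define S where "S = (M + 1 / (80 * C))\<^sup>2"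
  have "0 < M + 1 / (80 * C)" using M(1) C by (intro add_pos_pos) auto
  then have S: "S > 0" unfolding S_def by (rule zero_less_power)
  let ?post = "\<lambda>n. measure (Pstar n) {D \<in> space (Pstar n). post n D {\<theta>. d n \<theta> \<le> \<epsilon> n} \<ge> 1 - exp (- (1 / 160) * rate n)}"
  have bounds:
    "\<forall>\<^sub>F n in sequentially. 1 \<le> 1 / 160 * rate n"
    "\<forall>\<^sub>F n in sequentially. 1 \<le> exp (- L) * real (r n)"
    "\<forall>\<^sub>F n in sequentially. real (rbar n) * ln (1 / (\<epsilon> n)\<^sup>2) \<le> 1 / 400 * rate n"
    "\<forall>\<^sub>F n in sequentially. real (rbar n) * ln (real (K n)) \<le> 1 / 400 * rate n"
    "\<forall>\<^sub>F n in sequentially. real (rbar n) * ln (growth_D a b (real (rbar n) * sqrt (rate n * Btilde n))) \<le> 1 / 400 * rate n"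
    "\<forall>\<^sub>F n in sequentially. B n \<le> 1 / (400 * S) * rate n"
    "\<forall>\<^sub>F n in sequentially. real (r n) * ln (Bbar n) \<le> 1 / 400 * rate n"
    "\<forall>\<^sub>F n in sequentially. \<Delta> n \<le> 1 / (80 * C) * (\<epsilon> n)\<^sup>2"
  proof -
    show "\<forall>\<^sub>F n in sequentially. 1 \<le> 1 / 160 * rate n"
      by (rule seq_precD[OF rate_large _ rate_pos]) (use S C in simp)
    show "\<forall>\<^sub>F n in sequentially. 1 \<le> exp (- L) * real (r n)"
      by (rule seq_precD[OF r_large _ r_pos]) (use S C in simp)
    show "\<forall>\<^sub>F n in sequentially. real (rbar n) * ln (1 / (\<epsilon> n)\<^sup>2) \<le> 1 / 400 * rate n"
      by (rule seq_precD[OF cond_eps _ rate_pos]) (use S C in simp)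
    show "\<forall>\<^sub>F n in sequentially. real (rbar n) * ln (real (K n)) \<le> 1 / 400 * rate n"
      by (rule seq_precD[OF cond_K _ rate_pos]) (use S C in simp)
    show "\<forall>\<^sub>F n in sequentially. real (rbar n) * ln (growth_D a b (real (rbar n) * sqrt (rate n * Btilde n))) \<le> 1 / 400 * rate n"
      by (rule seq_precD[OF cond_D _ rate_pos]) (use S C in simp)
    show "\<forall>\<^sub>F n in sequentially. B n \<le> 1 / (400 * S) * rate n"
      by (rule seq_precD[OF cond_B _ rate_pos]) (use S C in simp)
    show "\<forall>\<^sub>F n in sequentially. real (r n) * ln (Bbar n) \<le> 1 / 400 * rate n"
      by (rule seq_precD[OF cond_Bbar _ rate_pos]) (use S C in simp)
    show "\<forall>\<^sub>F n in sequentially. \<Delta> n \<le> 1 / (80 * C) * (\<epsilon> n)\<^sup>2"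
      by (rule seq_precD[OF cond_Delta _ eps_pos]) (use S C in simp)
  qed
  have main: "\<forall>\<^sub>F n in sequentially.
      (\<integral>D. post n D {\<theta>. d n \<theta> > \<epsilon> n} \<partial>Pstar n) \<le> exp (- (1 / 80) * rate n) \<and>
      measure (Pstar n) {D \<in> space (Pstar n). post n D {\<theta>. d n \<theta> > \<epsilon> n} \<ge> exp (- (1 / 160) * rate n)} \<le> exp (- (1 / 160) * rate n) \<and>
      1 - exp (- (1 / 160) * rate n) \<le> ?post n \<and> ?post n \<le> 1"
    using n1 bounds
  proof eventually_elim
    case (elim n)
    interpret m: glm_model a b c \<nu>y "K n" "r n" "rbar n" "\<nu>x n" "\<beta>s n" "V n" M
      using elim by (intro model) simp
    have lnK: "L \<le> ln (real (K n))"
    proof -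
      have "1 \<le> exp (- L) * real (r n)" using elim by simp
      then have "exp L \<le> real (r n)" by (simp add: exp_minus field_simps)
      also have "\<dots> \<le> real (K n)" using r_range[of n] elim by simp
      finally show ?thesis by (subst ln_ge_iff) (use r_range[of n] elim in auto)
    qed
    have cB: "sup_ch1_inv (K n) (V n) (r n) * (M + 1 / (80 * C))\<^sup>2 \<le> real n * (\<epsilon> n)\<^sup>2 / 400"
      using elim S unfolding B_def rate_def S_def[symmetric] by (simp add: field_simps)
    have cDelta: "C * tail_sum (K n) (\<beta>s n) (r n) \<le> (\<epsilon> n)\<^sup>2 / 80"
      using elim C unfolding \<Delta>_def by (simp add: field_simps)
    have e: "0 < \<epsilon> n" "\<epsilon> n \<le> 1" using \<epsilon>_range elim by auto
    have rest: "real (rbar n) * ln (1 / (\<epsilon> n)\<^sup>2) \<le> real n * (\<epsilon> n)\<^sup>2 / 400"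
      "real (rbar n) * ln (real (K n)) \<le> real n * (\<epsilon> n)\<^sup>2 / 400"
      "real (rbar n) * ln (growth_D a b (real (rbar n) * sqrt (real n * (\<epsilon> n)\<^sup>2 * sup_ch1_upto (K n) (V n) (rbar n)))) \<le> real n * (\<epsilon> n)\<^sup>2 / 400"
      "real (r n) * ln (sup_ch1 (K n) (V n) (r n)) \<le> real n * (\<epsilon> n)\<^sup>2 / 400"
      "160 \<le> real n * (\<epsilon> n)\<^sup>2"
      using elim unfolding rate_def Btilde_def Bbar_def by simp_all
    note res = m.finite_sample_rate[OF e C chi lnK[unfolded L_def] rest(1-3) cB rest(4) cDelta rest(5)]
    show ?case
      unfolding Pstar_def pstar_def post_def d_def f_def rate_def
      by (intro conjI res)
  qed
  show ?thesis
  proof (intro conjI)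
    show "\<exists>c1>0. \<forall>\<^sub>F n in sequentially. measure (Pstar n) {D \<in> space (Pstar n). post n D {\<theta>. d n \<theta> > \<epsilon> n} \<ge> exp (- 0.5 * c1 * rate n)} \<le> exp (- 0.5 * c1 * rate n)"
      by (rule exI[of _ "1 / 80"]) (use main in \<open>auto elim!: eventually_mono\<close>)
    show "\<exists>c1>0. \<forall>\<^sub>F n in sequentially. (\<integral>D. post n D {\<theta>. d n \<theta> > \<epsilon> n} \<partial>Pstar n) \<le> exp (- c1 * rate n)"
      by (rule exI[of _ "1 / 80"]) (use main in \<open>auto elim!: eventually_mono\<close>)
    have "?post \<longlonglongrightarrow> 1"
    proof (rule tendsto_sandwich)
      show "\<forall>\<^sub>F n in sequentially. 1 - 160 * (1 / rate n) \<le> ?post n"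
        using main rate_pos
      proof eventually_elim
        case (elim n)
        \<comment> \<open>\<open>exp (- t) \<le> 1 / t\<close> turns the limit into the hypothesis that \<open>1 / rate\<close> tends to 0.\<close>
        have "rate n / 160 \<le> exp (rate n / 160)" using exp_ge_add_one_self[of "rate n / 160"] by linarith
        then have "exp (- (1 / 160) * rate n) \<le> 160 * (1 / rate n)"
          using elim by (simp add: exp_minus field_simps)
        then show ?case using elim by linarith
      qed
      show "\<forall>\<^sub>F n in sequentially. ?post n \<le> 1" using main by eventually_elim simp
      have "(\<lambda>n. 1 - 160 * (1 / rate n)) \<longlonglongrightarrow> 1 - 160 * 0"
        using rate_large unfolding seq_prec_def by (intro tendsto_intros)
      then show "(\<lambda>n. 1 - 160 * (1 / rate n)) \<longlonglongrightarrow> 1" by simp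
    qed simp
    then show "\<exists>r0>0. (\<lambda>n. measure (Pstar n) {D \<in> space (Pstar n). post n D {\<theta>. d n \<theta> \<le> \<epsilon> n} \<ge> 1 - exp (- r0 * rate n)}) \<longlonglongrightarrow> 1"
      by (intro exI[of _ "1 / 160"]) simp
  qed
qed

end
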